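(* Let $\mathcal{O}=\{t_1,\dots,t_\mu\}$ be an order ideal in $\mathbb{T}^n$, and let $\Delta=\#\{i\in\{1,\dots,\mu\}\mid\deg(t_i)=\deg(t_\mu)\}$. Let $I(\mathbb{B}^{\mathrm{df}}_{\mathcal{O}})=I(\mathbb{B}_{\mathcal{O}})+I^{\mathrm{df}}_{\mathcal{O}}$. For $i=1,\dots,\mu$ let $M^{\mathrm{hom}}_{t_i}=t_i(\mathcal{A}^{\mathrm{hom}}_1,\dots,\mathcal{A}^{\mathrm{hom}}_n)$, where $\mathcal{A}^{\mathrm{hom}}_1,\dots,\mathcal{A}^{\mathrm{hom}}_n$ are the generic homogeneous multiplication matrices. For $j=1,\dots,\Delta$ let $V_j\in\mathrm{Mat}_\mu(K[C])$ be the matrix whose $i$-th column is the $(\mu-\Delta+j)$-th column of $(M^{\mathrm{hom}}_{t_i})^{\mathrm{tr}}$ for $i=1,\dots,\mu$. Let $W=\mathrm{Col}(V_1,\dots,V_\Delta)$ be the block column matrix, and let $J$ be the ideal of $K[C]$ generated by the maximal minors of $W$. Then the ideal $I(\mathbb{B}^{\mathrm{df}}_{\mathcal{O}})+J$ defines a closed subscheme $\mathrm{NonSCB}^{\mathrm{df}}_{\mathcal{O}}$ of $\mathbb{B}^{\mathrm{df}}_{\mathcal{O}}$ whose $K$-rational points represent exactly the 0-dimensional subschemes of $\mathbb{A}^n_K$ which have a degree filtered $\mathcal{O}$-border basis, but are not strict Cayley-Bacharach schemes.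
   Context: $K$ is an arbitrary field, $P=K[x_1,\dots,x_n]$, and $\mathbb{T}^n$ is the monoid of terms (power products) in $x_1,\dots,x_n$. An order ideal is a finite set $\mathcal{O}=\{t_1,\dots,t_\mu\}\subset\mathbb{T}^n$ with $\mu\ge 1$ containing every divisor in $\mathbb{T}^n$ of each of its elements; it is always ordered so that $\deg(t_1)\le\cdots\le\deg(t_\mu)$, hence $t_1=1$. Its border is $\partial\mathcal{O}=(x_1\mathcal{O}\cup\cdots\cup x_n\mathcal{O})\setminus\mathcal{O}=\{b_1,\dots,b_\nu\}$. Let $C=\{c_{ij}\mid 1\le i\le\mu,\ 1\le j\le\nu\}$ be new indeterminates. The $r$-th generic multiplication matrix $\mathcal{A}_r=(a^{(r)}_{ij})\in\mathrm{Mat}_\mu(K[C])$ has $a^{(r)}_{ij}=\delta_{im}$ if $x_rt_j=t_m$ and $a^{(r)}_{ij}=c_{im}$ if $x_rt_j=b_m$. $I(\mathbb{B}_{\mathcal{O}})\subseteq K[C]$ is generated by the entries of all commutators $\mathcal{A}_r\mathcal{A}_s-\mathcal{A}_s\mathcal{A}_r$, and the border basis scheme $\mathbb{B}_{\mathcal{O}}\subseteq\mathrm{Spec}(K[C])$ is the closed subscheme it defines. For a $K$-rational point $\Gamma=(\gamma_{ij})$ of $\mathbb{B}_{\mathcal{O}}$, let $I_\Gamma\subset P$ be generated by $b_j-\sum_i\gamma_{ij}t_i$; $\Gamma$ represents the 0-dimensional scheme $\mathbb{X}_\Gamma\subset\mathbb{A}^n_K$ with vanishing ideal $I_\Gamma$.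 $I^{\mathrm{df}}_{\mathcal{O}}\subseteq K[C]$ is generated by all $c_{ij}$ with $\deg(t_i)>\deg(b_j)$; $\mathbb{B}^{\mathrm{df}}_{\mathcal{O}}$ is the closed subscheme of $\mathbb{B}_{\mathcal{O}}$ defined by $I(\mathbb{B}_{\mathcal{O}})+I^{\mathrm{df}}_{\mathcal{O}}$. $\mathcal{A}^{\mathrm{hom}}_r$ is obtained from $\mathcal{A}_r$ by setting all $c_{ij}$ with $\deg(t_i)\ne\deg(b_j)$ to zero. For a term $t=x_1^{\alpha_1}\cdots x_n^{\alpha_n}$, $t(M_1,\dots,M_n)=M_1^{\alpha_1}\cdots M_n^{\alpha_n}$. For a 0-dimensional subscheme $\mathbb{X}\subset\mathbb{A}^n_K$ with vanishing ideal $I_{\mathbb{X}}$ put $R_{\mathbb{X}}=P/I_{\mathbb{X}}$, let $F_iR_{\mathbb{X}}$ be the image of the polynomials of degree $\le i$ (including $0$), let $\mathrm{ord}_{\mathcal{F}}(f)=\min\{i\mid f\in F_iR_{\mathbb{X}}\}$ for $f\neq 0$, and let $\mathrm{ri}(R_{\mathbb{X}})=\min\{i\in\mathbb{Z}\mid F_jR_{\mathbb{X}}=R_{\mathbb{X}}\text{ for all }j\ge i\}$. $\mathbb{X}$ has a degree filtered $\mathcal{O}$-border basis if for every $i\ge 0$ the residue classes of the elements of $\mathcal{O}$ of degree $\le i$ form a $K$-basis of $F_iR_{\mathbb{X}}$. The associated graded ring is $\mathrm{gr}_{\mathcal{F}}(R_{\mathbb{X}})=\bigoplus_i F_iR_{\mathbb{X}}/F_{i-1}R_{\mathbb{X}}\cong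 P/\mathrm{DF}(I_{\mathbb{X}})$, where $\mathrm{DF}(I_{\mathbb{X}})$ is generated by the top-degree homogeneous components of the non-zero elements of $I_{\mathbb{X}}$. Cayley-Bacharach property: let $I_{\mathbb{X}}=\mathfrak{Q}_1\cap\cdots\cap\mathfrak{Q}_s$ be the primary decomposition with $\mathfrak{Q}_i$ being $\mathfrak{M}_i$-primary, $\mathfrak{M}_i$ maximal, and let $\mathfrak{m}_i$ be the image of $\mathfrak{M}_i$ in $R_{\mathbb{X}}$. A minimal $\mathfrak{Q}_i$-divisor of $I_{\mathbb{X}}$ is an ideal $J=\mathfrak{Q}_1\cap\cdots\cap\mathfrak{Q}'_i\cap\cdots\cap\mathfrak{Q}_s$ with $\mathfrak{Q}_i\subset\mathfrak{Q}'_i\subseteq\mathfrak{M}_i$ (for $\mathfrak{Q}_i=\mathfrak{M}_i$ one takes $\mathfrak{Q}'_i=P$) and $\dim_K(\mathfrak{Q}'_i/\mathfrak{Q}_i)=\dim_K(P/\mathfrak{M}_i)$. Put $\mathrm{ri}(J/I_{\mathbb{X}})=\max\{\mathrm{ord}_{\mathcal{F}}(f)\mid f\in J/I_{\mathbb{X}}\setminus\{0\}\}$, and let $\mathrm{sepdeg}(\mathfrak{m}_i)$ be the minimum of $\mathrm{ri}(J/I_{\mathbb{X}})$ over all minimal $\mathfrak{Q}_i$-divisors $J$. $R_{\mathbb{X}}$ has the Cayley-Bacharach property if $\mathrm{sepdeg}(\mathfrak{m}_i)=\mathrm{ri}(R_{\mathbb{X}})$ for all $i$. $\mathbb{X}$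 is a strict Cayley-Bacharach scheme if $\mathrm{gr}_{\mathcal{F}}(R_{\mathbb{X}})=P/\mathrm{DF}(I_{\mathbb{X}})$ has the Cayley-Bacharach property. Conventions: statements about $K$-rational points may be read for $L$-rational points for any field extension $L\supseteq K$; an ideal is said to define a subscheme up to radical. *)

theory Defs
  imports
    "HOL-Library.Poly_Mapping"
    "HOL-Algebra.QuotRing"
    "HOL-Algebra.Embedded_Algebras"
    "Jordan_Normal_Form.Determinant"
    "Jordan_Normal_Form.DL_Submatrix"
    "Jordan_Normal_Form.Ring_Hom_Matrix"
begin

section \<open>Terms and polynomial rings\<close>

text \<open>
  A term is its exponent function, so the product of terms is \<open>+\<close> and the term \<open>1\<close> is \<open>0\<close>.
  All indices start at \<open>0\<close>: the indeterminates of \<open>P\<close> are indexed by \<open>{..<n}\<close>, those of \<open>K[C]\<close>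
  by \<open>{..<\<mu>} \<times> {..<\<nu>}\<close>.
\<close>

type_synonym 'v trm = "'v \<Rightarrow>\<^sub>0 nat"
type_synonym ('v, 'k) mpoly = "('v \<Rightarrow>\<^sub>0 nat) \<Rightarrow>\<^sub>0 'k"

definition tdeg :: "'v trm \<Rightarrow> nat" where
  "tdeg t = (\<Sum>v\<in>Poly_Mapping.keys t. Poly_Mapping.lookup t v)"

definition var_trm :: "'v \<Rightarrow> 'v trm" where
  "var_trm v = Poly_Mapping.single v 1"

definition trm_poly :: "'v trm \<Rightarrow> ('v, 'k::field) mpoly" where
  "trm_poly t = Poly_Mapping.single t 1"

definition const_poly :: "'k \<Rightarrow> ('v, 'k::field) mpoly" where
  "const_poly c = Poly_Mapping.single 0 c"

definition poly_ring :: "'v set \<Rightarrow> ('v, 'k::field) mpoly ring" where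
  "poly_ring V =
     \<lparr>carrier = {f. \<forall>m\<in>Poly_Mapping.keys f. Poly_Mapping.keys m \<subseteq> V},
      monoid.mult = (*), one = 1, zero = 0, add = (+)\<rparr>"

abbreviation PR :: "nat \<Rightarrow> (nat, 'k::field) mpoly ring" where
  "PR n \<equiv> poly_ring {..<n}"

definition hom_comp :: "nat \<Rightarrow> ('v, 'k::field) mpoly \<Rightarrow> ('v, 'k) mpoly" where
  "hom_comp d f = (\<Sum>m \<in> {m \<in> Poly_Mapping.keys f. tdeg m = d}.
                     Poly_Mapping.single m (Poly_Mapping.lookup f m))"

definition pdeg :: "('v, 'k::field) mpoly \<Rightarrow> nat" where
  "pdeg f = Max (tdeg ` Poly_Mapping.keys f)"

definition eval_mpoly :: "('k::field \<Rightarrow> 'l::field) \<Rightarrow> ('v \<Rightarrow> 'l) \<Rightarrow> ('v, 'k) mpoly \<Rightarrow> 'l" where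
  "eval_mpoly \<iota> \<gamma> f =
     (\<Sum>m\<in>Poly_Mapping.keys f. \<iota> (Poly_Mapping.lookup f m) *
        (\<Prod>v\<in>Poly_Mapping.keys m. \<gamma> v ^ Poly_Mapping.lookup m v))"


section \<open>Order ideals and borders\<close>

definition trms :: "nat \<Rightarrow> nat trm set" where
  "trms n = {t. Poly_Mapping.keys t \<subseteq> {..<n}}"

definition trm_divides :: "'v trm \<Rightarrow> 'v trm \<Rightarrow> bool" where
  "trm_divides s t \<longleftrightarrow> (\<exists>u. t = s + u)"

definition order_ideal :: "nat \<Rightarrow> nat trm set \<Rightarrow> bool" where
  "order_ideal n O' \<longleftrightarrow> finite O' \<and> O' \<noteq> {} \<and> O' \<subseteq> trms n \<and>
     (\<forall>t\<in>O'. \<forall>s\<in>trms n. trm_divides s t \<longrightarrow> s \<in> O')"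

definition border :: "nat \<Rightarrow> nat trm set \<Rightarrow> nat trm set" where
  "border n O' = (\<Union>r<n. (\<lambda>t. var_trm r + t) ` O') - O'"


section \<open>Generic multiplication matrices and the border basis scheme\<close>

text \<open>
  An order ideal and its border are given by enumerations \<open>ts\<close> and \<open>bs\<close>, and \<open>c (i, j)\<close> is the
  indeterminate \<open>c\<^sub>i\<^sub>j\<close> in \<^term>\<open>gen_mult_mat\<close>, or \<open>0\<close> if it is set to zero, as in
  \<^term>\<open>hom_mult_mat\<close>.
\<close>

type_synonym 'k cpoly = "(nat \<times> nat, 'k) mpoly"

abbreviation KC :: "nat trm list \<Rightarrow> nat trm list \<Rightarrow> 'k::field cpoly ring" where
  "KC ts bs \<equiv> poly_ring ({..<length ts} \<times> {..<length bs})"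

definition cvar :: "nat \<times> nat \<Rightarrow> 'k::field cpoly" where
  "cvar p = trm_poly (var_trm p)"

definition mult_mat_with ::
  "nat trm list \<Rightarrow> nat trm list \<Rightarrow> (nat \<times> nat \<Rightarrow> 'k::field cpoly) \<Rightarrow> nat \<Rightarrow> 'k cpoly mat" where
  "mult_mat_with ts bs c r = mat (length ts) (length ts) (\<lambda>(i, j).
     let t = var_trm r + ts ! j in
     if t \<in> set ts then (if t = ts ! i then 1 else 0)
     else c (i, THE m. m < length bs \<and> bs ! m = t))"

definition gen_mult_mat :: "nat trm list \<Rightarrow> nat trm list \<Rightarrow> nat \<Rightarrow> 'k::field cpoly mat" where
  "gen_mult_mat ts bs = mult_mat_with ts bs cvar"

definition hom_mult_mat :: "nat trm list \<Rightarrow> nat trm list \<Rightarrow> nat \<Rightarrow> 'k::field cpoly mat" where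
  "hom_mult_mat ts bs =
     mult_mat_with ts bs (\<lambda>(i, j). if tdeg (ts ! i) = tdeg (bs ! j) then cvar (i, j) else 0)"

definition I_border :: "nat \<Rightarrow> nat trm list \<Rightarrow> nat trm list \<Rightarrow> 'k::field cpoly set" where
  "I_border n ts bs = genideal (KC ts bs)
     (\<Union>r<n. \<Union>s<n. elements_mat
        (gen_mult_mat ts bs r * gen_mult_mat ts bs s - gen_mult_mat ts bs s * gen_mult_mat ts bs r))"

definition I_df :: "nat trm list \<Rightarrow> nat trm list \<Rightarrow> 'k::field cpoly set" where
  "I_df ts bs = genideal (KC ts bs)
     {cvar (i, j) | i j. i < length ts \<and> j < length bs \<and> tdeg (ts ! i) > tdeg (bs ! j)}"

definition I_border_df :: "nat \<Rightarrow> nat trm list \<Rightarrow> nat trm list \<Rightarrow> 'k::field cpoly set" where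
  "I_border_df n ts bs = I_border n ts bs <+>\<^bsub>KC ts bs\<^esub> I_df ts bs"


section \<open>The matrix W and the ideal of its maximal minors\<close>

text \<open>
  The matrices \<open>M\<^sub>1, \<dots>, M\<^sub>n\<close> need not commute over \<open>K[C]\<close>, so the order of the factors in
  \<open>M\<^sub>1\<^bsup>\<alpha>\<^sub>1\<^esup> \<cdots> M\<^sub>n\<^bsup>\<alpha>\<^sub>n\<^esup>\<close> matters.
\<close>

definition eval_trm_mat :: "nat \<Rightarrow> nat \<Rightarrow> (nat \<Rightarrow> 'a::comm_ring_1 mat) \<Rightarrow> nat trm \<Rightarrow> 'a mat" where
  "eval_trm_mat n d M t = foldr (\<lambda>r N. (M r ^\<^sub>m Poly_Mapping.lookup t r) * N) [0..<n] (1\<^sub>m d)"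

definition M_hom :: "nat \<Rightarrow> nat trm list \<Rightarrow> nat trm list \<Rightarrow> nat trm \<Rightarrow> 'k::field cpoly mat" where
  "M_hom n ts bs t = eval_trm_mat n (length ts) (hom_mult_mat ts bs) t"

definition Delta :: "nat trm list \<Rightarrow> nat" where
  "Delta ts = card {i. i < length ts \<and> tdeg (ts ! i) = tdeg (last ts)}"

definition V_mat :: "nat \<Rightarrow> nat trm list \<Rightarrow> nat trm list \<Rightarrow> nat \<Rightarrow> 'k::field cpoly mat" where
  "V_mat n ts bs j = mat_of_cols (length ts)
     (map (\<lambda>i. col (transpose_mat (M_hom n ts bs (ts ! i))) (length ts - Delta ts + j))
        [0..<length ts])"

definition W_mat :: "nat \<Rightarrow> nat trm list \<Rightarrow> nat trm list \<Rightarrow> 'k::field cpoly mat" where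
  "W_mat n ts bs = foldr append_rows (map (V_mat n ts bs) [0..<Delta ts]) (0\<^sub>m 0 (length ts))"

definition maximal_minors :: "'a::comm_ring_1 mat \<Rightarrow> 'a set" where
  "maximal_minors A = {det (submatrix A I J) | I J.
     I \<subseteq> {..<dim_row A} \<and> J \<subseteq> {..<dim_col A} \<and>
     card I = min (dim_row A) (dim_col A) \<and> card J = min (dim_row A) (dim_col A)}"

definition J_minors :: "nat \<Rightarrow> nat trm list \<Rightarrow> nat trm list \<Rightarrow> 'k::field cpoly set" where
  "J_minors n ts bs = genideal (KC ts bs) (maximal_minors (W_mat n ts bs))"

definition I_NonSCB :: "nat \<Rightarrow> nat trm list \<Rightarrow> nat trm list \<Rightarrow> 'k::field cpoly set" where
  "I_NonSCB n ts bs = I_border_df n ts bs <+>\<^bsub>KC ts bs\<^esub> J_minors n ts bs"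


section \<open>Rational points and the schemes they represent\<close>

text \<open>
  The \<open>L\<close>-rational points, for a field extension \<open>\<iota> : K \<rightarrow> L\<close>, of the closed subscheme of
  \<open>Spec K[C]\<close> defined by \<open>I\<close>.
\<close>

definition rational_points ::
  "('k::field \<Rightarrow> 'l::field) \<Rightarrow> nat trm list \<Rightarrow> nat trm list \<Rightarrow> 'k cpoly set \<Rightarrow> 'l mat set" where
  "rational_points \<iota> ts bs I =
     {\<Gamma> \<in> carrier_mat (length ts) (length bs). \<forall>f\<in>I. eval_mpoly \<iota> (\<lambda>(i, j). \<Gamma> $$ (i, j)) f = 0}"

text \<open>A closed subscheme of affine \<open>n\<close>-space is given by its vanishing ideal in \<^term>\<open>PR n\<close>.\<close>

definition I_pt :: "nat \<Rightarrow> nat trm list \<Rightarrow> nat trm list \<Rightarrow> 'l::field mat \<Rightarrow> (nat, 'l) mpoly set" where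
  "I_pt n ts bs \<Gamma> = genideal (PR n)
     {trm_poly (bs ! j) - (\<Sum>i<length ts. const_poly (\<Gamma> $$ (i, j)) * trm_poly (ts ! i)) | j. j < length bs}"


section \<open>The affine coordinate ring and its degree filtration\<close>

abbreviation RX :: "nat \<Rightarrow> (nat, 'k::field) mpoly set \<Rightarrow> (nat, 'k) mpoly set ring" where
  "RX n I \<equiv> PR n Quot I"

abbreviation residue :: "nat \<Rightarrow> (nat, 'k::field) mpoly set \<Rightarrow> (nat, 'k) mpoly \<Rightarrow> (nat, 'k) mpoly set" where
  "residue n I f \<equiv> I +>\<^bsub>PR n\<^esub> f"

text \<open>The copy of \<open>K\<close> inside \<^term>\<open>RX n I\<close>.\<close>

definition K_in :: "nat \<Rightarrow> (nat, 'k::field) mpoly set \<Rightarrow> (nat, 'k) mpoly set set" where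
  "K_in n I = range (\<lambda>c. residue n I (const_poly c))"

definition zero_dim_scheme :: "nat \<Rightarrow> (nat, 'k::field) mpoly set \<Rightarrow> bool" where
  "zero_dim_scheme n I \<longleftrightarrow> ideal I (PR n) \<and> I \<noteq> carrier (PR n) \<and>
     ring.finite_dimension (RX n I) (K_in n I) (carrier (RX n I))"

text \<open>
  The filtration is indexed by \<^typ>\<open>int\<close>; its pieces of negative index are the zero subspace,
  the class of the polynomial \<open>0\<close>.
\<close>

definition filt :: "nat \<Rightarrow> (nat, 'k::field) mpoly set \<Rightarrow> int \<Rightarrow> (nat, 'k) mpoly set set" where
  "filt n I i = residue n I `
     {f \<in> carrier (PR n). \<forall>m\<in>Poly_Mapping.keys f. int (tdeg m) \<le> i}"

definition ord_filt :: "nat \<Rightarrow> (nat, 'k::field) mpoly set \<Rightarrow> (nat, 'k) mpoly set \<Rightarrow> int" where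
  "ord_filt n I v = (LEAST i. v \<in> filt n I i)"

definition reg_index :: "nat \<Rightarrow> (nat, 'k::field) mpoly set \<Rightarrow> int" where
  "reg_index n I = (LEAST i. \<forall>j\<ge>i. filt n I j = carrier (RX n I))"

definition df_border_basis :: "nat \<Rightarrow> nat trm list \<Rightarrow> (nat, 'k::field) mpoly set \<Rightarrow> bool" where
  "df_border_basis n ts I \<longleftrightarrow> (\<forall>i\<ge>0.
     let Us = map (\<lambda>t. residue n I (trm_poly t)) (filter (\<lambda>t. int (tdeg t) \<le> i) ts) in
     ring.independent (RX n I) (K_in n I) Us \<and> ring.Span (RX n I) (K_in n I) Us = filt n I i)"

definition DF :: "nat \<Rightarrow> (nat, 'k::field) mpoly set \<Rightarrow> (nat, 'k) mpoly set" where
  "DF n I = genideal (PR n) {hom_comp (pdeg f) f | f. f \<in> I \<and> f \<noteq> 0}"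


section \<open>The Cayley-Bacharach property\<close>

text \<open>\<^term>\<open>primary_to Q M R\<close> says that \<open>Q\<close> is an \<open>M\<close>-primary ideal of \<open>R\<close>.\<close>

definition primary_to :: "'a set \<Rightarrow> 'a set \<Rightarrow> 'a ring \<Rightarrow> bool" where
  "primary_to Q M R \<longleftrightarrow> ideal Q R \<and> Q \<noteq> carrier R \<and>
     (\<forall>a\<in>carrier R. \<forall>b\<in>carrier R. a \<otimes>\<^bsub>R\<^esub> b \<in> Q \<longrightarrow> a \<in> Q \<or> (\<exists>k::nat. b [^]\<^bsub>R\<^esub> k \<in> Q)) \<and>
     M = {a \<in> carrier R. \<exists>k::nat. a [^]\<^bsub>R\<^esub> k \<in> Q}"

definition primary_decomposition ::
  "nat \<Rightarrow> (nat, 'k::field) mpoly set \<Rightarrow> (nat, 'k) mpoly set list \<Rightarrow> (nat, 'k) mpoly set list \<Rightarrow> bool" where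
  "primary_decomposition n I Qs Ms \<longleftrightarrow> length Qs = length Ms \<and> distinct Ms \<and>
     (\<forall>i<length Ms. maximalideal (Ms ! i) (PR n) \<and> primary_to (Qs ! i) (Ms ! i) (PR n)) \<and>
     I = \<Inter> (set Qs)"

definition minimal_divisors ::
  "nat \<Rightarrow> (nat, 'k::field) mpoly set list \<Rightarrow> (nat, 'k) mpoly set list \<Rightarrow> nat \<Rightarrow> (nat, 'k) mpoly set set" where
  "minimal_divisors n Qs Ms i =
     {\<Inter> (set (Qs[i := Q'])) | Q'. ideal Q' (PR n) \<and>
        (if Qs ! i = Ms ! i then Q' = carrier (PR n) else Qs ! i \<subset> Q' \<and> Q' \<subseteq> Ms ! i) \<and>
        (\<exists>d. ring.dimension (RX n (Qs ! i)) d (K_in n (Qs ! i)) (residue n (Qs ! i) ` Q') \<and>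
             ring.dimension (RX n (Ms ! i)) d (K_in n (Ms ! i)) (carrier (RX n (Ms ! i))))}"

definition reg_index_divisor ::
  "nat \<Rightarrow> (nat, 'k::field) mpoly set \<Rightarrow> (nat, 'k) mpoly set \<Rightarrow> int" where
  "reg_index_divisor n I J =
     Max (ord_filt n I ` (residue n I ` J - {\<zero>\<^bsub>RX n I\<^esub>}))"

definition sepdeg ::
  "nat \<Rightarrow> (nat, 'k::field) mpoly set \<Rightarrow> (nat, 'k) mpoly set list \<Rightarrow> (nat, 'k) mpoly set list \<Rightarrow> nat \<Rightarrow> int" where
  "sepdeg n I Qs Ms i = Min (reg_index_divisor n I ` minimal_divisors n Qs Ms i)"

text \<open>
  The primary decomposition of a 0-dimensional ideal with pairwise distinct \<open>M\<^sub>i\<close> exists and is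
  unique up to the numbering of the components.
\<close>

definition cayley_bacharach :: "nat \<Rightarrow> (nat, 'k::field) mpoly set \<Rightarrow> bool" where
  "cayley_bacharach n I \<longleftrightarrow> (\<forall>Qs Ms. primary_decomposition n I Qs Ms \<longrightarrow>
     (\<forall>i<length Ms. sepdeg n I Qs Ms i = reg_index n I))"

text \<open>The ring \<^term>\<open>RX n (DF n I)\<close> is the associated graded ring of \<^term>\<open>RX n I\<close>.\<close>

definition strict_cayley_bacharach :: "nat \<Rightarrow> (nat, 'k::field) mpoly set \<Rightarrow> bool" where
  "strict_cayley_bacharach n I \<longleftrightarrow> cayley_bacharach n (DF n I)"

end

theory Submission
  imports Defs
begin

text \<open>
  The proof rests on one observation about each of the three sides of the statement.

  \<^item> Points. Let \<open>A\<^sub>r\<close> be the generic multiplication matrices evaluated at \<open>\<Gamma>\<close>. If they commute, they make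
  \<open>K\<^sup>\<mu>\<close> a module over \<open>P\<close>, generated by the first unit vector. The coordinates \<open>phi f\<close> of the
  image of that vector under \<open>f\<close> are a normal form of \<open>f\<close> modulo \<open>I\<^sub>\<Gamma>\<close>, and
  \<open>I\<^sub>\<Gamma>\<close> is the kernel of \<open>phi\<close> (\<open>mem_I_pt_iff\<close>). If moreover \<open>\<gamma>\<^sub>i\<^sub>j = 0\<close> whenever
  \<open>deg t\<^sub>i > deg b\<^sub>j\<close>, normal forms do not raise the degree, so that the border basis is
  degree filtered. Conversely, the normal forms of the border terms modulo an ideal with a degree
  filtered border basis give a point (\<open>df_border_basis_imp_point\<close>).

  \<^item> The associated graded ring. Setting to zero the entries of \<open>\<Gamma>\<close> with \<open>deg t\<^sub>i \<noteq> deg b\<^sub>j\<close>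
  keeps the part of each \<open>A\<^sub>r\<close> that raises degrees by exactly one. These parts commute again, and
  they describe multiplication modulo \<open>DF(I\<^sub>\<Gamma>)\<close> (\<open>DF_I_pt\<close>).

  \<^item> The Cayley-Bacharach property. The ring \<open>G = P/DF(I\<^sub>\<Gamma>)\<close> is local, its minimal divisors are
  the lines in its socle, and its regularity index is \<open>d = deg t\<^sub>\<mu>\<close>. So the property fails
  iff some nonzero socle element has order less than \<open>d\<close> (\<open>cayley_bacharach_iff\<close>). A nonzero ideal
  of \<open>G\<close> contains a nonzero socle element, and a socle element generates a line; hence the property
  fails iff there is \<open>f \<noteq> 0\<close> with \<open>f G \<subseteq> F\<^bsub>d-1\<^esub> G\<close> (\<open>not_strict_cayley_bacharach_iff\<close>).
  For \<open>f = v\<^sub>1 t\<^sub>1 + \<cdots> + v\<^sub>\<mu> t\<^sub>\<mu>\<close> this inclusion says that the last \<open>\<Delta>\<close> coordinates of all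
  products \<open>f t\<^sub>k\<close> vanish, which is the system \<open>W v = 0\<close> at \<open>\<Gamma>\<close> (\<open>W_kernel_iff\<close>).

  A matrix over a field with at least as many rows as columns has a nontrivial kernel iff its
  maximal minors vanish (\<open>maximal_minors_zero_iff\<close>), and this gives the ideal of the theorem. The
  argument holds over any field that contains the coordinates of \<open>\<Gamma>\<close>, so \<open>K\<close>-rational and
  \<open>L\<close>-rational points are treated at once.
\<close>

section \<open>Terms\<close>

lemma tdeg_superset:
  assumes "finite S" "Poly_Mapping.keys t \<subseteq> S"
  shows "tdeg t = (\<Sum>v\<in>S. Poly_Mapping.lookup t v)"
  unfolding tdeg_def using assms
  by (intro sum.mono_neutral_left) (auto simp: in_keys_iff)

lemma keys_trm_add:
  "Poly_Mapping.keys (s + t :: 'v trm) = Poly_Mapping.keys s \<union> Poly_Mapping.keys t"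
  by (auto simp: in_keys_iff lookup_add)

lemma tdeg_0 [simp]: "tdeg 0 = 0"
  by (simp add: tdeg_def)

lemma tdeg_add [simp]: "tdeg (s + t) = tdeg s + tdeg t"
proof -
  let ?S = "Poly_Mapping.keys s \<union> Poly_Mapping.keys t"
  have "tdeg (s + t) = (\<Sum>v\<in>?S. Poly_Mapping.lookup (s + t) v)"
    by (rule tdeg_superset) (auto simp: keys_trm_add)
  then show ?thesis
    by (simp add: lookup_add sum.distrib tdeg_superset[of ?S s] tdeg_superset[of ?S t])
qed

lemma tdeg_var [simp]: "tdeg (var_trm r) = 1"
  by (simp add: tdeg_def var_trm_def)

lemma keys_var [simp]: "Poly_Mapping.keys (var_trm r) = {r}"
  by (simp add: var_trm_def)

lemma trm_split:
  assumes "r \<in> Poly_Mapping.keys t"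
  obtains t' where "t = var_trm r + t'"
proof
  show "t = var_trm r + (t - var_trm r)"
    using assms
    by (intro poly_mapping_eqI) (auto simp: lookup_add lookup_minus var_trm_def lookup_single when_def in_keys_iff)
qed

lemma tdeg_eq_0_iff: "tdeg t = 0 \<longleftrightarrow> t = 0"
  by (auto simp: tdeg_def in_keys_iff poly_mapping_eq_iff fun_eq_iff)

lemma trm_induct [consumes 1, case_names 0 var]:
  assumes "Poly_Mapping.keys t \<subseteq> V"
    and "P 0"
    and "\<And>r t. r \<in> V \<Longrightarrow> Poly_Mapping.keys t \<subseteq> V \<Longrightarrow> P t \<Longrightarrow> P (var_trm r + t)"
  shows "P t"
  using assms(1)
proof (induction "tdeg t" arbitrary: t)
  case 0
  then show ?case using assms(2) by (simp add: tdeg_eq_0_iff)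
next
  case (Suc k)
  then obtain r where r: "r \<in> Poly_Mapping.keys t"
    by (metis tdeg_eq_0_iff keys_eq_empty equals0I nat.distinct(1))
  then obtain t' where t': "t = var_trm r + t'" by (rule trm_split)
  then have "k = tdeg t'" "Poly_Mapping.keys t' \<subseteq> V" "r \<in> V"
    using Suc r by (auto simp: keys_trm_add)
  then show ?case using Suc assms(3) t' by blast
qed

section \<open>Polynomial rings\<close>

abbreviation scaled_trm :: "'k \<Rightarrow> 'v trm \<Rightarrow> ('v, 'k::field) mpoly" where
  "scaled_trm c t \<equiv> Poly_Mapping.single t c"

lemma const_mult_trm: "const_poly c * trm_poly t = scaled_trm c t"
  by (simp add: const_poly_def trm_poly_def mult_single)

lemma poly_eq_sum_scaled_trm:
  assumes "finite S" "Poly_Mapping.keys f \<subseteq> S"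
  shows "f = (\<Sum>m\<in>S. scaled_trm (Poly_Mapping.lookup f m) m)"
proof (rule poly_mapping_eqI)
  fix m
  show "Poly_Mapping.lookup f m = Poly_Mapping.lookup (\<Sum>m\<in>S. scaled_trm (Poly_Mapping.lookup f m) m) m"
    using assms by (auto simp: lookup_sum lookup_single when_def sum.delta in_keys_iff)
qed

lemma poly_carrier: "carrier (poly_ring V) = {f. \<forall>m\<in>Poly_Mapping.keys f. Poly_Mapping.keys m \<subseteq> V}"
  and pr_mult [simp]: "f \<otimes>\<^bsub>poly_ring V\<^esub> g = f * g"
  and pr_add [simp]: "f \<oplus>\<^bsub>poly_ring V\<^esub> g = f + g"
  and pr_one [simp]: "\<one>\<^bsub>poly_ring V\<^esub> = 1"
  and pr_zero [simp]: "\<zero>\<^bsub>poly_ring V\<^esub> = 0"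
  by (simp_all add: poly_ring_def)

lemma poly_carrier_iff: "f \<in> carrier (poly_ring V) \<longleftrightarrow> (\<forall>m\<in>Poly_Mapping.keys f. Poly_Mapping.keys m \<subseteq> V)"
  by (simp add: poly_carrier)

lemma scaled_trm_carrier: "Poly_Mapping.keys t \<subseteq> V \<Longrightarrow> scaled_trm c t \<in> carrier (poly_ring V)"
  by (simp add: poly_carrier_iff)

lemma trm_poly_carrier: "Poly_Mapping.keys t \<subseteq> V \<Longrightarrow> trm_poly t \<in> carrier (poly_ring V)"
  by (simp add: trm_poly_def scaled_trm_carrier)

lemma const_poly_carrier [simp]: "const_poly c \<in> carrier (poly_ring V)"
  by (simp add: const_poly_def poly_carrier_iff)

lemma zero_carrier [simp]: "0 \<in> carrier (poly_ring V)"
  by (simp add: poly_carrier_iff)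

lemma one_carrier [simp]: "1 \<in> carrier (poly_ring V)"
  by (simp add: poly_carrier_iff)

lemma add_carrier: "f \<in> carrier (poly_ring V) \<Longrightarrow> g \<in> carrier (poly_ring V) \<Longrightarrow> f + g \<in> carrier (poly_ring V)"
  using keys_add[of f g] by (fastforce simp: poly_carrier_iff)

lemma mult_carrier: "f \<in> carrier (poly_ring V) \<Longrightarrow> g \<in> carrier (poly_ring V) \<Longrightarrow> f * g \<in> carrier (poly_ring V)"
  using keys_mult[of f g] by (fastforce simp: poly_carrier_iff keys_trm_add)

lemma uminus_carrier: "f \<in> carrier (poly_ring V) \<Longrightarrow> - f \<in> carrier (poly_ring V)"
  by (simp add: poly_carrier_iff in_keys_iff)

lemma diff_carrier: "f \<in> carrier (poly_ring V) \<Longrightarrow> g \<in> carrier (poly_ring V) \<Longrightarrow> f - g \<in> carrier (poly_ring V)"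
  using add_carrier[OF _ uminus_carrier, of f V g] by simp

lemma sum_carrier: "(\<And>i. i \<in> S \<Longrightarrow> f i \<in> carrier (poly_ring V)) \<Longrightarrow> sum f S \<in> carrier (poly_ring V)"
  by (induction S rule: infinite_finite_induct) (auto intro: add_carrier)

lemma prod_carrier: "(\<And>i. i \<in> S \<Longrightarrow> f i \<in> carrier (poly_ring V)) \<Longrightarrow> prod f S \<in> carrier (poly_ring V)"
  by (induction S rule: infinite_finite_induct) (auto intro: mult_carrier)

lemma power_carrier: "f \<in> carrier (poly_ring V) \<Longrightarrow> f ^ k \<in> carrier (poly_ring V)"
  by (induction k) (auto intro: mult_carrier)

lemmas carrier_intros = scaled_trm_carrier trm_poly_carrier add_carrier mult_carrier uminus_carrier diff_carrier
  sum_carrier prod_carrier power_carrier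

lemma poly_ring_cring: "cring (poly_ring V)"
proof (rule cringI)
  show "abelian_group (poly_ring V)"
  proof (rule abelian_groupI)
    fix f assume "f \<in> carrier (poly_ring V)"
    then show "\<exists>y\<in>carrier (poly_ring V). y \<oplus>\<^bsub>poly_ring V\<^esub> f = \<zero>\<^bsub>poly_ring V\<^esub>"
      by (intro bexI[of _ "- f"]) (auto intro: uminus_carrier)
  qed (auto simp: add.assoc add.commute intro: add_carrier)
  show "Group.comm_monoid (poly_ring V)"
    by (rule comm_monoidI) (auto simp: mult.assoc mult.commute intro: mult_carrier)
qed (simp add: distrib_right)

lemma poly_ring_ring: "ring (poly_ring V)"
  using poly_ring_cring by (rule cring.axioms(1))

lemma poly_uminus:
  assumes "f \<in> carrier (poly_ring V)" shows "\<ominus>\<^bsub>poly_ring V\<^esub> f = - f"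
proof -
  interpret ring "poly_ring V" by (rule poly_ring_ring)
  show ?thesis using minus_equality[of "- f" f] assms uminus_carrier[of f V] by simp
qed

lemma poly_minus:
  assumes "f \<in> carrier (poly_ring V)" "g \<in> carrier (poly_ring V)"
  shows "f \<ominus>\<^bsub>poly_ring V\<^esub> g = f - g"
  using assms by (simp add: a_minus_def poly_uminus)

lemma poly_pow: "f [^]\<^bsub>poly_ring V\<^esub> (k::nat) = f ^ k"
proof -
  interpret ring "poly_ring V" by (rule poly_ring_ring)
  show ?thesis by (induction k) (simp_all add: mult.commute)
qed

lemma poly_idealI:
  assumes "I \<subseteq> carrier (poly_ring V)" "0 \<in> I"
    and "\<And>f g. f \<in> I \<Longrightarrow> g \<in> I \<Longrightarrow> f + g \<in> I"
    and "\<And>f g. f \<in> carrier (poly_ring V) \<Longrightarrow> g \<in> I \<Longrightarrow> f * g \<in> I"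
  shows "ideal I (poly_ring V)"
proof (rule idealI)
  show "ring (poly_ring V)" by (rule poly_ring_ring)
  interpret ring "poly_ring V" by (rule poly_ring_ring)
  show "subgroup I (add_monoid (poly_ring V))"
  proof (rule add.subgroupI)
    fix f assume f: "f \<in> I"
    then have "(- 1) * f \<in> I" by (intro assms(4)) (auto intro: carrier_intros)
    then show "\<ominus>\<^bsub>poly_ring V\<^esub> f \<in> I" using f assms(1) by (simp add: poly_uminus subset_iff)
  qed (use assms in auto)
next
  fix f g :: "('a, 'b) mpoly" assume "f \<in> I" "g \<in> carrier (poly_ring V)"
  then show "g \<otimes>\<^bsub>poly_ring V\<^esub> f \<in> I" "f \<otimes>\<^bsub>poly_ring V\<^esub> g \<in> I"
    using assms(4)[of g f] by (simp_all add: mult.commute)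
qed

text \<open>The closure properties of an ideal in terms of the operations of the type class, in which all
  computations take place.\<close>

locale poly_ideal =
  fixes V :: "'v set" and I :: "('v, 'k::field) mpoly set"
  assumes ideal: "ideal I (poly_ring V)"
begin

lemma in_carrier: "f \<in> I \<Longrightarrow> f \<in> carrier (poly_ring V)"
  using ideal.Icarr[OF ideal] .

lemma zero_in: "0 \<in> I"
  using additive_subgroup.zero_closed[OF ideal.axioms(1)[OF ideal]] by simp

lemma add_in: "f \<in> I \<Longrightarrow> g \<in> I \<Longrightarrow> f + g \<in> I"
  using additive_subgroup.a_closed[OF ideal.axioms(1)[OF ideal]] by simp

lemma mult_in: "f \<in> carrier (poly_ring V) \<Longrightarrow> g \<in> I \<Longrightarrow> f * g \<in> I"
  using ideal.I_l_closed[OF ideal, of g f] by simp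

lemma mult_in2: "f \<in> I \<Longrightarrow> g \<in> carrier (poly_ring V) \<Longrightarrow> f * g \<in> I"
  using ideal.I_r_closed[OF ideal, of f g] by simp

lemma uminus_in: "f \<in> I \<Longrightarrow> - f \<in> I"
  using mult_in[of "- 1" f] by (simp add: carrier_intros)

lemma diff_in: "f \<in> I \<Longrightarrow> g \<in> I \<Longrightarrow> f - g \<in> I"
  using add_in[of f "- g"] uminus_in by simp

lemma sum_in: "(\<And>i. i \<in> S \<Longrightarrow> f i \<in> I) \<Longrightarrow> sum f S \<in> I"
  by (induction S rule: infinite_finite_induct) (auto intro: add_in zero_in)

lemma const_in: "f \<in> I \<Longrightarrow> const_poly c * f \<in> I"
  by (simp add: mult_in)

lemma const_in_cancel:
  assumes "c \<noteq> 0" "const_poly c * f \<in> I"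
  shows "f \<in> I"
proof -
  have "const_poly (inverse c) * (const_poly c * f) \<in> I" by (rule const_in[OF assms(2)])
  moreover have "const_poly (inverse c) * (const_poly c * f) = f"
    using assms(1) by (simp add: const_poly_def mult_single flip: mult.assoc)
  ultimately show ?thesis by simp
qed

lemma in_if_trms_in:
  assumes "\<And>m. m \<in> Poly_Mapping.keys f \<Longrightarrow> trm_poly m \<in> I"
  shows "f \<in> I"
proof -
  have "(\<Sum>m\<in>Poly_Mapping.keys f. scaled_trm (Poly_Mapping.lookup f m) m) \<in> I"
    using assms by (intro sum_in) (simp flip: const_mult_trm add: const_in)
  then show ?thesis using poly_eq_sum_scaled_trm[of "Poly_Mapping.keys f" f] by simp
qed

end

section \<open>Evaluation\<close>

lemma eval_mpoly_superset:
  assumes "field_hom \<iota>" "finite S" "Poly_Mapping.keys f \<subseteq> S"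
  shows "eval_mpoly \<iota> \<gamma> f = (\<Sum>m\<in>S. \<iota> (Poly_Mapping.lookup f m) *
        (\<Prod>v\<in>Poly_Mapping.keys m. \<gamma> v ^ Poly_Mapping.lookup m v))"
proof -
  interpret field_hom \<iota> by fact
  show ?thesis
    unfolding eval_mpoly_def using assms(2,3)
    by (intro sum.mono_neutral_left) (auto simp: in_keys_iff)
qed

lemma eval_trm_add:
  fixes \<gamma> :: "'v \<Rightarrow> 'l::field"
  shows "(\<Prod>v\<in>Poly_Mapping.keys (s + t). \<gamma> v ^ Poly_Mapping.lookup (s + t) v) =
    (\<Prod>v\<in>Poly_Mapping.keys s. \<gamma> v ^ Poly_Mapping.lookup s v) *
    (\<Prod>v\<in>Poly_Mapping.keys t. \<gamma> v ^ Poly_Mapping.lookup t v)"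
proof -
  let ?S = "Poly_Mapping.keys s \<union> Poly_Mapping.keys t"
  have *: "(\<Prod>v\<in>Poly_Mapping.keys u. \<gamma> v ^ Poly_Mapping.lookup u v) = (\<Prod>v\<in>?S. \<gamma> v ^ Poly_Mapping.lookup u v)"
    if "Poly_Mapping.keys u \<subseteq> ?S" for u
    using that by (intro prod.mono_neutral_left) (auto simp: in_keys_iff)
  show ?thesis
    by (simp add: *[of s] *[of t] keys_trm_add lookup_add power_add prod.distrib)
qed

lemma eval_mpoly_comm_ring_hom:
  assumes "field_hom \<iota>"
  shows "comm_ring_hom (eval_mpoly \<iota> \<gamma>)"
proof -
  interpret field_hom \<iota> by fact
  let ?e = "eval_mpoly \<iota> \<gamma>"
  let ?p = "\<lambda>m. (\<Prod>v\<in>Poly_Mapping.keys m. \<gamma> v ^ Poly_Mapping.lookup m v)"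
  have zero: "?e 0 = 0" by (simp add: eval_mpoly_def)
  have add: "?e (f + g) = ?e f + ?e g" for f g
  proof -
    let ?S = "Poly_Mapping.keys f \<union> Poly_Mapping.keys g"
    show ?thesis
      using keys_add[of f g]
      by (simp add: eval_mpoly_superset[OF assms, of ?S] lookup_add hom_add algebra_simps sum.distrib)
  qed
  have sum: "?e (sum h S) = (\<Sum>i\<in>S. ?e (h i))" for S and h :: "'d \<Rightarrow> _"
    by (induction S rule: infinite_finite_induct) (auto simp: zero add)
  have scaled_trm: "?e (scaled_trm c m) = \<iota> c * ?p m" for c m
    by (simp add: eval_mpoly_superset[OF assms, of "{m}"])
  have mult: "?e (f * g) = ?e f * ?e g" for f g
  proof -
    let ?m = "\<lambda>h s. scaled_trm (Poly_Mapping.lookup h s) s"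
    have "f * g = (\<Sum>s\<in>Poly_Mapping.keys f. ?m f s) * (\<Sum>t\<in>Poly_Mapping.keys g. ?m g t)"
      using poly_eq_sum_scaled_trm[OF finite_keys order_refl, of f]
        poly_eq_sum_scaled_trm[OF finite_keys order_refl, of g] by simp
    also have "\<dots> = (\<Sum>s\<in>Poly_Mapping.keys f. \<Sum>t\<in>Poly_Mapping.keys g.
        scaled_trm (Poly_Mapping.lookup f s * Poly_Mapping.lookup g t) (s + t))"
      by (simp add: sum_product mult_single)
    finally have "?e (f * g) = (\<Sum>s\<in>Poly_Mapping.keys f. \<Sum>t\<in>Poly_Mapping.keys g.
        \<iota> (Poly_Mapping.lookup f s * Poly_Mapping.lookup g t) * ?p (s + t))"
      by (simp only: sum scaled_trm)
    also have "\<dots> = (\<Sum>s\<in>Poly_Mapping.keys f. \<Sum>t\<in>Poly_Mapping.keys g.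
        (\<iota> (Poly_Mapping.lookup f s) * ?p s) * (\<iota> (Poly_Mapping.lookup g t) * ?p t))"
      by (intro sum.cong refl) (simp only: hom_mult eval_trm_add ac_simps)
    finally show ?thesis
      by (simp only: eval_mpoly_def[of \<iota> \<gamma> f] eval_mpoly_def[of \<iota> \<gamma> g] sum_product)
  qed
  show ?thesis
    using add mult zero by unfold_locales (simp_all add: eval_mpoly_def)
qed

lemma eval_cvar:
  assumes "field_hom \<iota>"
  shows "eval_mpoly \<iota> \<gamma> (cvar p) = \<gamma> p"
proof -
  interpret field_hom \<iota> by fact
  show ?thesis by (simp add: eval_mpoly_def cvar_def trm_poly_def var_trm_def)
qed

section \<open>Residue class rings as vector spaces\<close>

lemma const_poly_ring_hom:
  "const_poly (a + b) = const_poly a + (const_poly b :: ('v, 'k::field) mpoly)"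
  "const_poly (a * b) = const_poly a * (const_poly b :: ('v, 'k::field) mpoly)"
  "const_poly (- a) = - (const_poly a :: ('v, 'k::field) mpoly)"
  "const_poly 0 = (0 :: ('v, 'k::field) mpoly)"
  "const_poly 1 = (1 :: ('v, 'k::field) mpoly)"
  by (simp_all add: const_poly_def single_add mult_single single_uminus)

lemma lookup_const_mult: "Poly_Mapping.lookup (const_poly c * f) m = c * Poly_Mapping.lookup f m"
proof -
  have "const_poly c * f = Poly_Mapping.map ((*) c) f"
    by (simp add: const_poly_def mult_map_scale_conv_mult)
  then show ?thesis by (simp add: Poly_Mapping.map.rep_eq when_def)
qed

lemma const_poly_eq_iff [simp]: "const_poly a = const_poly b \<longleftrightarrow> a = b"
  by (metis const_poly_def lookup_single_eq)

lemma const_poly_eq_0_iff [simp]: "const_poly a = 0 \<longleftrightarrow> a = 0"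
  by (metis const_poly_eq_iff const_poly_ring_hom(4))

lemma const_poly_subfield: "subfield (range const_poly) (poly_ring V :: ('v, 'k::field) mpoly ring)"
proof -
  let ?R = "poly_ring V :: ('v, 'k) mpoly ring"
  interpret cring ?R by (rule poly_ring_cring)
  show ?thesis
  proof (rule subfieldI)
    show "subcring (range const_poly) ?R"
    proof (rule subcringI')
      show "subring (range const_poly) ?R"
      proof (rule subringI)
        show "range const_poly \<subseteq> carrier ?R" by auto
        show "\<one>\<^bsub>?R\<^esub> \<in> range (const_poly :: 'k \<Rightarrow> ('v, 'k) mpoly)"
          unfolding pr_one by (metis const_poly_ring_hom(5) rangeI)
      next
        fix f g :: "('v, 'k) mpoly" assume "f \<in> range const_poly" "g \<in> range const_poly"
        then obtain a b where f: "f = const_poly a" and g: "g = const_poly b" by blast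
        show "f \<otimes>\<^bsub>?R\<^esub> g \<in> range const_poly"
          unfolding f g pr_mult const_poly_ring_hom(2)[symmetric] by (rule rangeI)
        show "f \<oplus>\<^bsub>?R\<^esub> g \<in> range const_poly"
          unfolding f g pr_add const_poly_ring_hom(1)[symmetric] by (rule rangeI)
        show "\<ominus>\<^bsub>?R\<^esub> f \<in> range const_poly"
          unfolding f poly_uminus[OF const_poly_carrier] const_poly_ring_hom(3)[symmetric] by (rule rangeI)
      qed
    qed
    have "const_poly c \<in> Units (?R\<lparr>carrier := range const_poly\<rparr>)" if "c \<noteq> 0" for c :: 'k
    proof -
      have "const_poly (inverse c) * const_poly c = (1 :: ('v, 'k) mpoly)"
        "const_poly c * const_poly (inverse c) = (1 :: ('v, 'k) mpoly)"
        using that by (simp_all add: const_poly_def mult_single)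
      then show ?thesis unfolding Units_def by (auto intro!: bexI[of _ "const_poly (inverse c)"])
    qed
    moreover have "(0 :: ('v, 'k) mpoly) \<notin> Units (?R\<lparr>carrier := range const_poly\<rparr>)"
      by (auto simp: Units_def)
    ultimately show "Units (?R\<lparr>carrier := range const_poly\<rparr>) = range const_poly - {\<zero>\<^bsub>?R\<^esub>}"
      by (auto simp: Units_def)
  qed
qed

lemma (in ring) independent_Cons_iff:
  "u \<in> carrier R \<Longrightarrow> independent K (u # Us) \<longleftrightarrow> u \<notin> Span K Us \<and> independent K Us"
  using independent_backwards li_Cons by blast

locale pr_ideal = poly_ideal "{..<n}" I for n and I :: "(nat, 'k::field) mpoly set"
begin

abbreviation "P \<equiv> carrier (PR n :: (nat, 'k) mpoly ring)"
abbreviation "res \<equiv> residue n I"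

lemma quot_ring: "ring (RX n I)"
  by (rule ideal.quotient_is_ring[OF ideal])

lemma carrier_quot: "carrier (RX n I) = res ` P"
  by (auto simp: FactRing_def A_RCOSETS_def')

lemma res_eq_iff: "f \<in> P \<Longrightarrow> g \<in> P \<Longrightarrow> res f = res g \<longleftrightarrow> f - g \<in> I"
  using ring.quotient_eq_iff_same_a_r_cos[OF poly_ring_ring ideal] poly_minus by metis

lemma res_add: "f \<in> P \<Longrightarrow> g \<in> P \<Longrightarrow> res f \<oplus>\<^bsub>RX n I\<^esub> res g = res (f + g)"
  using ring_hom_add[OF ideal.rcos_ring_hom[OF ideal]] by fastforce

lemma res_mult: "f \<in> P \<Longrightarrow> g \<in> P \<Longrightarrow> res f \<otimes>\<^bsub>RX n I\<^esub> res g = res (f * g)"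
  using ring_hom_mult[OF ideal.rcos_ring_hom[OF ideal]] by fastforce

lemma res_one: "\<one>\<^bsub>RX n I\<^esub> = res 1"
  using ring_hom_one[OF ideal.rcos_ring_hom[OF ideal]] by simp

lemma res_zero: "\<zero>\<^bsub>RX n I\<^esub> = res 0"
  using ring_hom_ring.homh[OF ideal.rcos_ring_hom_ring[OF ideal]] ring_hom_zero[OF _ poly_ring_ring quot_ring] by fastforce

lemma res_eq_zero_iff: "f \<in> P \<Longrightarrow> res f = \<zero>\<^bsub>RX n I\<^esub> \<longleftrightarrow> f \<in> I"
  by (simp add: res_zero res_eq_iff)

lemma res_in_carrier: "f \<in> P \<Longrightarrow> res f \<in> carrier (RX n I)"
  by (simp add: carrier_quot)

lemma proper_iff: "I \<noteq> P \<longleftrightarrow> 1 \<notin> I"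
proof
  assume "I \<noteq> P"
  then show "1 \<notin> I" using ideal.one_imp_carrier[OF ideal] by auto
next
  assume "1 \<notin> I"
  then show "I \<noteq> P" using one_carrier by blast
qed

lemma K_in_subfield:
  assumes "1 \<notin> I" shows "subfield (K_in n I) (RX n I)"
proof -
  have "\<one>\<^bsub>RX n I\<^esub> \<noteq> \<zero>\<^bsub>RX n I\<^esub>"
    using assms by (simp add: res_one res_eq_zero_iff)
  from ring_hom_ring.img_is_subfield(2)[OF ideal.rcos_ring_hom_ring[OF ideal] const_poly_subfield this]
  show ?thesis by (simp add: K_in_def image_image)
qed

lemma line_extension_iff:
  assumes "f \<in> P" "S \<subseteq> P"
  shows "ring.line_extension (RX n I) (K_in n I) (res f) (res ` S) = res ` {const_poly c * f + g | c g. g \<in> S}"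
proof -
  have eq: "res (const_poly c) \<otimes>\<^bsub>RX n I\<^esub> res f \<oplus>\<^bsub>RX n I\<^esub> res g = res (const_poly c * f + g)"
    if "g \<in> S" for c g
    using that assms res_mult[of "const_poly c" f] res_add[of "const_poly c * f" g] mult_carrier[of "const_poly c" "{..<n}" f]
    by auto
  have "u \<in> ring.line_extension (RX n I) (K_in n I) (res f) (res ` S) \<longleftrightarrow>
      (\<exists>c. \<exists>g\<in>S. u = res (const_poly c) \<otimes>\<^bsub>RX n I\<^esub> res f \<oplus>\<^bsub>RX n I\<^esub> res g)" for u
    unfolding ring.line_extension_mem_iff[OF quot_ring] K_in_def by blast
  then have 1: "u \<in> ring.line_extension (RX n I) (K_in n I) (res f) (res ` S) \<longleftrightarrow>
      (\<exists>c. \<exists>g\<in>S. u = res (const_poly c * f + g))" for u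
    using eq by (simp cong: bex_cong)
  have 2: "u \<in> res ` {const_poly c * f + g | c g. g \<in> S} \<longleftrightarrow> (\<exists>c. \<exists>g\<in>S. u = res (const_poly c * f + g))" for u
    by blast
  show ?thesis by (rule Set.set_eqI, rule trans[OF 1 2[symmetric]])
qed

text \<open>A linear combination of distinct terms is the same thing as a polynomial supported on them. So
  spans and linear independence of terms can be expressed without lists of coefficients.\<close>

lemma Span_terms:
  assumes "set l \<subseteq> trms n"
  shows "ring.Span (RX n I) (K_in n I) (map (\<lambda>t. res (trm_poly t)) l) = res ` {f. Poly_Mapping.keys f \<subseteq> set l}"
  using assms
proof (induction l)
  case Nil
  then show ?case by (simp add: ring.Span.simps[OF quot_ring] res_zero)
next
  case (Cons t l)
  have t: "trm_poly t \<in> P" using Cons.prems by (simp add: trms_def carrier_intros)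
  have S: "{f. Poly_Mapping.keys f \<subseteq> set l} \<subseteq> P"
    using Cons.prems by (fastforce simp: trms_def poly_carrier_iff)
  have "{const_poly c * trm_poly t + g | c g. g \<in> {f :: (nat, 'k) mpoly. Poly_Mapping.keys f \<subseteq> set l}}
    = {f. Poly_Mapping.keys f \<subseteq> set (t # l)}" (is "?A = ?B")
  proof
    show "?A \<subseteq> ?B"
    proof clarify
      fix c m and g :: "(nat, 'k) mpoly"
      assume "Poly_Mapping.keys g \<subseteq> set l" "m \<in> Poly_Mapping.keys (const_poly c * trm_poly t + g)"
      then show "m \<in> set (t # l)"
        using keys_add[of "scaled_trm c t" g] by (auto simp: const_mult_trm split: if_splits)
    qed
    show "?B \<subseteq> ?A"
    proof
      fix f :: "(nat, 'k) mpoly" assume f: "f \<in> ?B"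
      let ?c = "Poly_Mapping.lookup f t"
      have "f = const_poly ?c * trm_poly t + (f - scaled_trm ?c t)"
        by (simp add: const_mult_trm)
      moreover have "Poly_Mapping.keys (f - scaled_trm ?c t) \<subseteq> set l"
        using f by (auto simp: in_keys_iff lookup_minus lookup_single when_def split: if_splits)
      ultimately show "f \<in> ?A" by blast
    qed
  qed
  then show ?case
    using Cons line_extension_iff[OF t S] by (simp add: ring.Span.simps[OF quot_ring])
qed

lemma independent_terms_iff:
  assumes "set l \<subseteq> trms n" "distinct l"
  shows "ring.independent (RX n I) (K_in n I) (map (\<lambda>t. res (trm_poly t)) l) \<longleftrightarrow>
    (\<forall>f\<in>I. Poly_Mapping.keys f \<subseteq> set l \<longrightarrow> f = 0)"
  using assms
proof (induction l)
  case Nil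
  then show ?case by (simp add: ring.li_Nil[OF quot_ring])
next
  case (Cons t l)
  have t: "trm_poly t \<in> P" using Cons.prems by (simp add: trms_def carrier_intros)
  have S: "{f. Poly_Mapping.keys f \<subseteq> set l} \<subseteq> P"
    using Cons.prems by (fastforce simp: trms_def poly_carrier_iff)
  have "res (trm_poly t) = res f \<longleftrightarrow> trm_poly t - f \<in> I" if "Poly_Mapping.keys f \<subseteq> set l" for f
    using that S t by (intro res_eq_iff) auto
  then have "res (trm_poly t) \<in> res ` {f. Poly_Mapping.keys f \<subseteq> set l} \<longleftrightarrow>
      (\<exists>f. Poly_Mapping.keys f \<subseteq> set l \<and> trm_poly t - f \<in> I)"
    unfolding image_iff by blast
  moreover have "ring.independent (RX n I) (K_in n I) (map (\<lambda>t. res (trm_poly t)) l) \<longleftrightarrow>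
      (\<forall>f\<in>I. Poly_Mapping.keys f \<subseteq> set l \<longrightarrow> f = 0)"
    and "set l \<subseteq> trms n"
    using Cons by auto
  ultimately have "ring.independent (RX n I) (K_in n I) (map (\<lambda>t. res (trm_poly t)) (t # l)) \<longleftrightarrow>
     \<not> (\<exists>f. Poly_Mapping.keys f \<subseteq> set l \<and> trm_poly t - f \<in> I) \<and>
     (\<forall>f\<in>I. Poly_Mapping.keys f \<subseteq> set l \<longrightarrow> f = 0)"
    by (simp only: list.map ring.independent_Cons_iff[OF quot_ring res_in_carrier[OF t]] Span_terms)
  also have "\<dots> \<longleftrightarrow> (\<forall>f\<in>I. Poly_Mapping.keys f \<subseteq> set (t # l) \<longrightarrow> f = 0)" (is "?L \<longleftrightarrow> ?R")
  proof
    assume L: ?L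
    show ?R
    proof (intro ballI impI)
      fix f assume f: "f \<in> I" "Poly_Mapping.keys f \<subseteq> set (t # l)"
      let ?c = "Poly_Mapping.lookup f t"
      show "f = 0"
      proof (cases "?c = 0")
        case True
        then have "Poly_Mapping.keys f \<subseteq> set l" using f(2) by (auto simp: in_keys_iff)
        then show ?thesis using L f(1) by blast
      next
        case False
        let ?g = "trm_poly t - const_poly (inverse ?c) * f"
        have "trm_poly t - ?g \<in> I" using const_in[OF f(1)] by simp
        moreover have "Poly_Mapping.keys ?g \<subseteq> set l"
        proof
          fix m assume m: "m \<in> Poly_Mapping.keys ?g"
          then show "m \<in> set l"
            using f(2) False
            by (auto simp: lookup_const_mult in_keys_iff lookup_minus trm_poly_def lookup_single when_def split: if_splits)
        qed
        ultimately show ?thesis using L by blast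
      qed
    qed
  next
    assume R: ?R
    have "trm_poly t - f \<notin> I" if f: "Poly_Mapping.keys f \<subseteq> set l" for f :: "(nat, 'k) mpoly"
    proof
      assume "trm_poly t - f \<in> I"
      moreover have "Poly_Mapping.keys (trm_poly t - f) \<subseteq> set (t # l)"
        using f by (auto simp: in_keys_iff lookup_minus trm_poly_def lookup_single when_def split: if_splits)
      ultimately have "trm_poly t = f" using R by fastforce
      then have "Poly_Mapping.keys f = {t}" by (metis keys_single trm_poly_def zero_neq_one)
      then show False using f Cons.prems by simp
    qed
    then show ?L using R by auto
  qed
  finally show ?case .
qed

lemma filt_eq: "filt n I i = res ` {f \<in> P. \<forall>m\<in>Poly_Mapping.keys f. int (tdeg m) \<le> i}"
  by (simp add: filt_def)

lemma res_in_filt_iff: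
  assumes "f \<in> P"
  shows "res f \<in> filt n I i \<longleftrightarrow> (\<exists>g\<in>P. (\<forall>m\<in>Poly_Mapping.keys g. int (tdeg m) \<le> i) \<and> f - g \<in> I)"
proof -
  have "res f = res g \<longleftrightarrow> f - g \<in> I" if "g \<in> P" for g
    using assms that by (rule res_eq_iff)
  then show ?thesis by (auto simp: filt_eq image_iff)
qed

text \<open>Linear independence is needed once, for the whole order ideal, and the spanning conditions say
  that every polynomial has a normal form that does not raise its degree.\<close>

lemma df_border_basis_iff:
  assumes "set ts \<subseteq> trms n" "distinct ts"
  shows "df_border_basis n ts I \<longleftrightarrow>
    (\<forall>f\<in>I. Poly_Mapping.keys f \<subseteq> set ts \<longrightarrow> f = 0) \<and>
    (\<forall>f\<in>P. \<forall>d. (\<forall>m\<in>Poly_Mapping.keys f. tdeg m \<le> d) \<longrightarrow>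
      (\<exists>g. Poly_Mapping.keys g \<subseteq> {t\<in>set ts. tdeg t \<le> d} \<and> f - g \<in> I))" (is "_ \<longleftrightarrow> ?R1 \<and> ?R2")
proof -
  have sub: "set (filter Q ts) \<subseteq> trms n" "distinct (filter Q ts)" for Q
    using assms by auto
  have inP: "f \<in> P" if "Poly_Mapping.keys f \<subseteq> set (filter Q ts)" for f :: "(nat, 'k) mpoly" and Q
    using that assms(1) by (fastforce simp: poly_carrier_iff trms_def)
  have eq: "df_border_basis n ts I \<longleftrightarrow> (\<forall>i\<ge>0. (\<forall>f\<in>I. Poly_Mapping.keys f \<subseteq> set (filter (\<lambda>t. int (tdeg t) \<le> i) ts) \<longrightarrow> f = 0) \<and>
     res ` {f. Poly_Mapping.keys f \<subseteq> set (filter (\<lambda>t. int (tdeg t) \<le> i) ts)} = filt n I i)"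
    unfolding df_border_basis_def Let_def independent_terms_iff[OF sub] Span_terms[OF sub(1)] ..
  show ?thesis
  proof
    assume L: "df_border_basis n ts I"
    have ?R1
    proof (intro ballI impI)
      fix f assume f: "f \<in> I" "Poly_Mapping.keys f \<subseteq> set ts"
      let ?i = "int (Max (tdeg ` set ts))"
      have "set (filter (\<lambda>t. int (tdeg t) \<le> ?i) ts) = set ts" by auto
      moreover have "0 \<le> ?i" by simp
      ultimately show "f = 0" using f L unfolding eq by blast
    qed
    moreover have ?R2
    proof (intro ballI allI impI)
      fix f :: "(nat, 'k) mpoly" and d assume f: "f \<in> P" "\<forall>m\<in>Poly_Mapping.keys f. tdeg m \<le> d"
      then have "res f \<in> filt n I (int d)" by (auto simp: filt_eq)
      then have "res f \<in> res ` {f. Poly_Mapping.keys f \<subseteq> set (filter (\<lambda>t. int (tdeg t) \<le> int d) ts)}"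
        using L[unfolded eq, rule_format, of "int d"] by simp
      then obtain g where g: "Poly_Mapping.keys g \<subseteq> set (filter (\<lambda>t. int (tdeg t) \<le> int d) ts)" "res f = res g"
        by blast
      then show "\<exists>g. Poly_Mapping.keys g \<subseteq> {t \<in> set ts. tdeg t \<le> d} \<and> f - g \<in> I"
        using res_eq_iff[OF f(1) inP[OF g(1)]] by (intro exI[of _ g]) auto
    qed
    ultimately show "?R1 \<and> ?R2" ..
  next
    assume R: "?R1 \<and> ?R2"
    show "df_border_basis n ts I"
      unfolding eq
    proof (intro allI impI conjI ballI)
      fix i :: int and f assume "f \<in> I" "Poly_Mapping.keys f \<subseteq> set (filter (\<lambda>t. int (tdeg t) \<le> i) ts)"
      then show "f = 0" using R by auto
    next
      fix i :: int assume i: "0 \<le> i"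
      show "res ` {f. Poly_Mapping.keys f \<subseteq> set (filter (\<lambda>t. int (tdeg t) \<le> i) ts)} = filt n I i" (is "?A = _")
      proof
        show "?A \<subseteq> filt n I i"
          unfolding filt_eq using inP by (intro image_mono) auto
        show "filt n I i \<subseteq> ?A"
        proof
          fix u assume "u \<in> filt n I i"
          then obtain f where f: "f \<in> P" "\<forall>m\<in>Poly_Mapping.keys f. int (tdeg m) \<le> i" "u = res f"
            by (auto simp: filt_eq)
          have "\<forall>m\<in>Poly_Mapping.keys f. tdeg m \<le> nat i"
            using f(2) i by (auto simp: le_nat_iff)
          then obtain g where g: "Poly_Mapping.keys g \<subseteq> {t \<in> set ts. tdeg t \<le> nat i}" "f - g \<in> I"
            using R f(1) by blast
          then have "Poly_Mapping.keys g \<subseteq> set (filter (\<lambda>t. int (tdeg t) \<le> i) ts)"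
            using i by (auto simp: le_nat_iff)
          moreover from this have "u = res g" using g(2) f res_eq_iff[OF f(1) inP] by simp
          ultimately show "u \<in> ?A" by blast
        qed
      qed
    qed
  qed
qed

end

section \<open>The Cayley-Bacharach property of a local ring at the origin\<close>

lemma (in ring) dimension_Suc_0_iff:
  "dimension (Suc 0) K E \<longleftrightarrow> (\<exists>v\<in>carrier R. v \<noteq> \<zero> \<and> E = line_extension K v {\<zero>})"
proof
  assume "dimension (Suc 0) K E"
  then obtain v E' where v: "v \<in> carrier R" "v \<notin> E'" "E = line_extension K v E'" "dimension 0 K E'"
    by (cases rule: dimension.cases) auto
  from v(4) have "E' = {\<zero>}" by (cases rule: dimension.cases) auto
  then show "\<exists>v\<in>carrier R. v \<noteq> \<zero> \<and> E = line_extension K v {\<zero>}" using v by auto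
next
  assume "\<exists>v\<in>carrier R. v \<noteq> \<zero> \<and> E = line_extension K v {\<zero>}"
  then show "dimension (Suc 0) K E" using Suc_dim[OF _ _ zero_dim] by auto
qed

lemma pr_idealI: "ideal I (PR n) \<Longrightarrow> pr_ideal n I"
  by (intro pr_ideal.intro poly_ideal.intro)

lemma var_trm_neq_0 [simp]: "var_trm r \<noteq> 0"
  by (metis tdeg_0 tdeg_var zero_neq_one)

lemma trm_add_eq_0_iff: "s + t = (0 :: 'v trm) \<longleftrightarrow> s = 0 \<and> t = 0"
  by (metis add_is_0 tdeg_add tdeg_eq_0_iff)

definition origin_ideal :: "nat \<Rightarrow> (nat, 'k::field) mpoly set" where
  "origin_ideal n = {f \<in> carrier (PR n). Poly_Mapping.lookup f 0 = 0}"

lemma origin_ideal_ideal: "ideal (origin_ideal n) (PR n)"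
proof (rule poly_idealI)
  fix f g :: "(nat, 'k::field) mpoly"
  assume fg: "f \<in> carrier (PR n)" "g \<in> origin_ideal n"
  then have "0 \<notin> Poly_Mapping.keys g" by (simp add: origin_ideal_def in_keys_iff)
  then have "0 \<notin> Poly_Mapping.keys (f * g)"
    using keys_mult[of f g] by (auto simp: trm_add_eq_0_iff dest!: subsetD)
  then show "f * g \<in> origin_ideal n"
    using fg by (simp add: origin_ideal_def in_keys_iff mult_carrier)
qed (auto simp: origin_ideal_def lookup_add intro: add_carrier)

lemma diff_const_in_origin_ideal:
  "f \<in> carrier (PR n) \<Longrightarrow> f - const_poly (Poly_Mapping.lookup f 0) \<in> origin_ideal n"
  using diff_carrier[OF _ const_poly_carrier, of f] by (simp add: origin_ideal_def lookup_minus const_poly_def)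

lemma one_notin_origin_ideal: "1 \<notin> origin_ideal n"
  by (simp add: origin_ideal_def)

lemma var_minus_const_notin_origin_ideal:
  "c \<noteq> 0 \<Longrightarrow> trm_poly (var_trm r) - const_poly c \<notin> origin_ideal n"
  by (simp add: origin_ideal_def lookup_minus trm_poly_def const_poly_def lookup_single)

lemma origin_ideal_maximal: "maximalideal (origin_ideal n) (PR n)"
proof (rule maximalidealI)
  show "ideal (origin_ideal n) (PR n)" by (rule origin_ideal_ideal)
  show "carrier (PR n) \<noteq> (origin_ideal n :: (nat, 'k::field) mpoly set)"
    using one_notin_origin_ideal one_carrier by metis
  fix J :: "(nat, 'k::field) mpoly set"
  assume J: "ideal J (PR n)" "origin_ideal n \<subseteq> J" "J \<subseteq> carrier (PR n)"
  interpret J: pr_ideal n J by (rule pr_idealI[OF J(1)])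
  show "J = origin_ideal n \<or> J = carrier (PR n)"
  proof (cases "J \<subseteq> origin_ideal n")
    case False
    then obtain f where f: "f \<in> J" "f \<notin> origin_ideal n" by blast
    let ?c = "Poly_Mapping.lookup f 0"
    have fP: "f \<in> carrier (PR n)" using f(1) J(3) by blast
    then have "?c \<noteq> 0" using f(2) by (simp add: origin_ideal_def)
    moreover have "const_poly ?c * 1 \<in> J"
      using J.diff_in[OF f(1), of "f - const_poly ?c"] diff_const_in_origin_ideal[OF fP] J(2) by auto
    ultimately have "1 \<in> J" by (rule J.const_in_cancel)
    then show ?thesis using J.proper_iff by blast
  qed (use J(2) in blast)
qed

lemma origin_ideal_quotient_dimension:
  "ring.dimension (RX n (origin_ideal n :: (nat, 'k::field) mpoly set)) (Suc 0)
    (K_in n (origin_ideal n)) (carrier (RX n (origin_ideal n)))"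
proof -
  let ?M = "origin_ideal n :: (nat, 'k) mpoly set"
  interpret M: pr_ideal n ?M by (rule pr_idealI[OF origin_ideal_ideal])
  have "ring.line_extension (RX n ?M) (K_in n ?M) (M.res 1) (M.res ` {0}) = M.res ` {const_poly c * 1 + g | c g. g \<in> {0}}"
    by (rule M.line_extension_iff) auto
  also have "\<dots> = M.res ` M.P"
  proof
    show "M.res ` {const_poly c * 1 + g | c g. g \<in> {0}} \<subseteq> M.res ` M.P" by (intro image_mono) auto
    show "M.res ` M.P \<subseteq> M.res ` {const_poly c * 1 + g | c g. g \<in> {0}}"
    proof (rule image_subsetI)
      fix f assume f: "f \<in> M.P"
      let ?c = "Poly_Mapping.lookup f 0"
      have "M.res f = M.res (const_poly ?c)"
        using M.res_eq_iff[OF f const_poly_carrier] diff_const_in_origin_ideal[OF f] by simp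
      moreover have "const_poly ?c \<in> {const_poly c * 1 + g | c g. g \<in> {0}}"
        by (auto intro: exI[of _ ?c])
      ultimately show "M.res f \<in> M.res ` {const_poly c * 1 + g | c g. g \<in> {0}}" by (rule image_eqI)
    qed
  qed
  finally have "carrier (RX n ?M) = ring.line_extension (RX n ?M) (K_in n ?M) (M.res 1) {M.res 0}"
    by (simp add: M.carrier_quot)
  then show ?thesis
    unfolding ring.dimension_Suc_0_iff[OF M.quot_ring] M.res_zero
    using one_notin_origin_ideal M.res_in_carrier[OF one_carrier] M.res_eq_iff[OF one_carrier zero_carrier]
    by (intro bexI[of _ "M.res 1"]) auto
qed

text \<open>As all terms of large degree lie in \<open>D\<close>, the ring \<open>P/D\<close> is local, and its maximal ideal is
  generated by the indeterminates. For the associated graded ring of a scheme this holds because \<open>D\<close> is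
  homogeneous and of dimension zero.\<close>

locale origin_primary = pr_ideal n D for n and D :: "(nat, 'k::field) mpoly set" +
  fixes d :: nat
  assumes proper: "1 \<notin> D"
    and high: "t \<in> trms n \<Longrightarrow> tdeg t > d \<Longrightarrow> trm_poly t \<in> D"
begin

abbreviation "M \<equiv> origin_ideal n :: (nat, 'k) mpoly set"

text \<open>Polynomials whose class modulo \<open>D\<close> is in the socle of \<open>P/D\<close>.\<close>

definition socle :: "(nat, 'k) mpoly set" where
  "socle = {f \<in> P. \<forall>r<n. trm_poly (var_trm r) * f \<in> D}"

lemma socle_carrier: "f \<in> socle \<Longrightarrow> f \<in> P"
  by (simp add: socle_def)

text \<open>Every term other than \<open>1\<close> contains an indeterminate, which annihilates the socle. So only the
  constant term of a factor acts on the socle.\<close>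

lemma mult_socle:
  assumes f: "f \<in> socle" and h: "h \<in> P"
  shows "h * f - const_poly (Poly_Mapping.lookup h 0) * f \<in> D"
proof -
  have *: "scaled_trm c t * f \<in> D" if "t \<in> trms n" "t \<noteq> 0" for c t
  proof -
    from that obtain r where r: "r \<in> Poly_Mapping.keys t" by (metis keys_eq_empty equals0I)
    then obtain t' where t': "t = var_trm r + t'" by (rule trm_split)
    have eq: "scaled_trm c t * f = scaled_trm c t' * (trm_poly (var_trm r) * f)"
      by (simp add: t' trm_poly_def mult_single add.commute flip: mult.assoc)
    have r: "r < n" and t': "Poly_Mapping.keys t' \<subseteq> {..<n}"
      using that r by (auto simp: trms_def t' keys_trm_add)
    show ?thesis
      unfolding eq by (rule mult_in[OF scaled_trm_carrier[OF t']]) (use f r in \<open>auto simp: socle_def\<close>)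
  qed
  let ?h = "h - const_poly (Poly_Mapping.lookup h 0)"
  have "(\<Sum>t\<in>Poly_Mapping.keys ?h. scaled_trm (Poly_Mapping.lookup ?h t) t * f) \<in> D"
  proof (rule sum_in)
    fix t assume t: "t \<in> Poly_Mapping.keys ?h"
    then have "t \<noteq> 0" by (auto simp: in_keys_iff lookup_minus const_poly_def)
    moreover have "t \<in> trms n"
      using t diff_carrier[OF h const_poly_carrier, of "Poly_Mapping.lookup h 0"]
      by (simp add: poly_carrier_iff trms_def)
    ultimately show "scaled_trm (Poly_Mapping.lookup ?h t) t * f \<in> D" by (rule *[rotated])
  qed
  then have "?h * f \<in> D"
    using poly_eq_sum_scaled_trm[OF finite_keys order_refl, of ?h] by (simp flip: sum_distrib_right)
  then show ?thesis by (simp add: algebra_simps)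
qed

text \<open>A term of maximal degree among those that do not annihilate the class of \<open>f\<close> moves \<open>f\<close> into the socle.\<close>

lemma ex_trm_mult_socle:
  assumes f: "f \<in> P" "f \<notin> D"
  obtains t where "t \<in> trms n" "trm_poly t * f \<in> socle" "trm_poly t * f \<notin> D"
proof -
  let ?Q = "\<lambda>t. t \<in> trms n \<and> trm_poly t * f \<notin> D"
  have "?Q 0" using f by (simp add: trms_def trm_poly_def)
  moreover have "\<forall>t. ?Q t \<longrightarrow> tdeg t < Suc d"
  proof (intro allI impI)
    fix t assume t: "?Q t"
    show "tdeg t < Suc d"
    proof (rule ccontr)
      assume "\<not> tdeg t < Suc d"
      then have "trm_poly t * f \<in> D" using t by (intro mult_in2[OF high f(1)]) auto
      then show False using t by blast
    qed
  qed
  ultimately obtain t where t: "?Q t" "\<And>s. ?Q s \<Longrightarrow> tdeg s \<le> tdeg t"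
    using ex_has_greatest_nat[of ?Q 0 tdeg "Suc d"] by metis
  have "trm_poly (var_trm r) * (trm_poly t * f) \<in> D" if "r < n" for r
  proof (rule ccontr)
    assume "\<not> ?thesis"
    then have "trm_poly (var_trm r + t) * f \<notin> D"
      by (simp add: trm_poly_def mult_single flip: mult.assoc)
    then have "tdeg (var_trm r + t) \<le> tdeg t"
      using t that by (intro t(2)) (auto simp: trms_def keys_trm_add)
    then show False by simp
  qed
  moreover have "trm_poly t * f \<in> P" using t(1) f(1) by (auto simp: trms_def intro: carrier_intros)
  ultimately show ?thesis using that t(1) by (auto simp: socle_def)
qed

text \<open>Outside of \<open>D\<close>, some multiple of \<open>a\<close> is a nonzero element of the socle, and \<open>b\<close> acts on
  it as its constant term, a nonzero scalar.\<close>

lemma cancel_unit: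
  assumes "a \<in> P" "b \<in> P" "a * b \<in> D" "b \<notin> M"
  shows "a \<in> D"
proof (rule ccontr)
  assume "a \<notin> D"
  then obtain t where t: "t \<in> trms n" "trm_poly t * a \<in> socle" "trm_poly t * a \<notin> D"
    using ex_trm_mult_socle assms(1) by blast
  let ?c = "Poly_Mapping.lookup b 0" and ?g = "trm_poly t * a"
  have "b * ?g - const_poly ?c * ?g \<in> D" by (rule mult_socle[OF t(2) assms(2)])
  moreover have "b * ?g \<in> D"
    using mult_in[OF _ assms(3), of "trm_poly t"] t(1) by (auto simp: trms_def ac_simps intro: carrier_intros)
  ultimately have "const_poly ?c * ?g \<in> D" using diff_in by fastforce
  moreover have "?c \<noteq> 0" using assms by (simp add: origin_ideal_def)
  ultimately show False using const_in_cancel t(3) by blast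
qed

lemma D_subset: "D \<subseteq> M"
proof
  fix f assume f: "f \<in> D"
  show "f \<in> M"
  proof (rule ccontr)
    assume "f \<notin> M"
    then show False using cancel_unit[of 1 f] f in_carrier proper by simp
  qed
qed

lemma keys_power_tdeg:
  assumes "f \<in> M" "m \<in> Poly_Mapping.keys (f ^ k)"
  shows "k \<le> tdeg m"
  using assms(2)
proof (induction k arbitrary: m)
  case (Suc k)
  then obtain a b where m: "m = a + b" "a \<in> Poly_Mapping.keys f" "b \<in> Poly_Mapping.keys (f ^ k)"
    using keys_mult[of f "f ^ k"] by auto
  then have "a \<noteq> 0" using assms(1) by (auto simp: origin_ideal_def in_keys_iff)
  then have "tdeg a \<ge> 1" by (metis tdeg_eq_0_iff less_one not_le)
  then show ?case using Suc.IH[OF m(3)] m(1) by simp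
qed simp

lemma power_in: assumes "f \<in> M" shows "f ^ Suc d \<in> D"
proof (rule in_if_trms_in)
  fix m assume m: "m \<in> Poly_Mapping.keys (f ^ Suc d)"
  have "f ^ Suc d \<in> P" using assms by (intro power_carrier) (simp add: origin_ideal_def)
  then have "m \<in> trms n" using m by (auto simp: poly_carrier_iff trms_def)
  then show "trm_poly m \<in> D" using keys_power_tdeg[OF assms m] by (intro high) auto
qed

lemma power_not_in:
  assumes "f \<in> P" "f \<notin> M" shows "f ^ k \<notin> D"
proof (induction k)
  case (Suc k)
  then show ?case
    using cancel_unit[of "f ^ k" f] assms by (auto simp: power_carrier mult.commute)
qed (simp add: proper)

lemma primary_to_origin: "primary_to D M (PR n)"
  unfolding primary_to_def poly_pow pr_mult
proof (intro conjI ballI impI)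
  show "ideal D (PR n)" by (rule ideal)
  show "D \<noteq> P" using proper one_carrier by blast
  fix a b assume ab: "a \<in> P" "b \<in> P" "a * b \<in> D"
  show "a \<in> D \<or> (\<exists>k. b ^ k \<in> D)"
    using cancel_unit[OF ab] power_in[of b] by blast
next
  show "M = {a \<in> P. \<exists>k. a ^ k \<in> D}"
  proof (intro equalityI subsetI)
    fix a assume a: "a \<in> M"
    then have "a \<in> P" by (simp add: origin_ideal_def)
    then show "a \<in> {a \<in> P. \<exists>k. a ^ k \<in> D}" using power_in[OF a] by blast
  next
    fix a assume "a \<in> {a \<in> P. \<exists>k. a ^ k \<in> D}"
    then show "a \<in> M" using power_not_in by blast
  qed
qed

text \<open>Each component contains \<open>D\<close> and hence a power of every element of \<open>M\<close>, so that its radical is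
  \<open>M\<close>. As the radicals are distinct, there is only one component.\<close>

lemma primary_decomposition_iff:
  "primary_decomposition n D Qs Ms \<longleftrightarrow> Qs = [D] \<and> Ms = [M]"
proof
  assume "Qs = [D] \<and> Ms = [M]"
  then show "primary_decomposition n D Qs Ms"
    using primary_to_origin origin_ideal_maximal by (simp add: primary_decomposition_def)
next
  assume L: "primary_decomposition n D Qs Ms"
  then have len: "length Qs = length Ms" and dist: "distinct Ms" and D: "D = \<Inter> (set Qs)"
    by (auto simp: primary_decomposition_def)
  have Mi: "Ms ! i = M" if i: "i < length Ms" for i
  proof -
    have max: "maximalideal (Ms ! i) (PR n)" and prim: "primary_to (Qs ! i) (Ms ! i) (PR n)"
      using L i by (auto simp: primary_decomposition_def)
    have "D \<subseteq> Qs ! i" using D len i by auto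
    have sub: "M \<subseteq> Ms ! i"
    proof
      fix f assume f: "f \<in> M"
      then have "f ^ Suc d \<in> Qs ! i" using power_in[OF f] \<open>D \<subseteq> Qs ! i\<close> by blast
      moreover have "f \<in> P" using f by (simp add: origin_ideal_def)
      ultimately show "f \<in> Ms ! i" using prim unfolding primary_to_def poly_pow by blast
    qed
    have "ideal (Ms ! i) (PR n)" "P \<noteq> Ms ! i"
      using max maximalideal.axioms(1) maximalideal.I_notcarr by blast+
    moreover have "Ms ! i \<subseteq> P"
      using prim unfolding primary_to_def by blast
    ultimately show "Ms ! i = M"
      using maximalideal.I_maximal[OF origin_ideal_maximal _ sub] by blast
  qed
  have "Ms \<noteq> []"
  proof
    assume "Ms = []"
    then have "D = UNIV" using D len by simp
    then show False using proper by blast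
  qed
  moreover have "\<not> 1 < length Ms"
  proof
    assume "1 < length Ms"
    then have len2: "0 < length Ms" "1 < length Ms" by linarith+
    then have "Ms ! 0 = Ms ! 1" by (simp only: Mi)
    then show False using nth_eq_iff_index_eq[OF dist len2] by simp
  qed
  ultimately have "length Ms = 1" by (metis length_0_conv less_one linorder_neqE_nat)
  then obtain Q M' where "Qs = [Q]" "Ms = [M']"
    using len by (metis One_nat_def length_0_conv length_Suc_conv)
  then show "Qs = [D] \<and> Ms = [M]" using Mi[of 0] D by simp
qed

text \<open>The ideal \<open>D + (f)\<close> for \<open>f\<close> in the socle, where \<open>P f\<close> and \<open>K f\<close> agree modulo \<open>D\<close>.\<close>

definition socle_ideal :: "(nat, 'k) mpoly \<Rightarrow> (nat, 'k) mpoly set" where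
  "socle_ideal f = {g \<in> P. \<exists>c. g - const_poly c * f \<in> D}"

lemma socle_ideal_ideal:
  assumes f: "f \<in> socle" shows "ideal (socle_ideal f) (PR n)"
proof (rule poly_idealI)
  show "0 \<in> socle_ideal f"
    using zero_in by (auto simp: socle_ideal_def const_poly_ring_hom intro!: exI[of _ 0])
next
  fix g h assume "g \<in> socle_ideal f" "h \<in> socle_ideal f"
  then obtain a b where gh: "g \<in> P" "h \<in> P" "g - const_poly a * f \<in> D" "h - const_poly b * f \<in> D"
    by (auto simp: socle_ideal_def)
  have "(g + h) - const_poly (a + b) * f \<in> D"
    using add_in[OF gh(3,4)] by (simp add: const_poly_ring_hom algebra_simps)
  then show "g + h \<in> socle_ideal f" using gh by (auto simp: socle_ideal_def add_carrier)
next
  fix h g assume h: "h \<in> P" and "g \<in> socle_ideal f"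
  then obtain c where g: "g \<in> P" "g - const_poly c * f \<in> D"
    by (auto simp: socle_ideal_def)
  let ?a = "Poly_Mapping.lookup h 0"
  have "h * (g - const_poly c * f) + const_poly c * (h * f - const_poly ?a * f) \<in> D"
    by (intro add_in mult_in[OF h] g(2) const_in mult_socle[OF f h])
  moreover have "h * (g - const_poly c * f) + const_poly c * (h * f - const_poly ?a * f)
      = h * g - const_poly (c * ?a) * f"
    by (simp add: const_poly_ring_hom algebra_simps)
  ultimately show "h * g \<in> socle_ideal f"
    using h g by (auto simp: socle_ideal_def mult_carrier)
qed (auto simp: socle_ideal_def)

lemma res_socle_ideal:
  assumes f: "f \<in> P" shows "res ` socle_ideal f = {res (const_poly c * f) | c. True}"
proof (intro equalityI subsetI)
  fix u assume "u \<in> res ` socle_ideal f"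
  then obtain g c where "u = res g" "g \<in> P" "g - const_poly c * f \<in> D"
    by (auto simp: socle_ideal_def)
  then have "u = res (const_poly c * f)" using res_eq_iff[of g "const_poly c * f"] f by (simp add: mult_carrier)
  then show "u \<in> {res (const_poly c * f) | c. True}" by blast
next
  fix u assume "u \<in> {res (const_poly c * f) | c. True}"
  then obtain c where "u = res (const_poly c * f)" by blast
  moreover have "const_poly c * f \<in> socle_ideal f"
    using f zero_in by (auto simp: socle_ideal_def mult_carrier intro!: exI[of _ c])
  ultimately show "u \<in> res ` socle_ideal f" by blast
qed

lemma line_extension_zero:
  assumes f: "f \<in> P"
  shows "ring.line_extension (RX n D) (K_in n D) (res f) {\<zero>\<^bsub>RX n D\<^esub>} = {res (const_poly c * f) | c. True}"
proof -
  have "ring.line_extension (RX n D) (K_in n D) (res f) (res ` {0}) = res ` {const_poly c * f + g | c g. g \<in> {0}}"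
    by (rule line_extension_iff) (use f in auto)
  also have "\<dots> = {res (const_poly c * f) | c. True}" by auto
  finally show ?thesis by (simp add: res_zero)
qed

text \<open>The image of a minimal divisor in \<open>P/D\<close> is spanned by one class \<open>v\<close>. Each indeterminate \<open>x\<close>
  acts on this line as a scalar \<open>c\<close>, and \<open>c = 0\<close> since otherwise \<open>x - c\<close> would be a unit that
  annihilates \<open>v\<close>; so \<open>v\<close> lies in the socle. If \<open>D = M\<close>, the line is the whole field \<open>P/D\<close>, as
  the definition of a minimal divisor demands in this case.\<close>

lemma minimal_divisors_eq:
  "minimal_divisors n [D] [M] 0 = socle_ideal ` (socle - D)"
proof (intro equalityI subsetI)
  interpret M: pr_ideal n M by (rule pr_idealI[OF origin_ideal_ideal])
  fix J assume "J \<in> minimal_divisors n [D] [M] 0"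
  then obtain d' Q where Q: "J = \<Inter> (set ([D][0 := Q]))" "ideal Q (PR n)"
    "if [D] ! 0 = [M] ! 0 then Q = P else [D] ! 0 \<subset> Q \<and> Q \<subseteq> [M] ! 0"
    "ring.dimension (RX n ([D] ! 0)) d' (K_in n ([D] ! 0)) (residue n ([D] ! 0) ` Q)"
    "ring.dimension (RX n ([M] ! 0)) d' (K_in n ([M] ! 0)) (carrier (RX n ([M] ! 0)))"
    unfolding minimal_divisors_def by blast
  then have "J = Q" by simp
  then have J: "ideal J (PR n)"
    and dim: "ring.dimension (RX n D) d' (K_in n D) (res ` J)"
    and dim': "ring.dimension (RX n M) d' (K_in n M) (carrier (RX n M))"
    and cond: "if D = M then J = P else D \<subset> J \<and> J \<subseteq> M"
    using Q by (simp_all cong: if_cong)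
  then have DJ: "D \<subseteq> J" using in_carrier by (auto split: if_splits)
  interpret J: pr_ideal n J by (rule pr_idealI[OF J])
  have "d' = Suc 0"
    using ring.dimension_is_inj[OF M.quot_ring M.K_in_subfield[OF one_notin_origin_ideal] dim' origin_ideal_quotient_dimension] .
  then have "\<exists>v\<in>carrier (RX n D). v \<noteq> \<zero>\<^bsub>RX n D\<^esub> \<and>
      res ` J = ring.line_extension (RX n D) (K_in n D) v {\<zero>\<^bsub>RX n D\<^esub>}"
    using dim by (simp only: ring.dimension_Suc_0_iff[OF quot_ring])
  then obtain v where v: "v \<noteq> \<zero>\<^bsub>RX n D\<^esub>" "v \<in> carrier (RX n D)"
      "res ` J = ring.line_extension (RX n D) (K_in n D) v {\<zero>\<^bsub>RX n D\<^esub>}"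
    by (elim bexE conjE)
  then obtain f where f: "f \<in> P" "v = res f" by (auto simp: carrier_quot)
  have resJ: "res ` J = {res (const_poly c * f) | c. True}"
    using v(3) f line_extension_zero by simp
  have fD: "f \<notin> D" using v(1) f(2) res_eq_zero_iff[OF f(1)] by simp
  have J_iff: "g \<in> J \<longleftrightarrow> g \<in> socle_ideal f" if g: "g \<in> P" for g
  proof
    assume "g \<in> J"
    then obtain c where "res g = res (const_poly c * f)" using resJ by blast
    then show "g \<in> socle_ideal f"
      using res_eq_iff[OF g, of "const_poly c * f"] g f by (auto simp: socle_ideal_def mult_carrier)
  next
    assume "g \<in> socle_ideal f"
    then obtain c where c: "g - const_poly c * f \<in> D" by (auto simp: socle_ideal_def)
    have "res (const_poly c * f) \<in> res ` J" using resJ by blast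
    then obtain j where j: "j \<in> J" "res j = res (const_poly c * f)" by (metis imageE)
    then have "j - const_poly c * f \<in> D"
      using res_eq_iff[of j "const_poly c * f"] f J.in_carrier by (simp add: mult_carrier)
    then have "g - j \<in> D" using c diff_in by fastforce
    then show "g \<in> J" using J.add_in[of "g - j" j] j DJ by auto
  qed
  have "f \<in> J"
    using J_iff[OF f(1)] f zero_in by (auto simp: socle_ideal_def const_poly_ring_hom intro!: exI[of _ 1])
  have "trm_poly (var_trm r) * f \<in> D" if r: "r < n" for r
  proof -
    let ?x = "trm_poly (var_trm r) :: (nat, 'k) mpoly"
    have x: "?x \<in> P" using r by (intro carrier_intros) simp
    have "?x * f \<in> J" using J.mult_in[OF x \<open>f \<in> J\<close>] .
    then have "?x * f \<in> socle_ideal f" using J_iff[OF mult_carrier[OF x f(1)]] by simp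
    then have "\<exists>c. ?x * f - const_poly c * f \<in> D" by (simp only: socle_ideal_def mem_Collect_eq)
    then obtain c where c: "?x * f - const_poly c * f \<in> D" by (elim exE)
    have "c = 0"
    proof (rule ccontr)
      assume "c \<noteq> 0"
      then have "?x - const_poly c \<notin> M" by (rule var_minus_const_notin_origin_ideal)
      moreover have "f * (?x - const_poly c) \<in> D" using c by (simp add: algebra_simps)
      ultimately show False using cancel_unit[OF f(1) diff_carrier[OF x const_poly_carrier]] fD by blast
    qed
    then show ?thesis using c by (simp add: const_poly_ring_hom)
  qed
  then have "f \<in> socle - D" using f fD by (simp add: socle_def)
  moreover have "J = socle_ideal f"
  proof (intro equalityI subsetI)
    fix g assume "g \<in> J"
    then show "g \<in> socle_ideal f" using J_iff[OF J.in_carrier] by simp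
  next
    fix g assume g: "g \<in> socle_ideal f"
    then have "g \<in> P" by (simp add: socle_ideal_def)
    then show "g \<in> J" using J_iff g by simp
  qed
  ultimately show "J \<in> socle_ideal ` (socle - D)" by blast
next
  fix J assume "J \<in> socle_ideal ` (socle - D)"
  then obtain f where f: "f \<in> socle" "f \<notin> D" and J: "J = socle_ideal f" by blast
  have fP: "f \<in> P" using f by (simp add: socle_def)
  interpret J: pr_ideal n J unfolding J by (rule pr_idealI[OF socle_ideal_ideal[OF f(1)]])
  have "f \<in> J"
    using fP zero_in by (auto simp: J socle_ideal_def const_poly_ring_hom intro!: exI[of _ 1])
  have "D \<subseteq> J"
    using in_carrier by (auto simp: J socle_ideal_def const_poly_ring_hom intro!: exI[of _ 0])
  have if_cond: "if D = M then J = P else D \<subset> J \<and> J \<subseteq> M"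
  proof (cases "D = M")
    case True
    then have "f \<notin> M" using f by simp
    then have "J \<noteq> M" using \<open>f \<in> J\<close> by blast
    moreover have "J \<subseteq> P" by (auto simp: J socle_ideal_def)
    moreover have "M \<subseteq> J" using \<open>D \<subseteq> J\<close> True by simp
    ultimately have "J = P"
      using maximalideal.I_maximal[OF origin_ideal_maximal J.ideal] by blast
    then show ?thesis using True by simp
  next
    case False
    have "f \<in> M"
    proof (rule ccontr)
      assume fM: "f \<notin> M"
      have "M \<subseteq> D"
      proof
        fix g assume g: "g \<in> M"
        then have gP: "g \<in> P" and g0: "Poly_Mapping.lookup g 0 = 0" by (auto simp: origin_ideal_def)
        have "g * f \<in> D" using mult_socle[OF f(1) gP] g0 by (simp add: const_poly_ring_hom)
        then show "g \<in> D" using cancel_unit[OF gP fP _ fM] by simp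
      qed
      then show False using D_subset False by blast
    qed
    interpret M: pr_ideal n M by (rule pr_idealI[OF origin_ideal_ideal])
    have "J \<subseteq> M"
    proof
      fix g assume "g \<in> J"
      then obtain c where "g - const_poly c * f \<in> M" using D_subset by (auto simp: J socle_ideal_def)
      from M.add_in[OF this M.const_in[OF \<open>f \<in> M\<close>, of c]] show "g \<in> M" by simp
    qed
    then show ?thesis using False \<open>D \<subseteq> J\<close> \<open>f \<in> J\<close> f(2) by auto
  qed
  have "ring.dimension (RX n D) (Suc 0) (K_in n D) (res ` J)"
    unfolding ring.dimension_Suc_0_iff[OF quot_ring]
    using line_extension_zero[OF fP] res_socle_ideal[OF fP] res_in_carrier[OF fP] res_eq_zero_iff[OF fP] f(2)
    by (intro bexI[of _ "res f"]) (auto simp: J)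
  then have "\<exists>d. ring.dimension (RX n D) d (K_in n D) (res ` J) \<and>
      ring.dimension (RX n M) d (K_in n M) (carrier (RX n M))"
    using origin_ideal_quotient_dimension by blast
  then show "J \<in> minimal_divisors n [D] [M] 0"
    unfolding minimal_divisors_def using if_cond J.ideal by (intro CollectI exI[of _ J]) simp
qed

lemma filt_const_mult:
  assumes f: "f \<in> P" and "res f \<in> filt n D i"
  shows "res (const_poly c * f) \<in> filt n D i"
proof -
  obtain g where g: "g \<in> P" "\<forall>m\<in>Poly_Mapping.keys g. int (tdeg m) \<le> i" "f - g \<in> D"
    using assms res_in_filt_iff by blast
  have "const_poly c * f - const_poly c * g \<in> D"
    using const_in[OF g(3), of c] by (simp add: algebra_simps)
  moreover have "\<forall>m\<in>Poly_Mapping.keys (const_poly c * g). int (tdeg m) \<le> i"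
    using g(2) by (auto simp: in_keys_iff lookup_const_mult)
  ultimately show ?thesis
    using res_in_filt_iff[of "const_poly c * f" i] f g(1) by (auto simp: mult_carrier)
qed

lemma filt_mono: "i \<le> j \<Longrightarrow> filt n D i \<subseteq> filt n D j"
  unfolding filt_eq by (intro image_mono) auto

lemma filt_neg:
  assumes "f \<in> P" "f \<notin> D" "res f \<in> filt n D i" shows "0 \<le> i"
proof (rule ccontr)
  assume "\<not> 0 \<le> i"
  moreover obtain g where g: "g \<in> P" "\<forall>m\<in>Poly_Mapping.keys g. int (tdeg m) \<le> i" "f - g \<in> D"
    using assms res_in_filt_iff by blast
  ultimately have "Poly_Mapping.keys g = {}"
    by (metis all_not_in_conv of_nat_0_le_iff order_trans)
  then show False using g assms by simp
qed

end

text \<open>The hypotheses on the filtration say that the regularity index is \<open>d\<close>.\<close>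

locale origin_primary_reg = origin_primary +
  assumes filt_d: "filt n D (int d) = carrier (RX n D)"
    and filt_below_d: "filt n D (int d - 1) \<noteq> carrier (RX n D)"
begin

lemma filt_subset_carrier: "filt n D i \<subseteq> carrier (RX n D)"
  by (auto simp: filt_eq carrier_quot)

lemma reg_index_eq: "reg_index n D = int d"
  unfolding reg_index_def
proof (rule Least_equality)
  show "\<forall>j\<ge>int d. filt n D j = carrier (RX n D)"
    using filt_mono filt_subset_carrier filt_d by blast
  fix i assume i: "\<forall>j\<ge>i. filt n D j = carrier (RX n D)"
  show "int d \<le> i"
  proof (rule ccontr)
    assume "\<not> int d \<le> i"
    then have "i \<le> int d - 1" by simp
    then show False using i filt_below_d by blast
  qed
qed

lemma ord_filt_le_iff:
  assumes f: "f \<in> P" "f \<notin> D"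
  shows "ord_filt n D (res f) \<le> i \<longleftrightarrow> res f \<in> filt n D i"
proof -
  let ?k = "LEAST k. res f \<in> filt n D (int k)"
  have ex: "res f \<in> filt n D (int d)" using filt_d f(1) by (simp add: res_in_carrier)
  have k: "res f \<in> filt n D (int ?k)" by (rule LeastI[of _ d]) (rule ex)
  have le: "int ?k \<le> j" if "res f \<in> filt n D j" for j
  proof -
    have "0 \<le> j" using filt_neg f that by blast
    then have "?k \<le> nat j" using that by (intro Least_le) simp
    then show ?thesis using \<open>0 \<le> j\<close> by linarith
  qed
  have "ord_filt n D (res f) = int ?k"
    unfolding ord_filt_def by (rule Least_equality) (use k le in auto)
  then show ?thesis using le k filt_mono by auto
qed

lemma reg_index_divisor_eq:
  assumes f: "f \<in> P" "f \<notin> D"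
  shows "reg_index_divisor n D (socle_ideal f) = ord_filt n D (res f)"
proof -
  have *: "ord_filt n D (res (const_poly c * f)) = ord_filt n D (res f)"
    if c: "const_poly c * f \<notin> D" for c
  proof -
    have "c \<noteq> 0" using c zero_in by (auto simp: const_poly_ring_hom)
    have cf: "const_poly c * f \<in> P" using f by (simp add: mult_carrier)
    have inv: "const_poly (inverse c) * (const_poly c * f) = f"
      using \<open>c \<noteq> 0\<close> by (simp add: const_poly_def mult_single flip: mult.assoc)
    have "res (const_poly c * f) \<in> filt n D i \<longleftrightarrow> res f \<in> filt n D i" for i
      using filt_const_mult[OF f(1), of i c] filt_const_mult[OF cf, of i "inverse c"]
      by (simp only: inv) blast
    then have "ord_filt n D (res (const_poly c * f)) \<le> i \<longleftrightarrow> ord_filt n D (res f) \<le> i" for i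
      using ord_filt_le_iff[OF f] ord_filt_le_iff[OF cf c] by simp
    then show ?thesis by (metis order_antisym order_refl)
  qed
  have "ord_filt n D ` (res ` socle_ideal f - {\<zero>\<^bsub>RX n D\<^esub>}) = {ord_filt n D (res f)}"
  proof (intro equalityI subsetI)
    fix i assume "i \<in> ord_filt n D ` (res ` socle_ideal f - {\<zero>\<^bsub>RX n D\<^esub>})"
    then obtain c where c: "i = ord_filt n D (res (const_poly c * f))" "res (const_poly c * f) \<noteq> \<zero>\<^bsub>RX n D\<^esub>"
      unfolding res_socle_ideal[OF f(1)] by blast
    then have "const_poly c * f \<notin> D" using f by (simp add: res_eq_zero_iff mult_carrier)
    then show "i \<in> {ord_filt n D (res f)}" using c * by simp
  next
    fix i assume "i \<in> {ord_filt n D (res f)}"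
    moreover have "res f \<in> res ` socle_ideal f - {\<zero>\<^bsub>RX n D\<^esub>}"
      using f res_eq_zero_iff[OF f(1)] unfolding res_socle_ideal[OF f(1)]
      by (auto simp: const_poly_ring_hom intro!: exI[of _ 1])
    ultimately show "i \<in> ord_filt n D ` (res ` socle_ideal f - {\<zero>\<^bsub>RX n D\<^esub>})" by blast
  qed
  then show ?thesis by (simp add: reg_index_divisor_def)
qed

text \<open>The separator degree is the least order of a nonzero element of the socle, and no order exceeds the
  regularity index \<open>d\<close>.\<close>

lemma cayley_bacharach_iff:
  "cayley_bacharach n D \<longleftrightarrow> (\<forall>f\<in>socle - D. res f \<notin> filt n D (int d - 1))"
proof -
  let ?X = "(\<lambda>f. ord_filt n D (res f)) ` (socle - D)"
  have "reg_index_divisor n D ` minimal_divisors n [D] [M] 0 = ?X"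
    unfolding minimal_divisors_eq image_image
    by (intro image_cong refl) (auto simp: reg_index_divisor_eq socle_carrier)
  then have "cayley_bacharach n D \<longleftrightarrow> Min ?X = int d"
    by (auto simp: cayley_bacharach_def primary_decomposition_iff sepdeg_def reg_index_eq)
  also have "\<dots> \<longleftrightarrow> (\<forall>f\<in>socle - D. \<not> ord_filt n D (res f) \<le> int d - 1)"
  proof -
    have bounds: "0 \<le> ord_filt n D (res f)" "ord_filt n D (res f) \<le> int d" if "f \<in> socle - D" for f
      using that filt_neg[of f] ord_filt_le_iff[of f] filt_d socle_carrier[of f] res_in_carrier[of f] by auto
    then have "?X \<subseteq> {0..int d}" by auto
    then have "finite ?X" by (rule finite_subset) simp
    moreover have "?X \<noteq> {}"
    proof -
      obtain t where "trm_poly t * 1 \<in> socle - D"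
        using ex_trm_mult_socle[OF one_carrier proper] by blast
      then show ?thesis by blast
    qed
    ultimately have Min: "int d \<le> Min ?X \<longleftrightarrow> (\<forall>x\<in>?X. int d \<le> x)" "Min ?X \<in> ?X"
      by (rule Min_ge_iff, rule Min_in)
    then have "Min ?X \<le> int d" using bounds by auto
    then have "Min ?X = int d \<longleftrightarrow> int d \<le> Min ?X" by linarith
    also have "\<dots> \<longleftrightarrow> (\<forall>f\<in>socle - D. int d \<le> ord_filt n D (res f))"
      unfolding Min(1) by (rule ball_simps(9))
    also have "\<dots> \<longleftrightarrow> (\<forall>f\<in>socle - D. \<not> ord_filt n D (res f) \<le> int d - 1)"
      by (intro ball_cong refl) linarith
    finally show ?thesis .
  qed
  also have "\<dots> \<longleftrightarrow> (\<forall>f\<in>socle - D. res f \<notin> filt n D (int d - 1))"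
    using ord_filt_le_iff socle_carrier by blast
  finally show ?thesis .
qed

end

section \<open>Multiplication matrices with entries in a field\<close>

text \<open>The multiplication matrices of \<^term>\<open>mult_mat_with\<close> with entries in any ring, so that the generic
  matrices and their values at a point are instances of the same function.\<close>

definition num_mat :: "nat trm list \<Rightarrow> nat trm list \<Rightarrow> (nat \<times> nat \<Rightarrow> 'a::{zero,one}) \<Rightarrow> nat \<Rightarrow> 'a mat" where
  "num_mat ts bs c r = mat (length ts) (length ts) (\<lambda>(i, j).
     let t = var_trm r + ts ! j in
     if t \<in> set ts then (if t = ts ! i then 1 else 0)
     else c (i, THE m. m < length bs \<and> bs ! m = t))"

lemma pow_mat_commute:
  assumes A: "A \<in> carrier_mat d d" and B: "B \<in> carrier_mat d d" and AB: "A * B = B * (A :: 'a::comm_ring_1 mat)"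
  shows "A ^\<^sub>m k * B = B * A ^\<^sub>m k"
proof (induction k)
  case 0
  then show ?case using A B by simp
next
  case (Suc k)
  have Ak: "A ^\<^sub>m k \<in> carrier_mat d d" using A by (rule pow_carrier_mat)
  have "A ^\<^sub>m Suc k * B = A ^\<^sub>m k * (A * B)" using assoc_mult_mat[OF Ak A B] by simp
  also have "\<dots> = (A ^\<^sub>m k * B) * A" using assoc_mult_mat[OF Ak B A] AB by simp
  also have "\<dots> = B * A ^\<^sub>m Suc k" using Suc assoc_mult_mat[OF B Ak A] by simp
  finally show ?case .
qed

lemma mat_mult_entry:
  assumes "A \<in> carrier_mat d d" "B \<in> carrier_mat d d" "i < d" "k < d"
  shows "(A * B) $$ (i, k) = (\<Sum>l<d. A $$ (i, l) * B $$ (l, k))"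
  using assms by (auto simp: scalar_prod_def lessThan_atLeast0)

lemma sum_mult_delta:
  fixes a :: "nat \<Rightarrow> 'a::comm_ring_1"
  assumes "k < N" shows "(\<Sum>l<N. a l * (if l = k then 1 else 0)) = a k"
proof -
  have "(\<Sum>l<N. a l * (if l = k then 1 else 0)) = (\<Sum>l<N. if l = k then a l else 0)"
    by (rule sum.cong) auto
  then show ?thesis using assms by simp
qed

lemma foldr_mat_carrier:
  assumes "\<And>r. r \<in> set xs \<Longrightarrow> A r \<in> carrier_mat d d"
  shows "foldr (\<lambda>r N. (A r ^\<^sub>m Poly_Mapping.lookup t r) * N) xs (1\<^sub>m d) \<in> carrier_mat d d"
  using assms by (induction xs) (auto intro!: mult_carrier_mat pow_carrier_mat)

lemma foldr_mat_var:
  fixes A :: "nat \<Rightarrow> 'a::comm_ring_1 mat"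
  assumes A: "\<And>r. r \<in> set xs \<Longrightarrow> A r \<in> carrier_mat d d"
    and comm: "\<And>r s. r \<in> set xs \<Longrightarrow> s \<in> set xs \<Longrightarrow> A r * A s = A s * A r"
    and "distinct xs" "r \<in> set xs"
  shows "foldr (\<lambda>s N. (A s ^\<^sub>m Poly_Mapping.lookup (var_trm r + t) s) * N) xs (1\<^sub>m d) =
    A r * foldr (\<lambda>s N. (A s ^\<^sub>m Poly_Mapping.lookup t s) * N) xs (1\<^sub>m d)"
  using assms
proof (induction xs)
  case (Cons x xs)
  let ?F = "\<lambda>u. foldr (\<lambda>s N. (A s ^\<^sub>m Poly_Mapping.lookup u s) * N) xs (1\<^sub>m d)"
  have F: "?F u \<in> carrier_mat d d" for u
    using Cons.prems(1) by (intro foldr_mat_carrier) auto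
  have Ar: "A r \<in> carrier_mat d d" and Ax: "A x \<in> carrier_mat d d" using Cons.prems(1,4) by auto
  have pow: "A x ^\<^sub>m k \<in> carrier_mat d d" for k using Ax by (rule pow_carrier_mat)
  show ?case
  proof (cases "r = x")
    case True
    have same: "?F (var_trm r + t) = ?F t"
      using Cons.prems(3) True by (intro foldr_cong) (auto simp: lookup_add var_trm_def lookup_single when_def)
    have l: "Poly_Mapping.lookup (var_trm r + t) x = Suc (Poly_Mapping.lookup t x)"
      using True by (simp add: lookup_add var_trm_def lookup_single)
    have "A x ^\<^sub>m Suc (Poly_Mapping.lookup t x) = A x * A x ^\<^sub>m Poly_Mapping.lookup t x"
      using pow_mat_commute[OF Ax Ax refl] by simp
    then show ?thesis
      using assoc_mult_mat[OF Ax pow F] True same l by simp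
  next
    case False
    have IH: "?F (var_trm r + t) = A r * ?F t"
      using Cons False by (intro Cons.IH) auto
    have l: "Poly_Mapping.lookup (var_trm r + t) x = Poly_Mapping.lookup t x"
      using False by (simp add: lookup_add var_trm_def lookup_single when_def)
    let ?p = "A x ^\<^sub>m Poly_Mapping.lookup t x"
    have "?p * (A r * ?F t) = (?p * A r) * ?F t" by (rule assoc_mult_mat[OF pow Ar F, symmetric])
    also have "?p * A r = A r * ?p" using Cons.prems(2,4) by (intro pow_mat_commute[OF Ax Ar]) auto
    also have "(A r * ?p) * ?F t = A r * (?p * ?F t)" by (rule assoc_mult_mat[OF Ar pow F])
    finally show ?thesis using IH l by simp
  qed
qed simp

lemma eval_trm_mat_carrier:
  assumes "\<And>r. r < n \<Longrightarrow> A r \<in> carrier_mat d d"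
  shows "eval_trm_mat n d A t \<in> carrier_mat d d"
  unfolding eval_trm_mat_def using assms by (intro foldr_mat_carrier) auto

lemma eval_trm_mat_var:
  assumes "\<And>r. r < n \<Longrightarrow> A r \<in> carrier_mat d d"
    and "\<And>r s. r < n \<Longrightarrow> s < n \<Longrightarrow> A r * A s = A s * A r" and "r < n"
  shows "eval_trm_mat n d A (var_trm r + t) = A r * eval_trm_mat n d A t"
  unfolding eval_trm_mat_def using assms by (intro foldr_mat_var) auto

lemma eval_trm_mat_0: 
  assumes "\<And>r. r < n \<Longrightarrow> A r \<in> carrier_mat d d"
  shows "eval_trm_mat n d A 0 = 1\<^sub>m d"
proof -
  have "dim_row (A r) = d" if "r < n" for r using carrier_matD(1)[OF assms[OF that]] .
  then have *: "set xs \<subseteq> {..<n} \<Longrightarrow> foldr (\<lambda>r N. (A r ^\<^sub>m Poly_Mapping.lookup 0 r) * N) xs (1\<^sub>m d) = 1\<^sub>m d" for xs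
    by (induction xs) auto
  show ?thesis unfolding eval_trm_mat_def by (rule *) auto
qed

locale border_setting =
  fixes n :: nat and ts bs :: "nat trm list"
  assumes oi: "order_ideal n (set ts)" and dist_ts: "distinct ts" and sorted_ts: "sorted (map tdeg ts)"
    and set_bs: "set bs = border n (set ts)" and dist_bs: "distinct bs"
begin

lemma ts_trms: "set ts \<subseteq> trms n"
  using oi by (simp add: order_ideal_def)

lemma keys_ts: "k < length ts \<Longrightarrow> Poly_Mapping.keys (ts ! k) \<subseteq> {..<n}"
  using ts_trms nth_mem by (fastforce simp: trms_def)

lemma ts_down:
  assumes "s + t \<in> set ts" shows "t \<in> set ts"
proof -
  have "t \<in> trms n" using subsetD[OF ts_trms assms] by (simp add: trms_def keys_trm_add)
  moreover have "trm_divides t (s + t)" unfolding trm_divides_def by (rule exI[of _ s]) (simp add: add.commute)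
  ultimately show ?thesis using oi assms unfolding order_ideal_def by blast
qed

lemma zero_in_ts: "0 \<in> set ts"
proof -
  have "ts \<noteq> []" using oi by (simp add: order_ideal_def)
  then have "hd ts + 0 \<in> set ts" by simp
  then show ?thesis by (rule ts_down)
qed

lemma length_ts_pos: "0 < length ts"
  using zero_in_ts by (cases ts) auto

lemma ts_0: "ts ! 0 = 0"
proof -
  obtain k where k: "k < length ts" "ts ! k = 0" using zero_in_ts by (metis in_set_conv_nth)
  then have "tdeg (ts ! 0) \<le> tdeg (ts ! k)"
    using sorted_nth_mono[OF sorted_ts, of 0 k] length_ts_pos by simp
  then show ?thesis using k by (simp add: tdeg_eq_0_iff)
qed

lemma bs_obtain:
  assumes "j < length bs"
  obtains r k where "r < n" "k < length ts" "bs ! j = var_trm r + ts ! k"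
proof -
  have "bs ! j \<in> border n (set ts)" using assms set_bs nth_mem by blast
  then show ?thesis using that by (auto simp: border_def in_set_conv_nth)
qed

lemma bs_not_ts: "j < length bs \<Longrightarrow> bs ! j \<notin> set ts"
  using set_bs nth_mem[of j bs] by (auto simp: border_def)

lemma keys_bs: "j < length bs \<Longrightarrow> Poly_Mapping.keys (bs ! j) \<subseteq> {..<n}"
  by (erule bs_obtain) (simp add: keys_trm_add keys_ts)

lemma var_cases:
  assumes "r < n" "k < length ts"
  obtains (ts) m where "m < length ts" "var_trm r + ts ! k = ts ! m"
    | (bs) j where "j < length bs" "var_trm r + ts ! k = bs ! j"
proof (cases "var_trm r + ts ! k \<in> set ts")
  case True
  then show ?thesis using ts by (metis in_set_conv_nth)
next
  case False
  then have "var_trm r + ts ! k \<in> set bs"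
    using assms(1) nth_mem[OF assms(2)] unfolding set_bs border_def by blast
  then show ?thesis using bs by (metis in_set_conv_nth)
qed

lemma num_mat_carrier [simp]: "num_mat ts bs c r \<in> carrier_mat (length ts) (length ts)"
  by (simp add: num_mat_def)

lemma num_mat_ts:
  assumes "i < length ts" "k < length ts" "m < length ts" "var_trm r + ts ! k = ts ! m"
  shows "num_mat ts bs c r $$ (i, k) = (if i = m then 1 else 0)"
  using assms dist_ts by (auto simp: num_mat_def nth_eq_iff_index_eq)

lemma the_border_index:
  assumes "j < length bs" shows "(THE m. m < length bs \<and> bs ! m = bs ! j) = j"
  using assms dist_bs by (intro the_equality) (auto simp: nth_eq_iff_index_eq)

lemma num_mat_bs:
  assumes "i < length ts" "k < length ts" "j < length bs" "var_trm r + ts ! k = bs ! j"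
  shows "num_mat ts bs c r $$ (i, k) = c (i, j)"
  using assms bs_not_ts[of j] by (simp add: num_mat_def the_border_index)

definition comb :: "(nat \<Rightarrow> 'l::field) \<Rightarrow> (nat, 'l) mpoly" where
  "comb c = (\<Sum>i<length ts. const_poly (c i) * trm_poly (ts ! i))"

lemma comb_carrier: "comb c \<in> carrier (PR n)"
  unfolding comb_def by (auto intro!: sum_carrier mult_carrier trm_poly_carrier dest: keys_ts)

lemma lookup_comb: "k < length ts \<Longrightarrow> Poly_Mapping.lookup (comb c) (ts ! k) = c k"
proof -
  assume k: "k < length ts"
  have "Poly_Mapping.lookup (comb c) (ts ! k) = (\<Sum>i<length ts. c i * (if i = k then 1 else 0))"
    unfolding comb_def lookup_sum const_mult_trm
    using k dist_ts by (intro sum.cong) (auto simp: lookup_single when_def nth_eq_iff_index_eq)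
  then show ?thesis using sum_mult_delta[OF k] by simp
qed

lemma keys_comb: "Poly_Mapping.keys (comb c) \<subseteq> {ts ! i | i. i < length ts \<and> c i \<noteq> 0}"
proof -
  have "Poly_Mapping.keys (comb c) \<subseteq> (\<Union>i<length ts. Poly_Mapping.keys (scaled_trm (c i) (ts ! i)))"
    unfolding comb_def const_mult_trm by (rule keys_sum)
  then show ?thesis by (auto split: if_splits)
qed

lemma comb_lookup:
  assumes "Poly_Mapping.keys f \<subseteq> set ts"
  shows "f = comb (\<lambda>i. Poly_Mapping.lookup f (ts ! i))"
proof -
  have "f = (\<Sum>m\<in>set ts. scaled_trm (Poly_Mapping.lookup f m) m)"
    by (rule poly_eq_sum_scaled_trm) (use assms in auto)
  also have "\<dots> = (\<Sum>i<length ts. scaled_trm (Poly_Mapping.lookup f (ts ! i)) (ts ! i))"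
    by (rule sum.reindex_bij_betw[OF bij_betw_nth, symmetric]) (use dist_ts in auto)
  finally show ?thesis by (simp add: comb_def const_mult_trm)
qed

definition border_poly :: "'l::field mat \<Rightarrow> nat \<Rightarrow> (nat, 'l) mpoly" where
  "border_poly \<Gamma> j = trm_poly (bs ! j) - comb (\<lambda>i. \<Gamma> $$ (i, j))"

lemma border_poly_carrier: "j < length bs \<Longrightarrow> border_poly \<Gamma> j \<in> carrier (PR n)"
  unfolding border_poly_def by (intro diff_carrier trm_poly_carrier keys_bs comb_carrier)

lemma I_pt_eq: "I_pt n ts bs \<Gamma> = genideal (PR n) (border_poly \<Gamma> ` {..<length bs})"
  unfolding I_pt_def border_poly_def comb_def by (rule arg_cong[of _ _ "genideal (PR n)"]) auto

lemma I_pt_ideal: "pr_ideal n (I_pt n ts bs \<Gamma>)"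
  unfolding I_pt_eq by (intro pr_idealI ring.genideal_ideal[OF poly_ring_ring]) (auto intro: border_poly_carrier)

lemma border_poly_in_I_pt: "j < length bs \<Longrightarrow> border_poly \<Gamma> j \<in> I_pt n ts bs \<Gamma>"
proof -
  have "border_poly \<Gamma> ` {..<length bs} \<subseteq> carrier (PR n)" by (auto intro: border_poly_carrier)
  from ring.genideal_self[OF poly_ring_ring this] show "j < length bs \<Longrightarrow> ?thesis"
    unfolding I_pt_eq by blast
qed

lemma I_pt_minimal:
  assumes "ideal I (PR n)" "\<And>j. j < length bs \<Longrightarrow> border_poly \<Gamma> j \<in> I"
  shows "I_pt n ts bs \<Gamma> \<subseteq> I"
  unfolding I_pt_eq using assms by (intro ring.genideal_minimal[OF poly_ring_ring]) auto

abbreviation mult_mat :: "'l::field mat \<Rightarrow> nat \<Rightarrow> 'l mat" where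
  "mult_mat \<Gamma> r \<equiv> num_mat ts bs (\<lambda>p. \<Gamma> $$ p) r"

text \<open>The product \<open>x\<^sub>r t\<^sub>k\<close> is in the order ideal or in the border, and in the second case a border
  polynomial replaces it by the combination of terms in the column of the matrix.\<close>

lemma var_mult_reduce:
  assumes "pr_ideal n I" "\<And>j. j < length bs \<Longrightarrow> border_poly \<Gamma> j \<in> I" "r < n" "k < length ts"
  shows "trm_poly (var_trm r) * trm_poly (ts ! k) - comb (\<lambda>i. mult_mat \<Gamma> r $$ (i, k)) \<in> I"
proof -
  interpret I: pr_ideal n I by fact
  have x: "trm_poly (var_trm r) * trm_poly (ts ! k) = trm_poly (var_trm r + ts ! k)"
    by (simp add: trm_poly_def mult_single)
  from assms(3,4) show ?thesis
  proof (cases rule: var_cases)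
    case (ts m)
    have "comb (\<lambda>i. mult_mat \<Gamma> r $$ (i, k)) = (\<Sum>i<length ts. if i = m then trm_poly (ts ! m) else 0)"
      unfolding comb_def
      by (rule sum.cong) (auto simp: num_mat_ts[OF _ assms(4) ts] const_poly_ring_hom)
    then have "comb (\<lambda>i. mult_mat \<Gamma> r $$ (i, k)) = trm_poly (ts ! m)" using ts by simp
    then show ?thesis using I.zero_in by (simp add: x ts)
  next
    case (bs j)
    have "comb (\<lambda>i. mult_mat \<Gamma> r $$ (i, k)) = comb (\<lambda>i. \<Gamma> $$ (i, j))"
      unfolding comb_def by (rule sum.cong) (auto simp: num_mat_bs[OF _ assms(4) bs])
    then show ?thesis using assms(2)[OF bs(1)] by (simp add: x bs border_poly_def)
  qed
qed

end

section \<open>Commuting multiplication matrices define a border basis\<close>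

locale border_point = border_setting +
  fixes \<Gamma> :: "'l::field mat"
  assumes comm: "\<And>r s. r < n \<Longrightarrow> s < n \<Longrightarrow> mult_mat \<Gamma> r * mult_mat \<Gamma> s = mult_mat \<Gamma> s * mult_mat \<Gamma> r"
begin

abbreviation "A \<equiv> mult_mat \<Gamma>"
abbreviation "I\<^sub>\<Gamma> \<equiv> I_pt n ts bs \<Gamma>"

definition trm_mat :: "nat trm \<Rightarrow> 'l mat" where
  "trm_mat t = eval_trm_mat n (length ts) A t"

text \<open>The coordinates of \<open>f e\<^sub>1\<close> in \<open>K\<^sup>\<mu>\<close>, which the commuting matrices make a module over \<open>P\<close>.\<close>

definition phi :: "(nat, 'l) mpoly \<Rightarrow> nat \<Rightarrow> 'l" where
  "phi f i = (\<Sum>m\<in>Poly_Mapping.keys f. Poly_Mapping.lookup f m * trm_mat m $$ (i, 0))"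

lemma phi_superset:
  assumes "finite S" "Poly_Mapping.keys f \<subseteq> S"
  shows "phi f i = (\<Sum>m\<in>S. Poly_Mapping.lookup f m * trm_mat m $$ (i, 0))"
  unfolding phi_def using assms
  by (intro sum.mono_neutral_left) (auto simp: in_keys_iff)

lemma phi_zero [simp]: "phi 0 i = 0"
  by (simp add: phi_def)

lemma phi_add: "phi (f + g) i = phi f i + phi g i"
  using keys_add[of f g]
  by (simp add: phi_superset[of "Poly_Mapping.keys f \<union> Poly_Mapping.keys g"] lookup_add distrib_right sum.distrib)

lemma phi_sum: "phi (sum h S) i = (\<Sum>x\<in>S. phi (h x) i)"
  by (induction S rule: infinite_finite_induct) (auto simp: phi_add)

lemma phi_scaled_trm: "phi (scaled_trm c m) i = c * trm_mat m $$ (i, 0)"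
  by (simp add: phi_superset[of "{m}"])

lemma phi_const_mult: "phi (const_poly c * f) i = c * phi f i"
proof -
  have "Poly_Mapping.keys (const_poly c * f) \<subseteq> Poly_Mapping.keys f"
    by (auto simp: in_keys_iff lookup_const_mult)
  from phi_superset[OF finite_keys this] show ?thesis
    by (simp add: lookup_const_mult phi_def sum_distrib_left mult.assoc)
qed

lemma phi_diff: "phi (f - g) i = phi f i - phi g i"
  using phi_add[of "f - g" g i] by simp

lemma trm_mat_carrier: "trm_mat t \<in> carrier_mat (length ts) (length ts)"
  unfolding trm_mat_def by (rule eval_trm_mat_carrier) simp

lemma trm_mat_0: "trm_mat 0 = 1\<^sub>m (length ts)"
  unfolding trm_mat_def by (rule eval_trm_mat_0) simp

lemma trm_mat_var:
  assumes "r < n" "i < length ts" "k < length ts"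
  shows "trm_mat (var_trm r + t) $$ (i, k) = (\<Sum>l<length ts. A r $$ (i, l) * trm_mat t $$ (l, k))"
proof -
  have "trm_mat (var_trm r + t) = A r * trm_mat t"
    unfolding trm_mat_def by (rule eval_trm_mat_var) (auto intro: comm assms(1))
  then show ?thesis using mat_mult_entry[OF num_mat_carrier trm_mat_carrier assms(2,3)] by simp
qed

lemma phi_one: "i < length ts \<Longrightarrow> phi 1 i = (if i = 0 then 1 else 0)"
proof -
  assume i: "i < length ts"
  have "phi 1 i = phi (scaled_trm 1 0) i" by simp
  also have "\<dots> = (if i = 0 then 1 else 0)" unfolding phi_scaled_trm trm_mat_0 using i length_ts_pos by simp
  finally show ?thesis .
qed

lemma phi_var_mult:
  assumes "r < n" "i < length ts"
  shows "phi (trm_poly (var_trm r) * f) i = (\<Sum>k<length ts. A r $$ (i, k) * phi f k)"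
proof -
  have "trm_poly (var_trm r) * f = (\<Sum>m\<in>Poly_Mapping.keys f. scaled_trm (Poly_Mapping.lookup f m) (var_trm r + m))"
    by (subst poly_eq_sum_scaled_trm[OF finite_keys order_refl, of f])
      (simp add: sum_distrib_left trm_poly_def mult_single)
  then have "phi (trm_poly (var_trm r) * f) i =
      (\<Sum>m\<in>Poly_Mapping.keys f. Poly_Mapping.lookup f m * (\<Sum>k<length ts. A r $$ (i, k) * trm_mat m $$ (k, 0)))"
    using assms length_ts_pos by (simp add: phi_sum phi_scaled_trm trm_mat_var)
  also have "\<dots> = (\<Sum>k<length ts. A r $$ (i, k) * phi f k)"
    unfolding phi_def sum_distrib_left by (subst sum.swap) (simp add: ac_simps)
  finally show ?thesis .
qed

lemma phi_trm_var:
  assumes "r < n" "i < length ts"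
  shows "phi (trm_poly (var_trm r + t)) i = (\<Sum>k<length ts. A r $$ (i, k) * phi (trm_poly t) k)"
  using phi_var_mult[OF assms, of "trm_poly t"] by (simp add: trm_poly_def mult_single)

text \<open>A term of the order ideal arises from \<open>1\<close> by multiplication with one indeterminate after another, and
  since all divisors are in the order ideal too, each step moves one unit vector to another.\<close>

lemma phi_ts:
  assumes "j < length ts" "i < length ts"
  shows "phi (trm_poly (ts ! j)) i = (if i = j then 1 else 0)"
proof -
  have "Poly_Mapping.keys (ts ! j) \<subseteq> {..<n}" using assms by (intro keys_ts)
  moreover have "Poly_Mapping.keys t \<subseteq> {..<n} \<Longrightarrow> (\<forall>j<length ts. t = ts ! j \<longrightarrow> (\<forall>i<length ts. phi (trm_poly t) i = (if i = j then 1 else 0)))" for t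
  proof (induction t rule: trm_induct)
    case 0
    show ?case
    proof (intro allI impI)
      fix j i assume j: "j < length ts" "0 = ts ! j" and i: "i < length ts"
      have "j = 0" using nth_eq_iff_index_eq[OF dist_ts j(1) length_ts_pos] j(2) ts_0 by simp
      then show "phi (trm_poly 0) i = (if i = j then 1 else 0)"
        using phi_one[OF i] by (simp add: trm_poly_def)
    qed
  next
    case (var r t)
    show ?case
    proof (intro allI impI)
      fix j i assume j: "j < length ts" "var_trm r + t = ts ! j" and i: "i < length ts"
      have "t \<in> set ts" by (rule ts_down[of "var_trm r"]) (use j in simp)
      then obtain k where k: "k < length ts" "t = ts ! k" by (metis in_set_conv_nth)
      then have "phi (trm_poly (var_trm r + t)) i = (\<Sum>l<length ts. A r $$ (i, l) * (if l = k then 1 else 0))"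
        using var i by (simp add: phi_trm_var)
      also have "\<dots> = A r $$ (i, k)" by (rule sum_mult_delta[OF k(1)])
      finally show "phi (trm_poly (var_trm r + t)) i = (if i = j then 1 else 0)"
        using num_mat_ts[OF i k(1) j(1), where r = r and c = "\<lambda>p. \<Gamma> $$ p"] j k by simp
    qed
  qed
  ultimately show ?thesis using assms by blast
qed

lemma phi_comb: "i < length ts \<Longrightarrow> phi (comb c) i = c i"
proof -
  assume i: "i < length ts"
  have "phi (comb c) i = (\<Sum>k<length ts. c k * (if k = i then 1 else 0))"
    unfolding comb_def phi_sum phi_const_mult using i by (intro sum.cong) (auto simp: phi_ts)
  then show ?thesis using sum_mult_delta[OF i] by simp
qed

lemma phi_bs:
  assumes "j < length bs" "i < length ts"
  shows "phi (trm_poly (bs ! j)) i = \<Gamma> $$ (i, j)"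
proof -
  obtain r k where rk: "r < n" "k < length ts" "bs ! j = var_trm r + ts ! k" by (rule bs_obtain[OF assms(1)])
  have "phi (trm_poly (bs ! j)) i = (\<Sum>l<length ts. A r $$ (i, l) * (if l = k then 1 else 0))"
    using rk assms by (simp add: phi_trm_var phi_ts)
  also have "\<dots> = A r $$ (i, k)" by (rule sum_mult_delta[OF rk(2)])
  finally show ?thesis using num_mat_bs[OF assms(2) rk(2) assms(1) rk(3)[symmetric], of "\<lambda>p. \<Gamma> $$ p"] rk(3) by simp
qed

lemma trm_mat_eq_phi:
  assumes "Poly_Mapping.keys t \<subseteq> {..<n}" "i < length ts" "k < length ts"
  shows "trm_mat t $$ (i, k) = phi (trm_poly t * trm_poly (ts ! k)) i"
  using assms(1,2)
proof (induction t arbitrary: i rule: trm_induct)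
  case 0
  then show ?case using assms(3) by (simp add: trm_mat_0 phi_ts trm_poly_def[of 0])
next
  case (var r t)
  have eq: "trm_poly (var_trm r + t) * trm_poly (ts ! k) = trm_poly (var_trm r) * (trm_poly t * trm_poly (ts ! k) :: (nat, 'l) mpoly)"
    by (simp add: trm_poly_def mult_single add.assoc)
  show ?case unfolding eq using var assms(3) by (simp add: trm_mat_var phi_var_mult)
qed

text \<open>That this kernel is an ideal containing the border polynomials gives one inclusion between it
  and \<open>I\<^sub>\<Gamma>\<close>.\<close>

definition phi_kernel :: "(nat, 'l) mpoly set" where
  "phi_kernel = {f \<in> carrier (PR n). \<forall>i<length ts. phi f i = 0}"

lemma phi_kernel_ideal: "ideal phi_kernel (PR n)"
proof (rule poly_idealI)
  fix f g :: "(nat, 'l) mpoly" assume f: "f \<in> carrier (PR n)" and g: "g \<in> phi_kernel"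
  have trm: "Poly_Mapping.keys t \<subseteq> {..<n} \<Longrightarrow> \<forall>i<length ts. phi (trm_poly t * g) i = 0" for t
  proof (induction t rule: trm_induct)
    case 0
    then show ?case using g by (simp add: phi_kernel_def trm_poly_def)
  next
    case (var r t)
    have eq: "trm_poly (var_trm r + t) * g = trm_poly (var_trm r) * (trm_poly t * g)"
      by (simp add: trm_poly_def mult_single flip: mult.assoc)
    show ?case unfolding eq using var by (simp add: phi_var_mult)
  qed
  have "f * g = (\<Sum>t\<in>Poly_Mapping.keys f. const_poly (Poly_Mapping.lookup f t) * (trm_poly t * g))"
    by (subst poly_eq_sum_scaled_trm[OF finite_keys order_refl, of f])
      (simp add: sum_distrib_right flip: const_mult_trm mult.assoc)
  then have "\<forall>i<length ts. phi (f * g) i = 0"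
    using trm f by (simp add: phi_sum phi_const_mult poly_carrier_iff)
  then show "f * g \<in> phi_kernel" using f g by (simp add: phi_kernel_def mult_carrier)
qed (auto simp: phi_kernel_def phi_add intro: add_carrier)

lemma border_poly_in_kernel: "j < length bs \<Longrightarrow> border_poly \<Gamma> j \<in> phi_kernel"
  by (simp add: phi_kernel_def border_poly_carrier, simp add: border_poly_def phi_diff phi_bs phi_comb)

sublocale I\<Gamma>: pr_ideal n "I_pt n ts bs \<Gamma>"
  by (rule I_pt_ideal)

lemma comb_add: "comb (\<lambda>i. a i + b i) = comb a + comb b"
  by (simp add: comb_def const_poly_ring_hom distrib_right sum.distrib)

lemma comb_cong: "(\<And>i. i < length ts \<Longrightarrow> a i = b i) \<Longrightarrow> comb a = comb b"
  by (simp add: comb_def)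

lemma comb_mult: "const_poly c * comb a = comb (\<lambda>i. c * a i)"
  by (simp add: comb_def const_poly_ring_hom sum_distrib_left mult.assoc)

lemma comb_sum: "finite S \<Longrightarrow> (\<Sum>k\<in>S. comb (a k)) = comb (\<lambda>i. \<Sum>k\<in>S. a k i)"
  by (induction S rule: finite_induct) (auto simp: comb_add, simp add: comb_def const_poly_ring_hom)

text \<open>By induction on terms: if \<open>t\<close> is congruent to the combination of the \<open>t\<^sub>k\<close> given by \<open>phi\<close>, then so is
  \<open>x\<^sub>r t\<close>, because the products \<open>x\<^sub>r t\<^sub>k\<close> are reduced by the columns of \<open>A r\<close>.\<close>

lemma normal_form:
  assumes f: "f \<in> carrier (PR n)"
  shows "f - comb (phi f) \<in> I\<^sub>\<Gamma>"
proof -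
  have trm: "Poly_Mapping.keys t \<subseteq> {..<n} \<Longrightarrow> trm_poly t - comb (phi (trm_poly t)) \<in> I\<^sub>\<Gamma>" for t
  proof (induction t rule: trm_induct)
    case 0
    have "Poly_Mapping.keys (0 :: nat trm) \<subseteq> {..<n}" "(0 :: nat trm) \<in> set ts" using zero_in_ts by auto
    then have "trm_poly 0 = comb (\<lambda>i. Poly_Mapping.lookup (trm_poly 0 :: (nat, 'l) mpoly) (ts ! i))"
      by (intro comb_lookup) (simp add: trm_poly_def)
    moreover from this have "comb (phi (trm_poly 0)) = comb (\<lambda>i. Poly_Mapping.lookup (trm_poly 0 :: (nat, 'l) mpoly) (ts ! i))"
      using phi_comb by (metis comb_cong)
    ultimately show ?case using I\<Gamma>.zero_in by simp
  next
    case (var r t)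
    let ?x = "trm_poly (var_trm r) :: (nat, 'l) mpoly" and ?p = "phi (trm_poly t)"
    let ?a = "\<lambda>k. comb (\<lambda>i. A r $$ (i, k))"
    have "?x * (trm_poly t - comb ?p) \<in> I\<^sub>\<Gamma>"
      using var by (intro I\<Gamma>.mult_in carrier_intros) auto
    moreover have "(\<Sum>k<length ts. const_poly (?p k) * (?x * trm_poly (ts ! k) - ?a k)) \<in> I\<^sub>\<Gamma>"
      using var by (intro I\<Gamma>.sum_in I\<Gamma>.const_in var_mult_reduce I_pt_ideal border_poly_in_I_pt) auto
    ultimately have "?x * (trm_poly t - comb ?p) + (\<Sum>k<length ts. const_poly (?p k) * (?x * trm_poly (ts ! k) - ?a k)) \<in> I\<^sub>\<Gamma>"
      by (rule I\<Gamma>.add_in)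
    moreover have "?x * (trm_poly t - comb ?p) + (\<Sum>k<length ts. const_poly (?p k) * (?x * trm_poly (ts ! k) - ?a k))
        = ?x * trm_poly t - (\<Sum>k<length ts. const_poly (?p k) * ?a k)"
      by (simp add: right_diff_distrib sum_subtractf comb_def[of ?p] sum_distrib_left mult.left_commute)
    moreover have "(\<Sum>k<length ts. const_poly (?p k) * ?a k) = comb (phi (trm_poly (var_trm r + t)))"
      unfolding comb_mult comb_sum[OF finite_lessThan]
      using var by (intro comb_cong) (simp add: phi_trm_var mult.commute)
    moreover have "?x * trm_poly t = trm_poly (var_trm r + t)"
      by (simp add: trm_poly_def mult_single)
    ultimately show ?case by simp
  qed
  have "(\<Sum>t\<in>Poly_Mapping.keys f. const_poly (Poly_Mapping.lookup f t) * (trm_poly t - comb (phi (trm_poly t)))) \<in> I\<^sub>\<Gamma>"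
    using f trm by (intro I\<Gamma>.sum_in I\<Gamma>.const_in) (auto simp: poly_carrier_iff)
  moreover have "(\<Sum>t\<in>Poly_Mapping.keys f. const_poly (Poly_Mapping.lookup f t) * trm_poly t) = f"
    using poly_eq_sum_scaled_trm[OF finite_keys order_refl, of f] by (simp add: const_mult_trm)
  moreover have "(\<Sum>t\<in>Poly_Mapping.keys f. const_poly (Poly_Mapping.lookup f t) * comb (phi (trm_poly t))) = comb (phi f)"
    unfolding comb_mult comb_sum[OF finite_keys]
    by (intro comb_cong) (simp add: phi_def[of f] trm_poly_def phi_scaled_trm)
  ultimately show ?thesis by (simp add: right_diff_distrib sum_subtractf)
qed

lemma mem_I_pt_iff:
  assumes f: "f \<in> carrier (PR n)"
  shows "f \<in> I\<^sub>\<Gamma> \<longleftrightarrow> (\<forall>i<length ts. phi f i = 0)"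
proof
  assume "f \<in> I\<^sub>\<Gamma>"
  then show "\<forall>i<length ts. phi f i = 0"
    using I_pt_minimal[OF phi_kernel_ideal border_poly_in_kernel] by (auto simp: phi_kernel_def)
next
  assume "\<forall>i<length ts. phi f i = 0"
  then have "comb (phi f) = 0" by (simp add: comb_def const_poly_ring_hom)
  then show "f \<in> I\<^sub>\<Gamma>" using normal_form[OF f] by simp
qed

lemma phi_cong: "f \<in> carrier (PR n) \<Longrightarrow> g \<in> carrier (PR n) \<Longrightarrow> f - g \<in> I\<^sub>\<Gamma> \<Longrightarrow> i < length ts \<Longrightarrow> phi f i = phi g i"
  using mem_I_pt_iff[of "f - g"] by (simp add: phi_diff diff_carrier)

lemma one_notin: "1 \<notin> I\<^sub>\<Gamma>"
proof
  assume "1 \<in> I\<^sub>\<Gamma>"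
  then have "phi 1 0 = 0" using mem_I_pt_iff[OF one_carrier] length_ts_pos by blast
  then show False using phi_one[OF length_ts_pos] by simp
qed

lemma independent: "f \<in> I\<^sub>\<Gamma> \<Longrightarrow> Poly_Mapping.keys f \<subseteq> set ts \<Longrightarrow> f = 0"
proof -
  assume f: "f \<in> I\<^sub>\<Gamma>" "Poly_Mapping.keys f \<subseteq> set ts"
  then have "phi f i = 0" if "i < length ts" for i
    using mem_I_pt_iff[OF I\<Gamma>.in_carrier[OF f(1)]] that by simp
  then have "Poly_Mapping.lookup f (ts ! i) = 0" if "i < length ts" for i
    using that comb_lookup[OF f(2)] phi_comb by metis
  then show "f = 0" using comb_lookup[OF f(2)] by (simp add: comb_def const_poly_ring_hom)
qed

end

locale df_border_point = border_point n ts bs \<Gamma> for n ts bs and \<Gamma> :: "'l::field mat" +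
  assumes df: "\<And>i j. i < length ts \<Longrightarrow> j < length bs \<Longrightarrow> tdeg (ts ! i) > tdeg (bs ! j) \<Longrightarrow> \<Gamma> $$ (i, j) = 0"
begin

lemma A_deg:
  assumes "r < n" "i < length ts" "k < length ts" "A r $$ (i, k) \<noteq> 0"
  shows "tdeg (ts ! i) \<le> Suc (tdeg (ts ! k))"
  using assms(1,3)
proof (cases rule: var_cases)
  case (ts m)
  then have "i = m" using num_mat_ts[OF assms(2,3) ts, of "\<lambda>p. \<Gamma> $$ p"] assms(4) by (simp split: if_splits)
  then show ?thesis using ts(2)[symmetric] by simp
next
  case (bs j)
  then have "\<Gamma> $$ (i, j) \<noteq> 0" using num_mat_bs[OF assms(2,3) bs, of "\<lambda>p. \<Gamma> $$ p"] assms(4) by simp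
  then have "tdeg (ts ! i) \<le> tdeg (bs ! j)" using df[OF assms(2) bs(1)] by force
  then show ?thesis using bs(2)[symmetric] by simp
qed

lemma phi_trm_deg:
  assumes "Poly_Mapping.keys t \<subseteq> {..<n}" "i < length ts" "phi (trm_poly t) i \<noteq> 0"
  shows "tdeg (ts ! i) \<le> tdeg t"
  using assms
proof (induction t arbitrary: i rule: trm_induct)
  case 0
  then show ?case using phi_one[of i] by (cases "i = 0") (auto simp: ts_0 trm_poly_def)
next
  case (var r t)
  have "(\<Sum>k<length ts. A r $$ (i, k) * phi (trm_poly t) k) \<noteq> 0"
    using var.prems phi_trm_var[OF _ var.prems(1), of r t] var.hyps by simp
  then obtain k where k: "k < length ts" "A r $$ (i, k) * phi (trm_poly t) k \<noteq> 0"
    by (metis (no_types, lifting) lessThan_iff sum.neutral)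
  then have "tdeg (ts ! k) \<le> tdeg t" by (intro var.IH) auto
  moreover have "tdeg (ts ! i) \<le> Suc (tdeg (ts ! k))" using A_deg[of r i k] var k by auto
  ultimately show ?case by simp
qed

lemma phi_deg:
  assumes "f \<in> carrier (PR n)" "i < length ts" "phi f i \<noteq> 0"
  obtains t where "t \<in> Poly_Mapping.keys f" "tdeg (ts ! i) \<le> tdeg t"
proof -
  obtain m where m: "m \<in> Poly_Mapping.keys f" "Poly_Mapping.lookup f m * trm_mat m $$ (i, 0) \<noteq> 0"
    using assms(3) unfolding phi_def by (meson sum.not_neutral_contains_not_neutral)
  then have "phi (trm_poly m) i \<noteq> 0" by (simp add: trm_poly_def phi_scaled_trm)
  moreover have "Poly_Mapping.keys m \<subseteq> {..<n}" using assms(1) m by (auto simp: poly_carrier_iff)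
  ultimately show ?thesis using that[OF m(1)] phi_trm_deg assms(2) by blast
qed

lemma res_in_filt_iff_phi:
  assumes f: "f \<in> carrier (PR n)"
  shows "I\<Gamma>.res f \<in> filt n I\<^sub>\<Gamma> e \<longleftrightarrow> (\<forall>i<length ts. phi f i \<noteq> 0 \<longrightarrow> int (tdeg (ts ! i)) \<le> e)"
proof
  assume "I\<Gamma>.res f \<in> filt n I\<^sub>\<Gamma> e"
  then obtain g where g: "g \<in> carrier (PR n)" "\<forall>m\<in>Poly_Mapping.keys g. int (tdeg m) \<le> e" "f - g \<in> I\<^sub>\<Gamma>"
    using I\<Gamma>.res_in_filt_iff[OF f] by blast
  show "\<forall>i<length ts. phi f i \<noteq> 0 \<longrightarrow> int (tdeg (ts ! i)) \<le> e"
  proof (intro allI impI)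
    fix i assume i: "i < length ts" "phi f i \<noteq> 0"
    then have "phi g i \<noteq> 0" using phi_cong[OF f g(1,3)] by simp
    then obtain t where "t \<in> Poly_Mapping.keys g" "tdeg (ts ! i) \<le> tdeg t" using phi_deg g(1) i(1) by blast
    then show "int (tdeg (ts ! i)) \<le> e" using g(2) by force
  qed
next
  assume "\<forall>i<length ts. phi f i \<noteq> 0 \<longrightarrow> int (tdeg (ts ! i)) \<le> e"
  then have "\<forall>m\<in>Poly_Mapping.keys (comb (phi f)). int (tdeg m) \<le> e"
    using keys_comb[of "phi f"] by auto
  then show "I\<Gamma>.res f \<in> filt n I\<^sub>\<Gamma> e"
    using I\<Gamma>.res_in_filt_iff[OF f] comb_carrier normal_form[OF f] by blast
qed

lemma df_border_basis_I_pt: "df_border_basis n ts I\<^sub>\<Gamma>"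
  unfolding I\<Gamma>.df_border_basis_iff[OF ts_trms dist_ts]
proof (intro conjI ballI allI impI)
  fix f assume "f \<in> I\<^sub>\<Gamma>" "Poly_Mapping.keys f \<subseteq> set ts"
  then show "f = 0" by (rule independent)
next
  fix f :: "(nat, 'l) mpoly" and d assume f: "f \<in> carrier (PR n)" "\<forall>m\<in>Poly_Mapping.keys f. tdeg m \<le> d"
  have "tdeg (ts ! i) \<le> d" if "i < length ts" "phi f i \<noteq> 0" for i
    using phi_deg[OF f(1) that] f(2) by (metis order_trans)
  then have "Poly_Mapping.keys (comb (phi f)) \<subseteq> {t \<in> set ts. tdeg t \<le> d}"
    using keys_comb[of "phi f"] by auto
  then show "\<exists>g. Poly_Mapping.keys g \<subseteq> {t \<in> set ts. tdeg t \<le> d} \<and> f - g \<in> I\<^sub>\<Gamma>"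
    using normal_form[OF f(1)] by blast
qed

lemma zero_dim_scheme_I_pt: "zero_dim_scheme n I\<^sub>\<Gamma>"
  unfolding zero_dim_scheme_def
proof (intro conjI)
  show "ideal I\<^sub>\<Gamma> (PR n)" by (rule I\<Gamma>.ideal)
  show "I\<^sub>\<Gamma> \<noteq> carrier (PR n)" using I\<Gamma>.proper_iff one_notin by blast
  let ?Us = "map (\<lambda>t. residue n I\<^sub>\<Gamma> (trm_poly t)) ts"
  have Us: "set ?Us \<subseteq> carrier (RX n I\<^sub>\<Gamma>)"
    using ts_trms by (auto simp: trms_def intro!: I\<Gamma>.res_in_carrier trm_poly_carrier)
  have "carrier (RX n I\<^sub>\<Gamma>) = ring.Span (RX n I\<^sub>\<Gamma>) (K_in n I\<^sub>\<Gamma>) ?Us"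
  proof
    show "carrier (RX n I\<^sub>\<Gamma>) \<subseteq> ring.Span (RX n I\<^sub>\<Gamma>) (K_in n I\<^sub>\<Gamma>) ?Us"
    proof
      fix u assume "u \<in> carrier (RX n I\<^sub>\<Gamma>)"
      then obtain f where f: "f \<in> carrier (PR n)" "u = I\<Gamma>.res f" by (auto simp: I\<Gamma>.carrier_quot)
      then have "u = I\<Gamma>.res (comb (phi f))"
        using I\<Gamma>.res_eq_iff[OF f(1) comb_carrier] normal_form by simp
      moreover have "Poly_Mapping.keys (comb (phi f)) \<subseteq> set ts" using keys_comb[of "phi f"] by auto
      ultimately show "u \<in> ring.Span (RX n I\<^sub>\<Gamma>) (K_in n I\<^sub>\<Gamma>) ?Us"
        unfolding I\<Gamma>.Span_terms[OF ts_trms] by blast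
    qed
    show "ring.Span (RX n I\<^sub>\<Gamma>) (K_in n I\<^sub>\<Gamma>) ?Us \<subseteq> carrier (RX n I\<^sub>\<Gamma>)"
      by (rule ring.Span_subgroup_props(1)[OF I\<Gamma>.quot_ring I\<Gamma>.K_in_subfield[OF one_notin] Us])
  qed
  then show "ring.finite_dimension (RX n I\<^sub>\<Gamma>) (K_in n I\<^sub>\<Gamma>) (carrier (RX n I\<^sub>\<Gamma>))"
    using ring.Span_finite_dimension[OF I\<Gamma>.quot_ring I\<Gamma>.K_in_subfield[OF one_notin] Us] by simp
qed

end

context border_setting begin

text \<open>Conversely, a degree filtered border basis yields a point: the columns of \<open>\<Gamma>\<close> are the
  normal forms of the border terms, and the multiplication matrices commute since their
  columns are determined by the residue class ring.\<close>

lemma df_border_basis_imp_point: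
  fixes I :: "(nat, 'l::field) mpoly set"
  assumes "ideal I (PR n)" and "df_border_basis n ts I"
  obtains \<Gamma> where "\<Gamma> \<in> carrier_mat (length ts) (length bs)" "df_border_point n ts bs \<Gamma>" "I = I_pt n ts bs \<Gamma>"
proof -
  interpret I: pr_ideal n I by (rule pr_idealI[OF assms(1)])
  have ind: "f = 0" if "f \<in> I" "Poly_Mapping.keys f \<subseteq> set ts" for f
    using assms(2) that unfolding I.df_border_basis_iff[OF ts_trms dist_ts] by blast
  have red: "\<exists>g. Poly_Mapping.keys g \<subseteq> {t\<in>set ts. tdeg t \<le> d} \<and> f - g \<in> I"
    if "f \<in> carrier (PR n)" "\<forall>m\<in>Poly_Mapping.keys f. tdeg m \<le> d" for f :: "(nat, 'l) mpoly" and d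
    using assms(2) that unfolding I.df_border_basis_iff[OF ts_trms dist_ts] by blast
  define g where "g j = (SOME g. Poly_Mapping.keys g \<subseteq> {t\<in>set ts. tdeg t \<le> tdeg (bs ! j)} \<and> trm_poly (bs ! j) - g \<in> I)" for j
  have g: "Poly_Mapping.keys (g j) \<subseteq> {t\<in>set ts. tdeg t \<le> tdeg (bs ! j)}" "trm_poly (bs ! j) - g j \<in> I"
    if j: "j < length bs" for j
  proof -
    have ex: "\<exists>g. Poly_Mapping.keys g \<subseteq> {t\<in>set ts. tdeg t \<le> tdeg (bs ! j)} \<and> trm_poly (bs ! j) - g \<in> I"
      using j by (intro red trm_poly_carrier keys_bs) (auto simp: trm_poly_def)
    have *: "Poly_Mapping.keys (g j) \<subseteq> {t\<in>set ts. tdeg t \<le> tdeg (bs ! j)} \<and> trm_poly (bs ! j) - g j \<in> I"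
      unfolding g_def by (rule someI_ex) (rule ex)
    show "Poly_Mapping.keys (g j) \<subseteq> {t\<in>set ts. tdeg t \<le> tdeg (bs ! j)}"
      using * by (rule conjunct1)
    show "trm_poly (bs ! j) - g j \<in> I"
      using * by (rule conjunct2)
  qed
  define \<Gamma> where "\<Gamma> = mat (length ts) (length bs) (\<lambda>(i, j). Poly_Mapping.lookup (g j) (ts ! i))"
  have bp: "border_poly \<Gamma> j \<in> I" if j: "j < length bs" for j
  proof -
    have "comb (\<lambda>i. \<Gamma> $$ (i, j)) = comb (\<lambda>i. Poly_Mapping.lookup (g j) (ts ! i))"
      unfolding comb_def using j by (intro sum.cong) (auto simp: \<Gamma>_def)
    also have "\<dots> = g j" using g(1)[OF j] by (intro comb_lookup[symmetric]) auto
    finally show ?thesis using g(2)[OF j] by (simp add: border_poly_def)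
  qed
  have red_var: "trm_poly (var_trm r) * trm_poly (ts ! k) - comb (\<lambda>i. mult_mat \<Gamma> r $$ (i, k)) \<in> I"
    if "r < n" "k < length ts" for r k
    using bp that by (intro var_mult_reduce) unfold_locales
  have red2: "trm_poly (var_trm s) * (trm_poly (var_trm r) * trm_poly (ts ! k))
      - comb (\<lambda>l. (mult_mat \<Gamma> s * mult_mat \<Gamma> r) $$ (l, k)) \<in> I" if rs: "r < n" "s < n" and k: "k < length ts" for r s k
  proof -
    let ?x = "trm_poly (var_trm r) :: (nat, 'l) mpoly" and ?y = "trm_poly (var_trm s) :: (nat, 'l) mpoly"
    let ?a = "\<lambda>i. mult_mat \<Gamma> r $$ (i, k)" and ?b = "\<lambda>i. comb (\<lambda>l. mult_mat \<Gamma> s $$ (l, i))"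
    have "?y * (?x * trm_poly (ts ! k) - comb ?a) + (\<Sum>i<length ts. const_poly (?a i) * (?y * trm_poly (ts ! i) - ?b i)) \<in> I"
      using rs k by (intro I.add_in I.mult_in I.sum_in I.const_in red_var trm_poly_carrier) auto
    moreover have "?y * (?x * trm_poly (ts ! k) - comb ?a) + (\<Sum>i<length ts. const_poly (?a i) * (?y * trm_poly (ts ! i) - ?b i))
      = ?y * (?x * trm_poly (ts ! k)) - (\<Sum>i<length ts. const_poly (?a i) * ?b i)"
      by (simp add: right_diff_distrib sum_subtractf comb_def[of ?a] sum_distrib_left mult.left_commute)
    moreover have "(\<Sum>i<length ts. const_poly (?a i) * ?b i) = comb (\<lambda>l. (mult_mat \<Gamma> s * mult_mat \<Gamma> r) $$ (l, k))"
    proof (rule poly_mapping_eqI)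
      fix m
      show "Poly_Mapping.lookup (\<Sum>i<length ts. const_poly (?a i) * ?b i) m =
          Poly_Mapping.lookup (comb (\<lambda>l. (mult_mat \<Gamma> s * mult_mat \<Gamma> r) $$ (l, k))) m"
      proof (cases "m \<in> set ts")
        case True
        then obtain l where l: "l < length ts" "m = ts ! l" by (metis in_set_conv_nth)
        then show ?thesis
          by (simp add: lookup_sum lookup_const_mult lookup_comb mult.commute
              mat_mult_entry[OF num_mat_carrier num_mat_carrier l(1) k])
      next
        case False
        then have "Poly_Mapping.lookup (comb c) m = 0" for c :: "nat \<Rightarrow> 'l"
          using keys_comb[of c] by (auto simp: in_keys_iff)
        then show ?thesis by (simp add: lookup_sum lookup_const_mult)
      qed
    qed
    ultimately show ?thesis by simp
  qed
  have comm: "mult_mat \<Gamma> r * mult_mat \<Gamma> s = mult_mat \<Gamma> s * mult_mat \<Gamma> r" if rs: "r < n" "s < n" for r s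
  proof (rule eq_matI)
    fix l k assume "l < dim_row (mult_mat \<Gamma> s * mult_mat \<Gamma> r)" "k < dim_col (mult_mat \<Gamma> s * mult_mat \<Gamma> r)"
    then have l: "l < length ts" and k: "k < length ts" by (auto simp: num_mat_def)
    let ?c = "\<lambda>r s. comb (\<lambda>l. (mult_mat \<Gamma> s * mult_mat \<Gamma> r) $$ (l, k))"
    have "?c r s - ?c s r \<in> I"
      using I.diff_in[OF red2[OF rs(2,1) k] red2[OF rs k]] by (simp add: mult.left_commute)
    moreover have "Poly_Mapping.keys (?c r s - ?c s r) \<subseteq> set ts"
      using keys_diff[of "?c r s" "?c s r"] keys_comb by fastforce
    ultimately have "?c r s = ?c s r" using ind by fastforce
    then show "(mult_mat \<Gamma> r * mult_mat \<Gamma> s) $$ (l, k) = (mult_mat \<Gamma> s * mult_mat \<Gamma> r) $$ (l, k)"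
      using lookup_comb[OF l] by metis
  qed (auto simp: num_mat_def)
  have pt: "df_border_point n ts bs \<Gamma>"
  proof unfold_locales
    fix i j assume ij: "i < length ts" "j < length bs" "tdeg (bs ! j) < tdeg (ts ! i)"
    then have "ts ! i \<notin> Poly_Mapping.keys (g j)" using g(1)[of j] by auto
    then show "\<Gamma> $$ (i, j) = 0" using ij by (simp add: \<Gamma>_def in_keys_iff)
  qed (rule comm)
  interpret p: df_border_point n ts bs \<Gamma> by (rule pt)
  have sub: "I_pt n ts bs \<Gamma> \<subseteq> I" using bp by (rule I_pt_minimal[OF assms(1)])
  have "I \<subseteq> I_pt n ts bs \<Gamma>"
  proof
    fix f assume f: "f \<in> I"
    let ?c = "comb (p.phi f)"
    have "f - ?c \<in> I_pt n ts bs \<Gamma>" by (rule p.normal_form[OF I.in_carrier[OF f]])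
    then have "?c \<in> I" using I.diff_in[OF f, of "f - ?c"] sub by auto
    moreover have "Poly_Mapping.keys ?c \<subseteq> set ts" using keys_comb[of "p.phi f"] by auto
    ultimately have "?c = 0" using ind by blast
    then show "f \<in> I_pt n ts bs \<Gamma>" using \<open>f - ?c \<in> I_pt n ts bs \<Gamma>\<close> by simp
  qed
  then show ?thesis using that[OF _ pt] sub by (auto simp: \<Gamma>_def)
qed

end

section \<open>The homogeneous part of a point and the associated graded ring\<close>

context border_setting begin

definition hom_point :: "'l::field mat \<Rightarrow> 'l mat" where
  "hom_point \<Gamma> = mat (length ts) (length bs) (\<lambda>(i, j). if tdeg (ts ! i) = tdeg (bs ! j) then \<Gamma> $$ (i, j) else 0)"

lemma hom_point_entry:
  "i < length ts \<Longrightarrow> j < length bs \<Longrightarrow>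
    hom_point \<Gamma> $$ (i, j) = (if tdeg (ts ! i) = tdeg (bs ! j) then \<Gamma> $$ (i, j) else 0)"
  by (simp add: hom_point_def)

lemma mult_mat_hom_point:
  assumes "r < n" "i < length ts" "k < length ts"
  shows "mult_mat (hom_point \<Gamma>) r $$ (i, k) =
    (if tdeg (ts ! i) = Suc (tdeg (ts ! k)) then mult_mat \<Gamma> r $$ (i, k) else 0)"
  using assms(1,3)
proof (cases rule: var_cases)
  case (ts m)
  have "tdeg (ts ! m) = Suc (tdeg (ts ! k))"
    using arg_cong[OF ts(2)[symmetric], of tdeg] by simp
  then show ?thesis
    using num_mat_ts[OF assms(2,3) ts, of "\<lambda>p. \<Gamma> $$ p"] num_mat_ts[OF assms(2,3) ts, of "\<lambda>p. hom_point \<Gamma> $$ p"]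
    by auto
next
  case (bs j)
  have "tdeg (bs ! j) = Suc (tdeg (ts ! k))"
    using arg_cong[OF bs(2)[symmetric], of tdeg] by simp
  then show ?thesis
    using num_mat_bs[OF assms(2,3) bs, of "\<lambda>p. \<Gamma> $$ p"] num_mat_bs[OF assms(2,3) bs, of "\<lambda>p. hom_point \<Gamma> $$ p"]
      hom_point_entry[OF assms(2) bs(1), of \<Gamma>] by auto
qed

end

context df_border_point begin

text \<open>Each \<open>A r\<close> raises degrees by at most one, so that the part raising them by two of
  \<open>A r * A s\<close> is the product of the parts raising them by one.\<close>

lemma hom_mat_mult:
  assumes "r < n" "s < n" "i < length ts" "k < length ts"
  shows "(mult_mat (hom_point \<Gamma>) r * mult_mat (hom_point \<Gamma>) s) $$ (i, k) =
    (if tdeg (ts ! i) = Suc (Suc (tdeg (ts ! k))) then (A r * A s) $$ (i, k) else 0)"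
proof -
  let ?H = "mult_mat (hom_point \<Gamma>)"
  have entry: "?H r $$ (i, l) * ?H s $$ (l, k) =
      (if tdeg (ts ! i) = Suc (Suc (tdeg (ts ! k))) then A r $$ (i, l) * A s $$ (l, k) else 0)"
    if l: "l < length ts" for l
  proof -
    have 1: "A r $$ (i, l) = 0" if "tdeg (ts ! i) > Suc (tdeg (ts ! l))"
      using A_deg[OF assms(1,3) l] that by force
    have 2: "A s $$ (l, k) = 0" if "tdeg (ts ! l) > Suc (tdeg (ts ! k))"
      using A_deg[OF assms(2) l assms(4)] that by force
    show ?thesis
      using 1 2 mult_mat_hom_point[OF assms(1,3) l, of \<Gamma>] mult_mat_hom_point[OF assms(2) l assms(4), of \<Gamma>]
      by (cases "tdeg (ts ! l)" "Suc (tdeg (ts ! k))" rule: linorder_cases) auto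
  qed
  have prod: "(B * C) $$ (i, k) = (\<Sum>l<length ts. B $$ (i, l) * C $$ (l, k))"
    if "B \<in> carrier_mat (length ts) (length ts)" "C \<in> carrier_mat (length ts) (length ts)" for B C :: "'l mat"
    by (rule mat_mult_entry[OF that assms(3,4)])
  show ?thesis
    unfolding prod[OF num_mat_carrier num_mat_carrier] using entry by simp
qed

lemma hom_point_df_border_point: "df_border_point n ts bs (hom_point \<Gamma>)"
proof unfold_locales
  let ?H = "mult_mat (hom_point \<Gamma>)"
  fix r s assume rs: "r < n" "s < n"
  show "?H r * ?H s = ?H s * ?H r"
  proof (rule eq_matI)
    fix i k assume "i < dim_row (?H s * ?H r)" "k < dim_col (?H s * ?H r)"
    then have "i < length ts" "k < length ts" by (auto simp: num_mat_def)
    then show "(?H r * ?H s) $$ (i, k) = (?H s * ?H r) $$ (i, k)"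
      using rs by (simp only: hom_mat_mult comm[OF rs])
  qed (auto simp: num_mat_def)
next
  fix i j assume "i < length ts" "j < length bs" "tdeg (bs ! j) < tdeg (ts ! i)"
  then show "hom_point \<Gamma> $$ (i, j) = 0" by (simp add: hom_point_entry)
qed

end

text \<open>The homogeneous part is itself a degree filtered point, with a homogeneous part of its own; this
  locale adds it once.\<close>

locale graded_point = df_border_point n ts bs \<Gamma> for n ts bs and \<Gamma> :: "'l::field mat"
begin

sublocale H: df_border_point n ts bs "hom_point \<Gamma>"
  by (rule hom_point_df_border_point)

text \<open>As the matrices raise degrees by at most one, a coordinate of \<open>t\<close> of degree \<open>deg t\<close> can only arise
  from steps that raise the degree by exactly one, which the homogeneous matrices retain.\<close>

lemma H_phi_trm:
  assumes "Poly_Mapping.keys t \<subseteq> {..<n}" "i < length ts"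
  shows "H.phi (trm_poly t) i = (if tdeg (ts ! i) = tdeg t then phi (trm_poly t) i else 0)"
  using assms
proof (induction t arbitrary: i rule: trm_induct)
  case 0
  have "tdeg (ts ! i) = 0 \<longleftrightarrow> i = 0"
    using nth_eq_iff_index_eq[OF dist_ts 0(1) length_ts_pos] ts_0 by (simp add: tdeg_eq_0_iff)
  then show ?case
    using phi_one[OF 0(1)] phi_one[OF length_ts_pos] H.phi_one[OF 0(1)] by (auto simp: trm_poly_def)
next
  case (var r t)
  have r: "r < n" using var by simp
  have "H.phi (trm_poly (var_trm r + t)) i = (\<Sum>k<length ts. H.A r $$ (i, k) * H.phi (trm_poly t) k)"
    by (rule H.phi_trm_var[OF r var.prems])
  also have "\<dots> = (\<Sum>k<length ts. if tdeg (ts ! i) = Suc (tdeg t) then A r $$ (i, k) * phi (trm_poly t) k else 0)"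
  proof (rule sum.cong[OF refl])
    fix k assume "k \<in> {..<length ts}"
    then have k: "k < length ts" by simp
    have 1: "A r $$ (i, k) = 0" if "tdeg (ts ! i) > Suc (tdeg (ts ! k))"
      using A_deg[OF r var.prems k] that by force
    have 2: "phi (trm_poly t) k = 0" if "tdeg (ts ! k) > tdeg t"
      using phi_trm_deg[OF var.hyps(2) k] that by force
    show "H.A r $$ (i, k) * H.phi (trm_poly t) k =
        (if tdeg (ts ! i) = Suc (tdeg t) then A r $$ (i, k) * phi (trm_poly t) k else 0)"
      using 1 2 mult_mat_hom_point[OF r var.prems k, of \<Gamma>] var.IH[OF k]
      by (cases "tdeg (ts ! k)" "tdeg t" rule: linorder_cases) auto
  qed
  also have "\<dots> = (if tdeg (ts ! i) = Suc (tdeg t) then phi (trm_poly (var_trm r + t)) i else 0)"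
    by (simp add: phi_trm_var[OF r var.prems])
  finally show ?case by simp
qed

lemma hom_comp_carrier: "f \<in> carrier (PR n) \<Longrightarrow> hom_comp e f \<in> carrier (PR n)"
  unfolding hom_comp_def by (intro sum_carrier scaled_trm_carrier) (auto simp: poly_carrier_iff)

lemma H_phi_hom_comp:
  assumes f: "f \<in> carrier (PR n)" "\<forall>m\<in>Poly_Mapping.keys f. tdeg m \<le> e" and i: "i < length ts"
  shows "H.phi (hom_comp e f) i = (if tdeg (ts ! i) = e then phi f i else 0)"
proof -
  let ?c = "Poly_Mapping.lookup f"
  have scaled_trm: "H.phi (scaled_trm c m) i = c * H.phi (trm_poly m) i" "phi (scaled_trm c m) i = c * phi (trm_poly m) i" for c m
    by (simp_all add: trm_poly_def H.phi_scaled_trm phi_scaled_trm)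
  have "phi f i = phi (\<Sum>m\<in>Poly_Mapping.keys f. scaled_trm (?c m) m) i"
    using poly_eq_sum_scaled_trm[OF finite_keys order_refl, of f] by simp
  then have phi_f: "phi f i = (\<Sum>m\<in>Poly_Mapping.keys f. ?c m * phi (trm_poly m) i)"
    by (simp add: phi_sum scaled_trm)
  have "H.phi (hom_comp e f) i = (\<Sum>m\<in>{m\<in>Poly_Mapping.keys f. tdeg m = e}. ?c m * H.phi (trm_poly m) i)"
    unfolding hom_comp_def by (simp add: H.phi_sum scaled_trm)
  also have "\<dots> = (\<Sum>m\<in>Poly_Mapping.keys f. if tdeg m = e then ?c m * H.phi (trm_poly m) i else 0)"
    by (rule sum.inter_filter) simp
  also have "\<dots> = (\<Sum>m\<in>Poly_Mapping.keys f. if tdeg (ts ! i) = e then ?c m * phi (trm_poly m) i else 0)"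
  proof (rule sum.cong[OF refl])
    fix m assume m: "m \<in> Poly_Mapping.keys f"
    then have mn: "Poly_Mapping.keys m \<subseteq> {..<n}" and me: "tdeg m \<le> e" using f by (auto simp: poly_carrier_iff)
    have "phi (trm_poly m) i = 0" if "tdeg (ts ! i) > tdeg m"
      using phi_trm_deg[OF mn i] that by force
    then show "(if tdeg m = e then ?c m * H.phi (trm_poly m) i else 0) =
        (if tdeg (ts ! i) = e then ?c m * phi (trm_poly m) i else 0)"
      using H_phi_trm[OF mn i] me by auto
  qed
  finally show ?thesis by (simp add: phi_f)
qed

lemma tdeg_le_pdeg: "m \<in> Poly_Mapping.keys f \<Longrightarrow> tdeg m \<le> pdeg f"
  unfolding pdeg_def by (intro Max_ge) auto

text \<open>If \<open>f \<in> I\<^sub>\<Gamma>\<close> has degree \<open>e\<close>, the coordinates of its leading form for the homogeneous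
  matrices are the coordinates of \<open>f\<close> in degree \<open>e\<close>, which vanish. Conversely, the border
  polynomials of the homogeneous part are the leading forms of those of \<open>\<Gamma>\<close>.\<close>

lemma DF_I_pt: "DF n I\<^sub>\<Gamma> = I_pt n ts bs (hom_point \<Gamma>)"
proof
  let ?S = "{hom_comp (pdeg f) f | f. f \<in> I\<^sub>\<Gamma> \<and> f \<noteq> 0}"
  show "DF n I\<^sub>\<Gamma> \<subseteq> I_pt n ts bs (hom_point \<Gamma>)"
    unfolding DF_def
  proof (rule ring.genideal_minimal[OF poly_ring_ring H.I\<Gamma>.ideal], clarify)
    fix f assume f: "f \<in> I\<^sub>\<Gamma>" "f \<noteq> 0"
    have fP: "f \<in> carrier (PR n)" using I\<Gamma>.in_carrier[OF f(1)] .
    have deg: "\<forall>m\<in>Poly_Mapping.keys f. tdeg m \<le> pdeg f" by (intro ballI tdeg_le_pdeg)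
    have "\<forall>i<length ts. phi f i = 0" using mem_I_pt_iff[OF fP] f by simp
    then show "hom_comp (pdeg f) f \<in> I_pt n ts bs (hom_point \<Gamma>)"
      unfolding H.mem_I_pt_iff[OF hom_comp_carrier[OF fP]]
      by (simp add: H_phi_hom_comp[OF fP deg])
  qed
  have S: "?S \<subseteq> carrier (PR n)" using I\<Gamma>.in_carrier hom_comp_carrier by blast
  show "I_pt n ts bs (hom_point \<Gamma>) \<subseteq> DF n I\<^sub>\<Gamma>"
  proof (rule I_pt_minimal)
    show "ideal (DF n I\<^sub>\<Gamma>) (PR n)"
      unfolding DF_def by (rule ring.genideal_ideal[OF poly_ring_ring S])
    fix j assume j: "j < length bs"
    let ?f = "border_poly \<Gamma> j"
    have keys: "Poly_Mapping.keys ?f \<subseteq> insert (bs ! j) {ts ! i | i. i < length ts \<and> \<Gamma> $$ (i, j) \<noteq> 0}"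
      using keys_diff[of "trm_poly (bs ! j)" "comb (\<lambda>i. \<Gamma> $$ (i, j))"] keys_comb[of "\<lambda>i. \<Gamma> $$ (i, j)"]
      unfolding border_poly_def by (auto simp: trm_poly_def)
    have lookup_b: "Poly_Mapping.lookup ?f (bs ! j) = 1"
    proof -
      have "bs ! j \<notin> Poly_Mapping.keys (comb (\<lambda>i. \<Gamma> $$ (i, j)))"
        using keys_comb[of "\<lambda>i. \<Gamma> $$ (i, j)"] bs_not_ts[OF j] by auto
      then show ?thesis by (simp add: border_poly_def lookup_minus trm_poly_def in_keys_iff)
    qed
    have lookup_t: "Poly_Mapping.lookup ?f (ts ! i) = - \<Gamma> $$ (i, j)" if "i < length ts" for i
      using that bs_not_ts[OF j] by (auto simp: border_poly_def lookup_minus trm_poly_def lookup_comb lookup_single when_def)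
    have deg: "tdeg m \<le> tdeg (bs ! j)" if "m \<in> Poly_Mapping.keys ?f" for m
    proof -
      have "tdeg (ts ! i) \<le> tdeg (bs ! j)" if "i < length ts" "\<Gamma> $$ (i, j) \<noteq> 0" for i
        using df[OF that(1) j] that(2) by force
      then show ?thesis using that keys by auto
    qed
    have bk: "bs ! j \<in> Poly_Mapping.keys ?f" using lookup_b by (simp add: in_keys_iff)
    then have pdeg: "pdeg ?f = tdeg (bs ! j)"
      unfolding pdeg_def using deg by (intro Max_eqI) auto
    have "hom_comp (pdeg ?f) ?f = border_poly (hom_point \<Gamma>) j"
    proof (rule poly_mapping_eqI)
      fix m
      have "Poly_Mapping.lookup (hom_comp (pdeg ?f) ?f) m =
          (if tdeg m = tdeg (bs ! j) then Poly_Mapping.lookup ?f m else 0)"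
        unfolding hom_comp_def pdeg
        by (simp add: lookup_sum lookup_single when_def in_keys_iff sum.delta)
      also have "\<dots> = Poly_Mapping.lookup (border_poly (hom_point \<Gamma>) j) m"
      proof (cases "m \<in> set ts")
        case True
        then obtain i where i: "i < length ts" "m = ts ! i" by (metis in_set_conv_nth)
        then have "Poly_Mapping.lookup (border_poly (hom_point \<Gamma>) j) m = - hom_point \<Gamma> $$ (i, j)"
          using bs_not_ts[OF j] by (auto simp: border_poly_def lookup_minus trm_poly_def lookup_comb lookup_single when_def)
        then show ?thesis using lookup_t i hom_point_entry[OF i(1) j, of \<Gamma>] by simp
      next
        case False
        have "Poly_Mapping.lookup (comb c) m = 0" for c :: "nat \<Rightarrow> 'l"
          using keys_comb[of c] False by (auto simp: in_keys_iff)
        then show ?thesis by (simp add: border_poly_def lookup_minus trm_poly_def lookup_single when_def)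
      qed
      finally show "Poly_Mapping.lookup (hom_comp (pdeg ?f) ?f) m = Poly_Mapping.lookup (border_poly (hom_point \<Gamma>) j) m" .
    qed
    moreover have "?f \<noteq> 0" using bk by auto
    ultimately have "border_poly (hom_point \<Gamma>) j \<in> ?S"
      using border_poly_in_I_pt[OF j, of \<Gamma>] by force
    then show "border_poly (hom_point \<Gamma>) j \<in> DF n I\<^sub>\<Gamma>"
      using ring.genideal_self[OF poly_ring_ring S] unfolding DF_def by blast
  qed
qed

section \<open>The strict Cayley-Bacharach property of a point\<close>

definition top_deg :: nat where "top_deg = tdeg (last ts)"

lemma last_ts: "last ts = ts ! (length ts - 1)"
  using length_ts_pos by (simp add: last_conv_nth)

lemma tdeg_le_top: "i < length ts \<Longrightarrow> tdeg (ts ! i) \<le> top_deg"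
  unfolding top_deg_def last_ts using sorted_nth_mono[OF sorted_ts, of i "length ts - 1"] by simp

abbreviation "D \<equiv> I_pt n ts bs (hom_point \<Gamma>)"

lemma H_origin_primary: "origin_primary_reg n D top_deg"
proof (intro origin_primary_reg.intro origin_primary.intro origin_primary_axioms.intro origin_primary_reg_axioms.intro)
  show "pr_ideal n D" by (rule I_pt_ideal)
  show "1 \<notin> D" by (rule H.one_notin)
  fix t :: "nat trm" assume t: "t \<in> trms n" "tdeg t > top_deg"
  have "H.phi (trm_poly t) i = 0" if i: "i < length ts" for i
    using H_phi_trm[of t i] t tdeg_le_top[OF i] i by (auto simp: trms_def)
  moreover have "trm_poly t \<in> carrier (PR n :: (nat, 'l) mpoly ring)" using t by (intro trm_poly_carrier) (simp add: trms_def)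
  ultimately show "trm_poly t \<in> D" by (simp add: H.mem_I_pt_iff)
next
  show "filt n D (int top_deg) = carrier (RX n D)"
  proof
    show "filt n D (int top_deg) \<subseteq> carrier (RX n D)" by (auto simp: H.I\<Gamma>.filt_eq H.I\<Gamma>.carrier_quot)
    show "carrier (RX n D) \<subseteq> filt n D (int top_deg)"
      unfolding H.I\<Gamma>.carrier_quot using H.res_in_filt_iff_phi tdeg_le_top by auto
  qed
  let ?l = "length ts - 1"
  have l: "?l < length ts" using length_ts_pos by simp
  have c: "trm_poly (ts ! ?l) \<in> carrier (PR n :: (nat, 'l) mpoly ring)" using l by (intro trm_poly_carrier keys_ts)
  have "H.phi (trm_poly (ts ! ?l)) ?l \<noteq> 0" using H.phi_ts[OF l l] by simp
  then have "residue n D (trm_poly (ts ! ?l)) \<notin> filt n D (int top_deg - 1)"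
    using H.res_in_filt_iff_phi[OF c, of "int top_deg - 1"] l by (auto simp: top_deg_def last_ts)
  moreover have "residue n D (trm_poly (ts ! ?l)) \<in> carrier (RX n D)" by (rule H.I\<Gamma>.res_in_carrier[OF c])
  ultimately show "filt n D (int top_deg - 1) \<noteq> carrier (RX n D)" by blast
qed

lemma filt_below_top_iff:
  assumes "f \<in> carrier (PR n)"
  shows "residue n D f \<in> filt n D (int top_deg - 1) \<longleftrightarrow>
    (\<forall>i<length ts. tdeg (ts ! i) = top_deg \<longrightarrow> H.phi f i = 0)"
proof -
  have "int (tdeg (ts ! i)) \<le> int top_deg - 1 \<longleftrightarrow> tdeg (ts ! i) \<noteq> top_deg" if "i < length ts" for i
    using tdeg_le_top[OF that] by linarith
  then show ?thesis using H.res_in_filt_iff_phi[OF assms] by blast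
qed

text \<open>A nonzero ideal of the local ring \<open>P/D\<close> meets the socle, and a socle element generates an
  ideal of dimension one. Hence some nonzero socle element has order less than the maximal degree in the
  order ideal iff there is a nonzero \<open>f\<close> all of whose multiples have such an order.\<close>

lemma not_strict_cayley_bacharach_iff:
  "\<not> strict_cayley_bacharach n I\<^sub>\<Gamma> \<longleftrightarrow>
    (\<exists>v. (\<exists>i<length ts. v i \<noteq> 0) \<and>
      (\<forall>k<length ts. \<forall>i<length ts. tdeg (ts ! i) = top_deg \<longrightarrow> H.phi (comb v * trm_poly (ts ! k)) i = 0))"
    (is "_ \<longleftrightarrow> ?R")
proof -
  interpret O: origin_primary_reg n D top_deg by (rule H_origin_primary)
  let ?F = "filt n D (int top_deg - 1)"
  have tsP: "trm_poly (ts ! k) \<in> carrier (PR n :: (nat, 'l) mpoly ring)" if "k < length ts" for k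
    using that by (intro trm_poly_carrier keys_ts)
  have mult_comb: "H.phi (f * g) i = (\<Sum>k<length ts. H.phi g k * H.phi (f * trm_poly (ts ! k)) i)"
    if f: "f \<in> carrier (PR n)" and g: "g \<in> carrier (PR n)" and i: "i < length ts" for f g i
  proof -
    have "f * g - f * comb (H.phi g) \<in> D"
      using H.I\<Gamma>.mult_in[OF f H.normal_form[OF g]] by (simp add: right_diff_distrib)
    then have "H.phi (f * g) i = H.phi (f * comb (H.phi g)) i"
      using f g i by (intro H.phi_cong mult_carrier comb_carrier)
    also have "f * comb (H.phi g) = (\<Sum>k<length ts. const_poly (H.phi g k) * (f * trm_poly (ts ! k)))"
      by (simp add: comb_def sum_distrib_left mult.left_commute)
    finally show ?thesis by (simp add: H.phi_sum H.phi_const_mult)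
  qed
  have "\<not> strict_cayley_bacharach n I\<^sub>\<Gamma> \<longleftrightarrow> (\<exists>f\<in>O.socle - D. residue n D f \<in> ?F)"
    unfolding strict_cayley_bacharach_def DF_I_pt O.cayley_bacharach_iff by blast
  also have "\<dots> \<longleftrightarrow> ?R"
  proof
    assume "\<exists>f\<in>O.socle - D. residue n D f \<in> ?F"
    then obtain f where f: "f \<in> O.socle" "f \<notin> D" "residue n D f \<in> ?F" by blast
    have fP: "f \<in> carrier (PR n)" by (rule O.socle_carrier[OF f(1)])
    let ?v = "H.phi f"
    have fv: "f - comb ?v \<in> D" by (rule H.normal_form[OF fP])
    have "\<exists>i<length ts. ?v i \<noteq> 0" using f(2) H.mem_I_pt_iff[OF fP] by blast
    moreover have "H.phi (comb ?v * trm_poly (ts ! k)) i = 0"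
      if k: "k < length ts" and i: "i < length ts" "tdeg (ts ! i) = top_deg" for i k
    proof -
      let ?t = "trm_poly (ts ! k) :: (nat, 'l) mpoly"
      let ?c = "Poly_Mapping.lookup ?t 0"
      have 1: "?t * (f - comb ?v) \<in> D" by (rule H.I\<Gamma>.mult_in[OF tsP[OF k] fv])
      have 2: "?t * f - const_poly ?c * f \<in> D" by (rule O.mult_socle[OF f(1) tsP[OF k]])
      have "comb ?v * ?t - const_poly ?c * f \<in> D"
        using H.I\<Gamma>.diff_in[OF 2 1] by (simp add: algebra_simps)
      then have "H.phi (comb ?v * ?t) i = H.phi (const_poly ?c * f) i"
        using fP tsP[OF k] i by (intro H.phi_cong mult_carrier comb_carrier const_poly_carrier)
      also have "\<dots> = 0" using f(3) filt_below_top_iff[OF fP] i by (simp add: H.phi_const_mult)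
      finally show ?thesis .
    qed
    ultimately show ?R by blast
  next
    assume ?R
    then obtain v where v: "\<exists>i<length ts. v i \<noteq> 0"
      "\<And>k i. k < length ts \<Longrightarrow> i < length ts \<Longrightarrow> tdeg (ts ! i) = top_deg \<Longrightarrow> H.phi (comb v * trm_poly (ts ! k)) i = 0"
      by blast
    let ?f = "comb v"
    have "?f \<notin> D" using v(1) H.mem_I_pt_iff[OF comb_carrier] by (auto simp: H.phi_comb)
    then obtain t where t: "t \<in> trms n" "trm_poly t * ?f \<in> O.socle" "trm_poly t * ?f \<notin> D"
      using O.ex_trm_mult_socle[OF comb_carrier] by metis
    have tP: "trm_poly t \<in> carrier (PR n :: (nat, 'l) mpoly ring)" using t(1) by (intro trm_poly_carrier) (simp add: trms_def)
    have "H.phi (?f * trm_poly t) i = 0" if "i < length ts" "tdeg (ts ! i) = top_deg" for i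
      using mult_comb[OF comb_carrier tP that(1)] v(2) that by simp
    then have "residue n D (?f * trm_poly t) \<in> ?F"
      using filt_below_top_iff[OF mult_carrier[OF comb_carrier tP]] by blast
    then have "residue n D (trm_poly t * ?f) \<in> ?F" by (simp only: mult.commute)
    then show "\<exists>f\<in>O.socle - D. residue n D f \<in> ?F" using t by blast
  qed
  finally show ?thesis .
qed

end

section \<open>Maximal minors and the kernel\<close>

text \<open>The rows are chosen by a function that need not be monotone or injective, so that any row can be
  added to a minor.\<close>

definition row_minor :: "'a::comm_ring_1 mat \<Rightarrow> nat \<Rightarrow> (nat \<Rightarrow> nat) \<Rightarrow> 'a mat" where
  "row_minor A s r = mat s s (\<lambda>(a, b). A $$ (r a, b))"

text \<open>Let \<open>k + 1\<close> be the least number such that all minors of the first \<open>k + 1\<close> columns vanish, and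
  take a nonzero minor of the first \<open>k\<close> columns. With the next column and any row added, it becomes a
  vanishing minor. The expansions along the added row all have the same cofactors, and these form a vector
  in the kernel, nonzero because the last cofactor is the chosen minor.\<close>

lemma ex_kernel_if_row_minors_zero:
  fixes A :: "'a::field mat"
  assumes A: "A \<in> carrier_mat m q"
    and zero: "\<And>r. (\<And>a. a < q \<Longrightarrow> r a < m) \<Longrightarrow> det (row_minor A q r) = 0"
  shows "\<exists>v\<in>carrier_vec q. v \<noteq> 0\<^sub>v q \<and> A *\<^sub>v v = 0\<^sub>v m"
proof -
  let ?Q = "\<lambda>s. \<forall>r. (\<forall>a<s. r a < m) \<longrightarrow> det (row_minor A s r) = 0"
  define s where "s = (LEAST s. ?Q s)"
  have "?Q q" using zero by blast
  then have Qs: "?Q s" and "s \<le> q" unfolding s_def by (rule LeastI, rule Least_le)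
  have "\<not> ?Q 0" by (simp add: row_minor_def)
  then have "s \<noteq> 0" using Qs by metis
  then obtain k where k: "s = Suc k" by (cases s) auto
  then have kq: "k < q" using \<open>s \<le> q\<close> by simp
  have "\<not> ?Q k" using not_less_Least[of k ?Q] k unfolding s_def[symmetric] by simp
  then obtain r where r: "\<And>a. a < k \<Longrightarrow> r a < m" "det (row_minor A k r) \<noteq> 0" by blast
  define B where "B = (\<lambda>i. row_minor A (Suc k) (r(k := i)))"
  have B: "B i \<in> carrier_mat (Suc k) (Suc k)" for i by (simp add: B_def row_minor_def)
  \<comment> \<open>The last row of \<open>B i\<close> does not enter its cofactors.\<close>
  have del: "mat_delete (B i) k b = mat_delete (B 0) k b" if "b \<le> k" for i b
    using that by (intro eq_matI) (auto simp: mat_delete_def B_def row_minor_def)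
  define v where "v = vec q (\<lambda>b. if b \<le> k then cofactor (B 0) k b else 0)"
  have cof: "cofactor (B i) k b = v $ b" if "b \<le> k" for i b
    using that kq by (simp add: v_def cofactor_def del[of b i])
  have "v $ k \<noteq> 0"
  proof -
    have "mat_delete (B 0) k k = row_minor A k r"
      by (intro eq_matI) (auto simp: mat_delete_def B_def row_minor_def)
    then show ?thesis using r(2) kq by (simp add: v_def cofactor_def)
  qed
  then have "v \<noteq> 0\<^sub>v q" using kq by auto
  moreover have "A *\<^sub>v v = 0\<^sub>v m"
  proof (rule eq_vecI)
    fix i assume "i < dim_vec (0\<^sub>v m)"
    then have i: "i < m" by simp
    have "det (B i) = 0" using Qs r(1) i unfolding k B_def by (simp add: less_Suc_eq)
    then have "0 = (\<Sum>b<Suc k. B i $$ (k, b) * cofactor (B i) k b)"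
      using laplace_expansion_row[OF B, of k i] by simp
    also have "\<dots> = (\<Sum>b<Suc k. A $$ (i, b) * v $ b)"
      by (rule sum.cong) (auto simp: cof, simp add: B_def row_minor_def)
    also have "\<dots> = (\<Sum>b\<in>{0..<q}. A $$ (i, b) * v $ b)"
      using kq by (intro sum.mono_neutral_left) (auto simp: v_def)
    also have "\<dots> = (A *\<^sub>v v) $ i"
      using A i by (simp add: scalar_prod_def v_def)
    finally show "(A *\<^sub>v v) $ i = 0\<^sub>v m $ i" using i by simp
  qed (use A in auto)
  ultimately show ?thesis by (intro bexI[of _ v]) (auto simp: v_def)
qed

lemma pick_lessThan: "b < q \<Longrightarrow> pick {..<q} b = b"
proof -
  assume "b < q"
  moreover from this have "{a\<in>{..<q}. a < b} = {..<b}" by auto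
  ultimately show ?thesis using pick_card_in_set[of b "{..<q}"] by simp
qed

lemma submatrix_rows:
  assumes A: "A \<in> carrier_mat m q" and I: "I \<subseteq> {..<m}" "card I = q" and J: "J \<subseteq> {..<q}" "card J = q"
  shows "submatrix A I J = row_minor A q (pick I)"
proof -
  have "J = {..<q}" using J card_subset_eq[of "{..<q}" J] by simp
  moreover have "{i. i < m \<and> i \<in> I} = I" "{j. j < q \<and> j \<in> {..<q}} = {..<q}" using I by auto
  ultimately show ?thesis
    using A I unfolding submatrix_def row_minor_def by (intro eq_matI) (auto simp: pick_lessThan)
qed

text \<open>If the choice of rows is injective, the minor agrees up to sign with the one that has the same
  rows in increasing order.\<close>

lemma row_minor_eq_0_if_minors_0:
  fixes A :: "'a::field mat"
  assumes A: "A \<in> carrier_mat m q" and q: "q \<le> m"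
    and zero: "\<And>B. B \<in> maximal_minors A \<Longrightarrow> B = 0" and r: "\<And>a. a < q \<Longrightarrow> r a < m"
  shows "det (row_minor A q r) = 0"
proof (cases "inj_on r {..<q}")
  case False
  then obtain a b where ab: "a < q" "b < q" "a \<noteq> b" "r a = r b"
    by (auto simp: inj_on_def)
  show ?thesis
    by (rule det_identical_rows[of _ q a b]) (use ab in \<open>auto simp: row_minor_def intro!: eq_vecI\<close>)
next
  case True
  define I where "I = r ` {..<q}"
  have I: "I \<subseteq> {..<m}" "card I = q" "finite I"
    using r True by (auto simp: I_def card_image)
  have "det (submatrix A I {..<q}) \<in> maximal_minors A"
    unfolding maximal_minors_def
    by (intro CollectI exI[of _ I] exI[of _ "{..<q}"]) (use A I(1,2) q in \<open>auto simp: min_absorb2\<close>)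
  then have "det (submatrix A I {..<q}) = 0" by (rule zero)
  then have 0: "det (row_minor A q (pick I)) = 0"
    using submatrix_rows[OF A I(1,2), of "{..<q}"] by simp
  define p where "p a = (if a < q then card {x\<in>I. x < r a} else a)" for a
  have pick: "pick I (p a) = r a" and pa: "p a < q" if "a < q" for a
  proof -
    have "r a \<in> I" using that by (simp add: I_def)
    then show "pick I (p a) = r a" using that by (simp add: p_def pick_card_in_set)
    have "{x\<in>I. x < r a} \<subset> I" using \<open>r a \<in> I\<close> by blast
    then have "card {x\<in>I. x < r a} < q" using psubset_card_mono[OF I(3)] I(2) by metis
    then show "p a < q" using that by (simp add: p_def)
  qed
  have "inj_on p {0..<q}"
    using True pick by (metis (mono_tags, lifting) atLeastLessThan_iff inj_on_def lessThan_iff)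
  then have "p ` {0..<q} = {0..<q}"
    using pa by (intro card_subset_eq) (auto simp: card_image)
  then have "bij_betw p {0..<q} {0..<q}" using \<open>inj_on p {0..<q}\<close> by (simp add: bij_betw_def)
  then have perm: "p permutes {0..<q}"
    by (rule bij_imp_permutes) (simp add: p_def)
  have "row_minor A q r = mat q q (\<lambda>(i, j). row_minor A q (pick I) $$ (p i, j))"
    by (rule eq_matI) (auto simp: row_minor_def pick pa)
  then show ?thesis
    using det_permute_rows[OF _ perm, of "row_minor A q (pick I)"] 0 by (simp add: row_minor_def)
qed

lemma maximal_minors_zero_iff:
  fixes A :: "'a::field mat"
  assumes A: "A \<in> carrier_mat m q" and q: "q \<le> m"
  shows "(\<forall>B\<in>maximal_minors A. B = 0) \<longleftrightarrow> (\<exists>v\<in>carrier_vec q. v \<noteq> 0\<^sub>v q \<and> A *\<^sub>v v = 0\<^sub>v m)"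
proof
  assume "\<forall>B\<in>maximal_minors A. B = 0"
  then show "\<exists>v\<in>carrier_vec q. v \<noteq> 0\<^sub>v q \<and> A *\<^sub>v v = 0\<^sub>v m"
    using row_minor_eq_0_if_minors_0[OF A q] ex_kernel_if_row_minors_zero[OF A] by blast
next
  assume "\<exists>v\<in>carrier_vec q. v \<noteq> 0\<^sub>v q \<and> A *\<^sub>v v = 0\<^sub>v m"
  then obtain v where v: "v \<in> carrier_vec q" "v \<noteq> 0\<^sub>v q" "A *\<^sub>v v = 0\<^sub>v m" by blast
  show "\<forall>B\<in>maximal_minors A. B = 0"
  proof
    fix B assume "B \<in> maximal_minors A"
    then obtain I J where B: "B = det (submatrix A I J)" and IJ: "I \<subseteq> {..<m}" "card I = q" "J \<subseteq> {..<q}" "card J = q"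
      using A q by (auto simp: maximal_minors_def min_absorb2)
    let ?S = "row_minor A q (pick I)"
    have S: "?S \<in> carrier_mat q q" by (simp add: row_minor_def)
    have "?S *\<^sub>v v = 0\<^sub>v q"
    proof (rule eq_vecI)
      fix a assume "a < dim_vec (0\<^sub>v q)"
      then have a: "a < q" by simp
      have "{i. i < m \<and> i \<in> I} = I" using IJ by auto
      then have pm: "pick I a < m" using pick_le[of a m I] a IJ by simp
      have "(?S *\<^sub>v v) $ a = (A *\<^sub>v v) $ pick I a"
        using A a pm v(1) by (simp add: row_minor_def scalar_prod_def)
      then show "(?S *\<^sub>v v) $ a = 0\<^sub>v q $ a" using v(3) a pm by simp
    qed (simp add: row_minor_def)
    then have "det ?S = 0" using det_0_iff_vec_prod_zero_field[OF S] v by blast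
    then show "B = 0" using B submatrix_rows[OF A IJ] by simp
  qed
qed

section \<open>Rational points of the schemes\<close>

lemma (in comm_ring_hom) eval_trm_mat_hom:
  assumes "\<And>r. r < n \<Longrightarrow> A r \<in> carrier_mat d d"
  shows "map_mat hom (eval_trm_mat n d A t) = eval_trm_mat n d (\<lambda>r. map_mat hom (A r)) t"
proof -
  have "set xs \<subseteq> {..<n} \<Longrightarrow> map_mat hom (foldr (\<lambda>r N. (A r ^\<^sub>m Poly_Mapping.lookup t r) * N) xs (1\<^sub>m d)) =
      foldr (\<lambda>r N. (map_mat hom (A r) ^\<^sub>m Poly_Mapping.lookup t r) * N) xs (1\<^sub>m d)" for xs
  proof (induction xs)
    case Nil
    then show ?case by (simp add: mat_hom_one)
  next
    case (Cons r xs)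
    have A: "A r \<in> carrier_mat d d" using assms Cons.prems by simp
    have "foldr (\<lambda>r N. (A r ^\<^sub>m Poly_Mapping.lookup t r) * N) xs (1\<^sub>m d) \<in> carrier_mat d d"
      using assms Cons.prems by (intro foldr_mat_carrier) auto
    then show ?case
      using Cons mat_hom_mult[OF pow_carrier_mat[OF A]] mat_hom_pow[OF A] by simp
  qed
  then show ?thesis unfolding eval_trm_mat_def by (simp add: atLeast_upt[symmetric] lessThan_atLeast0)
qed

lemma eval_trm_mat_cong:
  assumes "\<And>r. r < n \<Longrightarrow> A r = B r"
  shows "eval_trm_mat n d A t = eval_trm_mat n d B t"
  unfolding eval_trm_mat_def using assms by (intro foldr_cong) auto

lemma (in comm_ring_hom) maximal_minors_hom:
  "maximal_minors (map_mat hom A) = hom ` maximal_minors A"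
proof -
  have sub: "submatrix (map_mat hom A) I J = map_mat hom (submatrix A I J)" for I J
    unfolding submatrix_def by (rule eq_matI) (auto simp: pick_le)
  have det: "det (submatrix (map_mat hom A) I J) = hom (det (submatrix A I J))" for I J
    unfolding sub by (rule hom_det)
  show ?thesis unfolding maximal_minors_def det by auto
qed

lemma foldr_append_rows_carrier:
  assumes "\<And>V. V \<in> set Vs \<Longrightarrow> V \<in> carrier_mat q q"
  shows "foldr append_rows Vs (0\<^sub>m 0 q) \<in> carrier_mat (length Vs * q) q"
  using assms by (induction Vs) auto

lemma foldr_append_rows_kernel:
  fixes v :: "'a::comm_ring_1 vec"
  assumes "\<And>V. V \<in> set Vs \<Longrightarrow> V \<in> carrier_mat q q" and v: "v \<in> carrier_vec q"
  shows "foldr append_rows Vs (0\<^sub>m 0 q) *\<^sub>v v = 0\<^sub>v (length Vs * q) \<longleftrightarrow> (\<forall>V\<in>set Vs. V *\<^sub>v v = 0\<^sub>v q)"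
  using assms(1)
proof (induction Vs)
  case Nil
  then show ?case by (auto intro!: eq_vecI)
next
  case (Cons V Vs)
  let ?W = "foldr append_rows Vs (0\<^sub>m 0 q)"
  have V: "V \<in> carrier_mat q q" and W: "?W \<in> carrier_mat (length Vs * q) q"
    using Cons.prems foldr_append_rows_carrier[of Vs q] by auto
  have zero: "0\<^sub>v (length (V # Vs) * q) = (0\<^sub>v q @\<^sub>v 0\<^sub>v (length Vs * q) :: 'a vec)"
    by (auto intro!: eq_vecI)
  have "foldr append_rows (V # Vs) (0\<^sub>m 0 q) *\<^sub>v v = (V *\<^sub>v v) @\<^sub>v (?W *\<^sub>v v)"
    using mat_mult_append[OF V W v] by simp
  then show ?case
    unfolding zero using append_vec_eq[of "V *\<^sub>v v" q "0\<^sub>v q" "?W *\<^sub>v v" "0\<^sub>v (length Vs * q)"] V v Cons by simp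
qed

lemma append_rows_index:
  assumes "A \<in> carrier_mat a q" "B \<in> carrier_mat b q" "i < a + b" "j < q"
  shows "(A @\<^sub>r B) $$ (i, j) = (if i < a then A $$ (i, j) else B $$ (i - a, j))"
  using assms by (simp add: append_rows_def)

lemma map_mat_append_rows:
  assumes "A \<in> carrier_mat a q" "B \<in> carrier_mat b q"
  shows "map_mat h (A @\<^sub>r B) = map_mat h A @\<^sub>r map_mat h B"
proof (rule eq_matI)
  have AB: "A @\<^sub>r B \<in> carrier_mat (a + b) q" "map_mat h A @\<^sub>r map_mat h B \<in> carrier_mat (a + b) q"
    using assms by auto
  then show "dim_row (map_mat h (A @\<^sub>r B)) = dim_row (map_mat h A @\<^sub>r map_mat h B)"
    "dim_col (map_mat h (A @\<^sub>r B)) = dim_col (map_mat h A @\<^sub>r map_mat h B)" by auto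
  fix i j assume "i < dim_row (map_mat h A @\<^sub>r map_mat h B)" "j < dim_col (map_mat h A @\<^sub>r map_mat h B)"
  then have ij: "i < a + b" "j < q" using AB by auto
  have "map_mat h (A @\<^sub>r B) $$ (i, j) = h ((A @\<^sub>r B) $$ (i, j))" using AB(1) ij by auto
  also have "\<dots> = (map_mat h A @\<^sub>r map_mat h B) $$ (i, j)"
    unfolding append_rows_index[OF assms ij] using assms ij
    by (subst append_rows_index[of _ a q _ b]) auto
  finally show "map_mat h (A @\<^sub>r B) $$ (i, j) = (map_mat h A @\<^sub>r map_mat h B) $$ (i, j)" .
qed

lemma (in comm_ring_hom) foldr_append_rows_hom:
  assumes "\<And>V. V \<in> set Vs \<Longrightarrow> V \<in> carrier_mat q q"
  shows "map_mat hom (foldr append_rows Vs (0\<^sub>m 0 q)) = foldr append_rows (map (map_mat hom) Vs) (0\<^sub>m 0 q)"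
  using assms
proof (induction Vs)
  case Nil
  then show ?case by (auto intro!: eq_matI)
next
  case (Cons V Vs)
  let ?W = "foldr append_rows Vs (0\<^sub>m 0 q)"
  have V: "V \<in> carrier_mat q q" and W: "?W \<in> carrier_mat (length Vs * q) q"
    using Cons.prems foldr_append_rows_carrier[of Vs q] by auto
  have "map_mat hom (V @\<^sub>r ?W) = map_mat hom V @\<^sub>r map_mat hom ?W"
    by (rule map_mat_append_rows[OF V W])
  then show ?case using Cons by simp
qed

text \<open>Matrices and determinants are formed over the type of all polynomials, while the ideals live in the
  polynomial ring in the indeterminates \<open>V\<close>.\<close>

definition mat_over :: "'v set \<Rightarrow> ('v, 'k::field) mpoly mat \<Rightarrow> bool" where
  "mat_over V A \<longleftrightarrow> (\<forall>i<dim_row A. \<forall>j<dim_col A. A $$ (i, j) \<in> carrier (poly_ring V))"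

lemma mat_over_mult:
  assumes "mat_over V A" "mat_over V B" "dim_col A = dim_row B"
  shows "mat_over V (A * B)"
  using assms by (auto simp: mat_over_def scalar_prod_def intro!: sum_carrier mult_carrier)

lemma mat_over_one: "mat_over V (1\<^sub>m d)"
  by (auto simp: mat_over_def)

lemma mat_over_minus:
  "mat_over V A \<Longrightarrow> mat_over V B \<Longrightarrow> dim_row A = dim_row B \<Longrightarrow> dim_col A = dim_col B \<Longrightarrow> mat_over V (A - B)"
  by (auto simp: mat_over_def intro!: diff_carrier)

lemma mat_over_pow:
  assumes A: "A \<in> carrier_mat d d" "mat_over V A"
  shows "mat_over V (A ^\<^sub>m k)"
proof (induction k)
  case 0
  then show ?case by (simp add: mat_over_one)
next
  case (Suc k)
  then show ?case using A pow_carrier_mat[OF A(1), of k] by (auto intro!: mat_over_mult)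
qed

lemma mat_over_eval_trm_mat:
  assumes "\<And>r. r < n \<Longrightarrow> A r \<in> carrier_mat d d" "\<And>r. r < n \<Longrightarrow> mat_over V (A r)"
  shows "mat_over V (eval_trm_mat n d A t)"
proof -
  have "set xs \<subseteq> {..<n} \<Longrightarrow> mat_over V (foldr (\<lambda>r N. (A r ^\<^sub>m Poly_Mapping.lookup t r) * N) xs (1\<^sub>m d))" for xs
  proof (induction xs)
    case Nil
    then show ?case by (simp add: mat_over_one)
  next
    case (Cons r xs)
    have A: "A r \<in> carrier_mat d d" "mat_over V (A r)" using assms Cons.prems by auto
    have F: "foldr (\<lambda>r N. (A r ^\<^sub>m Poly_Mapping.lookup t r) * N) xs (1\<^sub>m d) \<in> carrier_mat d d"
      using assms Cons.prems by (intro foldr_mat_carrier) auto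
    show ?case
      using Cons mat_over_pow[OF A] F pow_carrier_mat[OF A(1), of "Poly_Mapping.lookup t r"]
      by (auto intro!: mat_over_mult)
  qed
  then show ?thesis unfolding eval_trm_mat_def by (simp add: atLeast_upt[symmetric] lessThan_atLeast0)
qed

lemma mat_over_foldr_append_rows:
  assumes "\<And>A. A \<in> set As \<Longrightarrow> A \<in> carrier_mat q q" "\<And>A. A \<in> set As \<Longrightarrow> mat_over V A"
  shows "mat_over V (foldr append_rows As (0\<^sub>m 0 q))"
  using assms
proof (induction As)
  case Nil
  then show ?case by (simp add: mat_over_def)
next
  case (Cons A As)
  let ?W = "foldr append_rows As (0\<^sub>m 0 q)"
  have A: "A \<in> carrier_mat q q" "mat_over V A" and W: "?W \<in> carrier_mat (length As * q) q" "mat_over V ?W"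
    using Cons foldr_append_rows_carrier[of As q] by auto
  have AW: "A @\<^sub>r ?W \<in> carrier_mat (q + length As * q) q" using A(1) W(1) by auto
  have "(A @\<^sub>r ?W) $$ (i, j) \<in> carrier (poly_ring V)" if ij: "i < q + length As * q" "j < q" for i j
  proof -
    have "i - q < length As * q" if "\<not> i < q" using ij that by simp
    then show ?thesis
      using A(2) W(2) ij(2) carrier_matD[OF A(1)] carrier_matD[OF W(1)]
      unfolding append_rows_index[OF A(1) W(1) ij] mat_over_def by auto
  qed
  then show ?case using carrier_matD[OF AW] by (simp add: mat_over_def)
qed

lemma det_carrier:
  assumes "mat_over V A"
  shows "det A \<in> carrier (poly_ring V)"
proof (cases "dim_row A = dim_col A")
  case True
  have sign: "signof p \<in> carrier (poly_ring V)" for p :: "nat \<Rightarrow> nat"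
    by (simp add: sign_def carrier_intros)
  have "A $$ (i, p i) \<in> carrier (poly_ring V)" if "p permutes {0..<dim_row A}" "i \<in> {0..<dim_row A}" for p i
    using assms that True permutes_in_image[OF that(1), of i] by (auto simp: mat_over_def)
  then show ?thesis
    unfolding det_def using True sign by (auto intro!: sum_carrier mult_carrier prod_carrier)
qed (simp add: det_def)

lemma maximal_minors_carrier:
  assumes "mat_over V A" shows "maximal_minors A \<subseteq> carrier (poly_ring V)"
proof -
  have "mat_over V (submatrix A I J)" for I J
    using assms by (auto simp: mat_over_def submatrix_def pick_le)
  then show ?thesis by (auto simp: maximal_minors_def det_carrier)
qed

text \<open>The polynomials that vanish at a point form an ideal.\<close>

lemma genideal_vanish_iff:
  assumes \<iota>: "field_hom \<iota>" and S: "S \<subseteq> carrier (poly_ring V)"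
  shows "(\<forall>f\<in>genideal (poly_ring V) S. eval_mpoly \<iota> \<gamma> f = 0) \<longleftrightarrow> (\<forall>f\<in>S. eval_mpoly \<iota> \<gamma> f = 0)"
proof
  assume "\<forall>f\<in>genideal (poly_ring V) S. eval_mpoly \<iota> \<gamma> f = 0"
  then show "\<forall>f\<in>S. eval_mpoly \<iota> \<gamma> f = 0"
    using ring.genideal_self[OF poly_ring_ring S] by blast
next
  assume L: "\<forall>f\<in>S. eval_mpoly \<iota> \<gamma> f = 0"
  interpret e: comm_ring_hom "eval_mpoly \<iota> \<gamma>" by (rule eval_mpoly_comm_ring_hom[OF \<iota>])
  let ?I = "{f \<in> carrier (poly_ring V). eval_mpoly \<iota> \<gamma> f = 0}"
  have "ideal ?I (poly_ring V)"
    by (rule poly_idealI) (auto simp: e.hom_add e.hom_mult intro: add_carrier mult_carrier)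
  then have "genideal (poly_ring V) S \<subseteq> ?I"
    using L S by (intro ring.genideal_minimal[OF poly_ring_ring]) auto
  then show "\<forall>f\<in>genideal (poly_ring V) S. eval_mpoly \<iota> \<gamma> f = 0" by blast
qed

lemma mem_ideal_sum_iff: "f \<in> I <+>\<^bsub>poly_ring V\<^esub> J \<longleftrightarrow> (\<exists>a\<in>I. \<exists>b\<in>J. f = a + b)"
  by (auto simp: set_add_def' )

lemma ideal_sum_upper:
  assumes "ideal I (poly_ring V)" "ideal J (poly_ring V)"
  shows "I \<subseteq> I <+>\<^bsub>poly_ring V\<^esub> J" "J \<subseteq> I <+>\<^bsub>poly_ring V\<^esub> J"
proof -
  interpret I: poly_ideal V I using assms(1) by (rule poly_ideal.intro)
  interpret J: poly_ideal V J using assms(2) by (rule poly_ideal.intro)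
  show "I \<subseteq> I <+>\<^bsub>poly_ring V\<^esub> J"
  proof
    fix f assume "f \<in> I"
    then show "f \<in> I <+>\<^bsub>poly_ring V\<^esub> J"
      unfolding mem_ideal_sum_iff by (intro bexI[of _ f] bexI[of _ 0]) (auto simp: J.zero_in)
  qed
  show "J \<subseteq> I <+>\<^bsub>poly_ring V\<^esub> J"
  proof
    fix f assume "f \<in> J"
    then show "f \<in> I <+>\<^bsub>poly_ring V\<^esub> J"
      unfolding mem_ideal_sum_iff by (intro bexI[of _ f] bexI[of _ 0]) (auto simp: I.zero_in)
  qed
qed

lemma ideal_sum_vanish_iff:
  assumes \<iota>: "field_hom \<iota>" and "ideal I (poly_ring V)" "ideal J (poly_ring V)"
  shows "(\<forall>f\<in>I <+>\<^bsub>poly_ring V\<^esub> J. eval_mpoly \<iota> \<gamma> f = 0) \<longleftrightarrow>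
    (\<forall>f\<in>I. eval_mpoly \<iota> \<gamma> f = 0) \<and> (\<forall>f\<in>J. eval_mpoly \<iota> \<gamma> f = 0)"
proof -
  interpret e: comm_ring_hom "eval_mpoly \<iota> \<gamma>" by (rule eval_mpoly_comm_ring_hom[OF \<iota>])
  show ?thesis
    using ideal_sum_upper[OF assms(2,3)] by (auto simp: mem_ideal_sum_iff e.hom_add)
qed

lemma upper_set_eq_interval:
  assumes S: "S \<subseteq> {..<m::nat}" and up: "\<And>i j. i \<in> S \<Longrightarrow> i \<le> j \<Longrightarrow> j < m \<Longrightarrow> j \<in> S"
  shows "S = {m - card S..<m}"
proof (cases "S = {}")
  case False
  have fin: "finite S" using S finite_subset by blast
  have "S = {Min S..<m}"
  proof (intro equalityI subsetI)
    fix i assume "i \<in> S"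
    then show "i \<in> {Min S..<m}" using S fin by auto
  next
    fix i assume "i \<in> {Min S..<m}"
    then show "i \<in> S" using up[OF Min_in[OF fin False]] by simp
  qed
  moreover have "Min S < m" using Min_in[OF fin False] S by blast
  ultimately show ?thesis by (metis card_atLeastLessThan diff_diff_cancel less_imp_le)
qed simp

context border_setting begin

abbreviation "vars \<equiv> {..<length ts} \<times> {..<length bs}"

lemma mult_mat_with_eq: "mult_mat_with ts bs c r = num_mat ts bs c r"
  by (simp add: mult_mat_with_def num_mat_def)

lemma num_mat_over:
  fixes c :: "nat \<times> nat \<Rightarrow> 'k::field cpoly"
  assumes "r < n" "\<And>i j. i < length ts \<Longrightarrow> j < length bs \<Longrightarrow> c (i, j) \<in> carrier (poly_ring vars)"
  shows "mat_over vars (num_mat ts bs c r)"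
  unfolding mat_over_def
proof (intro allI impI)
  fix i k assume "i < dim_row (num_mat ts bs c r)" "k < dim_col (num_mat ts bs c r)"
  then have ik: "i < length ts" "k < length ts" by (auto simp: num_mat_def)
  show "num_mat ts bs c r $$ (i, k) \<in> carrier (poly_ring vars)"
    using assms(1) ik(2)
  proof (cases rule: var_cases)
    case (ts m)
    then show ?thesis by (simp add: num_mat_ts[OF ik ts])
  next
    case (bs j)
    then show ?thesis using assms(2) ik by (simp add: num_mat_bs[OF ik bs])
  qed
qed

lemma num_mat_cong:
  assumes "r < n" "\<And>i j. i < length ts \<Longrightarrow> j < length bs \<Longrightarrow> c (i, j) = c' (i, j)"
  shows "num_mat ts bs c r = num_mat ts bs c' r"
proof (rule eq_matI)
  fix i k assume "i < dim_row (num_mat ts bs c' r)" "k < dim_col (num_mat ts bs c' r)"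
  then have ik: "i < length ts" "k < length ts" by (auto simp: num_mat_def)
  show "num_mat ts bs c r $$ (i, k) = num_mat ts bs c' r $$ (i, k)"
    using assms(1) ik(2)
  proof (cases rule: var_cases)
    case (ts m)
    then show ?thesis by (simp add: num_mat_ts[OF ik ts])
  next
    case (bs j)
    then show ?thesis using assms(2) ik by (simp add: num_mat_bs[OF ik bs])
  qed
qed (auto simp: num_mat_def)

lemma cvar_carrier: "i < length ts \<Longrightarrow> j < length bs \<Longrightarrow> cvar (i, j) \<in> carrier (poly_ring vars)"
  by (simp add: cvar_def trm_poly_carrier)

lemma gen_mult_mat_over: "r < n \<Longrightarrow> mat_over vars (gen_mult_mat ts bs r)"
  unfolding gen_mult_mat_def mult_mat_with_eq by (rule num_mat_over) (auto intro: cvar_carrier)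

lemma hom_mult_mat_over: "r < n \<Longrightarrow> mat_over vars (hom_mult_mat ts bs r)"
  unfolding hom_mult_mat_def mult_mat_with_eq by (rule num_mat_over) (auto intro: cvar_carrier)

lemma gen_mult_mat_carrier: "gen_mult_mat ts bs r \<in> carrier_mat (length ts) (length ts)"
  unfolding gen_mult_mat_def mult_mat_with_eq by simp

lemma hom_mult_mat_carrier: "hom_mult_mat ts bs r \<in> carrier_mat (length ts) (length ts)"
  unfolding hom_mult_mat_def mult_mat_with_eq by simp

definition comm_gens :: "'k::field cpoly set" where
  "comm_gens = (\<Union>r<n. \<Union>s<n. elements_mat
     (gen_mult_mat ts bs r * gen_mult_mat ts bs s - gen_mult_mat ts bs s * gen_mult_mat ts bs r))"

definition df_gens :: "'k::field cpoly set" where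
  "df_gens = {cvar (i, j) | i j. i < length ts \<and> j < length bs \<and> tdeg (ts ! i) > tdeg (bs ! j)}"

lemma comm_gens_carrier: "(comm_gens :: 'k::field cpoly set) \<subseteq> carrier (poly_ring vars)"
proof
  fix f :: "'k cpoly" assume "f \<in> comm_gens"
  then obtain r s where rs: "r < n" "s < n"
    and f: "f \<in> elements_mat (gen_mult_mat ts bs r * gen_mult_mat ts bs s - gen_mult_mat ts bs s * gen_mult_mat ts bs r)"
    by (auto simp: comm_gens_def)
  have dims: "dim_row (gen_mult_mat ts bs r) = length ts" "dim_col (gen_mult_mat ts bs r) = length ts"
    for r using gen_mult_mat_carrier[of r] by auto
  have "mat_over vars (gen_mult_mat ts bs r * gen_mult_mat ts bs s - gen_mult_mat ts bs s * gen_mult_mat ts bs r :: 'k cpoly mat)"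
    using rs by (intro mat_over_minus mat_over_mult gen_mult_mat_over) (auto simp: dims)
  then show "f \<in> carrier (poly_ring vars)" using elements_matD[OF f] unfolding mat_over_def by blast
qed

lemma df_gens_carrier: "df_gens \<subseteq> carrier (poly_ring vars)"
  by (auto simp: df_gens_def cvar_carrier)

definition top_indices :: "nat set" where
  "top_indices = {i. i < length ts \<and> tdeg (ts ! i) = tdeg (last ts)}"

lemma top_indices_eq: "top_indices = {length ts - Delta ts..<length ts}"
proof -
  have last: "last ts = ts ! (length ts - 1)" using length_ts_pos by (simp add: last_conv_nth)
  have "top_indices = {length ts - card top_indices..<length ts}"
  proof (rule upper_set_eq_interval)
    fix i j assume ij: "i \<in> top_indices" "i \<le> j" "j < length ts"
    then have "tdeg (ts ! i) \<le> tdeg (ts ! j)" "tdeg (ts ! j) \<le> tdeg (last ts)"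
      using sorted_nth_mono[OF sorted_ts, of i j] sorted_nth_mono[OF sorted_ts, of j "length ts - 1"] last by auto
    then show "j \<in> top_indices" using ij by (simp add: top_indices_def)
  qed (auto simp: top_indices_def)
  then show ?thesis by (simp add: Delta_def top_indices_def)
qed

lemma Delta_pos: "0 < Delta ts"
proof -
  have "length ts - 1 \<in> top_indices"
    using length_ts_pos by (simp add: top_indices_def last_conv_nth)
  moreover have "finite top_indices" by (simp add: top_indices_def)
  ultimately show ?thesis unfolding Delta_def top_indices_def[symmetric] by (auto simp: card_gt_0_iff)
qed

lemma Delta_le: "Delta ts \<le> length ts"
  unfolding Delta_def using card_mono[of "{..<length ts}" "{i. i < length ts \<and> tdeg (ts ! i) = tdeg (last ts)}"] by auto

lemma M_hom_carrier: "M_hom n ts bs t \<in> carrier_mat (length ts) (length ts)"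
  unfolding M_hom_def by (intro eval_trm_mat_carrier hom_mult_mat_carrier)

lemma V_mat_eq:
  assumes "j < Delta ts"
  shows "V_mat n ts bs j = mat (length ts) (length ts) (\<lambda>(k, i). M_hom n ts bs (ts ! i) $$ (length ts - Delta ts + j, k))"
proof (rule eq_matI)
  fix k i
  assume "k < dim_row (mat (length ts) (length ts) (\<lambda>(k, i). M_hom n ts bs (ts ! i) $$ (length ts - Delta ts + j, k)))"
    "i < dim_col (mat (length ts) (length ts) (\<lambda>(k, i). M_hom n ts bs (ts ! i) $$ (length ts - Delta ts + j, k)))"
  then have ki: "k < length ts" "i < length ts" by auto
  have j: "length ts - Delta ts + j < length ts" using assms Delta_le by simp
  show "V_mat n ts bs j $$ (k, i) =
      mat (length ts) (length ts) (\<lambda>(k, i). M_hom n ts bs (ts ! i) $$ (length ts - Delta ts + j, k)) $$ (k, i)"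
    using ki j unfolding V_mat_def by (simp add: mat_of_cols_index carrier_matD[OF M_hom_carrier])
qed (auto simp: V_mat_def)

lemma V_mat_carrier: "V_mat n ts bs j \<in> carrier_mat (length ts) (length ts)"
  by (rule carrier_matI) (simp_all add: V_mat_def)

lemma W_mat_carrier: "(W_mat n ts bs :: 'k::field cpoly mat) \<in> carrier_mat (Delta ts * length ts) (length ts)"
proof -
  let ?Vs = "map (V_mat n ts bs) [0..<Delta ts] :: 'k cpoly mat list"
  have "foldr append_rows ?Vs (0\<^sub>m 0 (length ts)) \<in> carrier_mat (length ?Vs * length ts) (length ts)"
    by (rule foldr_append_rows_carrier) (auto simp: V_mat_carrier)
  then show ?thesis unfolding W_mat_def by simp
qed

lemma W_mat_over: "mat_over vars (W_mat n ts bs :: 'k::field cpoly mat)"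
  unfolding W_mat_def
proof (rule mat_over_foldr_append_rows)
  fix A assume "A \<in> set (map (V_mat n ts bs) [0..<Delta ts] :: 'k cpoly mat list)"
  then obtain j where j: "j < Delta ts" "A = V_mat n ts bs j" by auto
  show "A \<in> carrier_mat (length ts) (length ts)" unfolding j(2) by (rule V_mat_carrier)
  have jl: "length ts - Delta ts + j < length ts" using j(1) Delta_le by simp
  have "mat_over vars (M_hom n ts bs t :: 'k cpoly mat)" for t
    unfolding M_hom_def by (intro mat_over_eval_trm_mat hom_mult_mat_carrier hom_mult_mat_over)
  then have "M_hom n ts bs t $$ (length ts - Delta ts + j, k) \<in> carrier (poly_ring vars :: 'k cpoly ring)"
    if "k < length ts" for t k
    using that jl unfolding mat_over_def carrier_matD[OF M_hom_carrier] by blast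
  then show "mat_over vars A" unfolding j(2) V_mat_eq[OF j(1)] by (simp add: mat_over_def)
qed

lemma I_border_ideal: "ideal (I_border n ts bs :: 'k::field cpoly set) (KC ts bs)"
  unfolding I_border_def comm_gens_def[symmetric] by (rule ring.genideal_ideal[OF poly_ring_ring comm_gens_carrier])

lemma I_df_ideal: "ideal (I_df ts bs :: 'k::field cpoly set) (KC ts bs)"
  unfolding I_df_def df_gens_def[symmetric] by (rule ring.genideal_ideal[OF poly_ring_ring df_gens_carrier])

lemma J_minors_ideal: "ideal (J_minors n ts bs :: 'k::field cpoly set) (KC ts bs)"
  unfolding J_minors_def by (rule ring.genideal_ideal[OF poly_ring_ring maximal_minors_carrier[OF W_mat_over]])

lemma I_border_df_ideal: "ideal (I_border_df n ts bs :: 'k::field cpoly set) (KC ts bs)"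
  unfolding I_border_df_def by (rule ring.add_ideals[OF poly_ring_ring I_border_ideal I_df_ideal])

lemma I_NonSCB_ideal: "ideal (I_NonSCB n ts bs :: 'k::field cpoly set) (KC ts bs)"
  unfolding I_NonSCB_def by (rule ring.add_ideals[OF poly_ring_ring I_border_df_ideal J_minors_ideal])

lemma rational_points_NonSCB_iff:
  fixes \<iota> :: "'k::field \<Rightarrow> 'l::field"
  assumes \<iota>: "field_hom \<iota>"
  defines "e \<equiv> \<lambda>\<Gamma>. eval_mpoly \<iota> (\<lambda>(i, j). \<Gamma> $$ (i, j))"
  shows "\<Gamma> \<in> rational_points \<iota> ts bs (I_NonSCB n ts bs) \<longleftrightarrow>
    \<Gamma> \<in> carrier_mat (length ts) (length bs) \<and> (\<forall>f\<in>comm_gens. e \<Gamma> f = 0) \<and> (\<forall>f\<in>df_gens. e \<Gamma> f = 0) \<and>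
    (\<forall>f\<in>maximal_minors (W_mat n ts bs). e \<Gamma> f = 0)"
proof -
  have "(\<forall>f\<in>I_border n ts bs. e \<Gamma> f = 0) \<longleftrightarrow> (\<forall>f\<in>comm_gens. e \<Gamma> f = 0)"
    unfolding I_border_def comm_gens_def[symmetric] e_def by (rule genideal_vanish_iff[OF \<iota> comm_gens_carrier])
  moreover have "(\<forall>f\<in>I_df ts bs. e \<Gamma> f = 0) \<longleftrightarrow> (\<forall>f\<in>df_gens. e \<Gamma> f = 0)"
    unfolding I_df_def df_gens_def[symmetric] e_def by (rule genideal_vanish_iff[OF \<iota> df_gens_carrier])
  moreover have "(\<forall>f\<in>J_minors n ts bs. e \<Gamma> f = 0) \<longleftrightarrow> (\<forall>f\<in>maximal_minors (W_mat n ts bs). e \<Gamma> f = 0)"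
    unfolding J_minors_def e_def by (rule genideal_vanish_iff[OF \<iota> maximal_minors_carrier[OF W_mat_over]])
  moreover have "(\<forall>f\<in>I_border_df n ts bs. e \<Gamma> f = 0) \<longleftrightarrow>
      (\<forall>f\<in>I_border n ts bs. e \<Gamma> f = 0) \<and> (\<forall>f\<in>I_df ts bs. e \<Gamma> f = 0)"
    unfolding I_border_df_def e_def by (rule ideal_sum_vanish_iff[OF \<iota> I_border_ideal I_df_ideal])
  moreover have "(\<forall>f\<in>I_NonSCB n ts bs. e \<Gamma> f = 0) \<longleftrightarrow>
      (\<forall>f\<in>I_border_df n ts bs. e \<Gamma> f = 0) \<and> (\<forall>f\<in>J_minors n ts bs. e \<Gamma> f = 0)"
    unfolding I_NonSCB_def e_def by (rule ideal_sum_vanish_iff[OF \<iota> I_border_df_ideal J_minors_ideal])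
  ultimately show ?thesis unfolding rational_points_def e_def by (simp only: mem_Collect_eq conj_assoc)
qed

context
  fixes \<iota> :: "'k::field \<Rightarrow> 'l::field" and \<Gamma> :: "'l mat"
  assumes \<iota>: "field_hom \<iota>"
begin

definition ev :: "'k cpoly \<Rightarrow> 'l" where "ev = eval_mpoly \<iota> (\<lambda>(i, j). \<Gamma> $$ (i, j))"

lemma ev_hom: "comm_ring_hom ev"
  unfolding ev_def by (rule eval_mpoly_comm_ring_hom[OF \<iota>])

lemma ev_cvar: "ev (cvar (i, j)) = \<Gamma> $$ (i, j)"
  unfolding ev_def by (simp add: eval_cvar[OF \<iota>])

lemma ev_num_mat: "map_mat ev (num_mat ts bs c r) = num_mat ts bs (\<lambda>p. ev (c p)) r"
proof -
  interpret ev: comm_ring_hom ev by (rule ev_hom)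
  show ?thesis by (rule eq_matI) (auto simp: num_mat_def Let_def)
qed

lemma ev_gen_mult_mat: "map_mat ev (gen_mult_mat ts bs r) = mult_mat \<Gamma> r"
  unfolding gen_mult_mat_def mult_mat_with_eq ev_num_mat
  by (rule arg_cong[of _ _ "\<lambda>c. num_mat ts bs c r"]) (auto simp: fun_eq_iff ev_cvar)

lemma ev_hom_mult_mat:
  assumes "r < n" shows "map_mat ev (hom_mult_mat ts bs r) = mult_mat (hom_point \<Gamma>) r"
proof -
  interpret ev: comm_ring_hom ev by (rule ev_hom)
  show ?thesis
    unfolding hom_mult_mat_def mult_mat_with_eq ev_num_mat
    by (rule num_mat_cong[OF assms]) (simp add: ev_cvar hom_point_entry)
qed

lemma comm_gens_vanish_iff:
  "(\<forall>f\<in>comm_gens. ev f = 0) \<longleftrightarrow> (\<forall>r<n. \<forall>s<n. mult_mat \<Gamma> r * mult_mat \<Gamma> s = mult_mat \<Gamma> s * mult_mat \<Gamma> r)"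
proof -
  interpret ev: comm_ring_hom ev by (rule ev_hom)
  have "(\<forall>f\<in>elements_mat (gen_mult_mat ts bs r * gen_mult_mat ts bs s - gen_mult_mat ts bs s * gen_mult_mat ts bs r). ev f = 0)
    \<longleftrightarrow> mult_mat \<Gamma> r * mult_mat \<Gamma> s = mult_mat \<Gamma> s * mult_mat \<Gamma> r" for r s
  proof -
    let ?A = "gen_mult_mat ts bs r :: 'k cpoly mat" and ?B = "gen_mult_mat ts bs s :: 'k cpoly mat"
    have AB: "?A * ?B \<in> carrier_mat (length ts) (length ts)" and BA: "?B * ?A \<in> carrier_mat (length ts) (length ts)"
      by (rule mult_carrier_mat[OF gen_mult_mat_carrier gen_mult_mat_carrier])+
    have C: "?A * ?B - ?B * ?A \<in> carrier_mat (length ts) (length ts)" using BA by (rule minus_carrier_mat)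
    have "map_mat ev (?A * ?B) = mult_mat \<Gamma> r * mult_mat \<Gamma> s" "map_mat ev (?B * ?A) = mult_mat \<Gamma> s * mult_mat \<Gamma> r"
      by (simp_all add: ev.mat_hom_mult[OF gen_mult_mat_carrier gen_mult_mat_carrier] ev_gen_mult_mat)
    note [symmetric] = this
    have "(\<forall>f\<in>elements_mat (?A * ?B - ?B * ?A). ev f = 0) \<longleftrightarrow>
        (\<forall>i<length ts. \<forall>j<length ts. ev ((?A * ?B - ?B * ?A) $$ (i, j)) = 0)"
    proof
      assume "\<forall>f\<in>elements_mat (?A * ?B - ?B * ?A). ev f = 0"
      then show "\<forall>i<length ts. \<forall>j<length ts. ev ((?A * ?B - ?B * ?A) $$ (i, j)) = 0"
        using elements_matI[OF C] by blast
    next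
      assume L: "\<forall>i<length ts. \<forall>j<length ts. ev ((?A * ?B - ?B * ?A) $$ (i, j)) = 0"
      show "\<forall>f\<in>elements_mat (?A * ?B - ?B * ?A). ev f = 0"
      proof
        fix f assume "f \<in> elements_mat (?A * ?B - ?B * ?A)"
        then obtain i j where "i < length ts" "j < length ts" "f = (?A * ?B - ?B * ?A) $$ (i, j)"
          using elements_matD carrier_matD[OF C] by metis
        then show "ev f = 0" using L by blast
      qed
    qed
    also have "\<dots> \<longleftrightarrow> (\<forall>i<length ts. \<forall>j<length ts. map_mat ev (?A * ?B) $$ (i, j) = map_mat ev (?B * ?A) $$ (i, j))"
      using carrier_matD[OF AB] carrier_matD[OF BA] by (simp add: ev.hom_minus del: index_mult_mat(1))
    also have "\<dots> \<longleftrightarrow> map_mat ev (?A * ?B) = map_mat ev (?B * ?A)"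
    proof
      assume "\<forall>i<length ts. \<forall>j<length ts. map_mat ev (?A * ?B) $$ (i, j) = map_mat ev (?B * ?A) $$ (i, j)"
      then show "map_mat ev (?A * ?B) = map_mat ev (?B * ?A)"
        using carrier_matD[OF AB] carrier_matD[OF BA] by (intro eq_matI) simp_all
    qed simp
    finally show ?thesis
      by (simp only: ev.mat_hom_mult[OF gen_mult_mat_carrier gen_mult_mat_carrier] ev_gen_mult_mat)
  qed
  then show ?thesis unfolding comm_gens_def by (simp only: ball_simps UN_iff lessThan_iff Ball_def) blast
qed

lemma df_gens_vanish_iff:
  "(\<forall>f\<in>df_gens. ev f = 0) \<longleftrightarrow>
    (\<forall>i<length ts. \<forall>j<length bs. tdeg (ts ! i) > tdeg (bs ! j) \<longrightarrow> \<Gamma> $$ (i, j) = 0)"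
  unfolding df_gens_def ev_cvar[symmetric] by blast

lemma df_border_point_iff:
  "df_border_point n ts bs \<Gamma> \<longleftrightarrow> (\<forall>f\<in>comm_gens. ev f = 0) \<and> (\<forall>f\<in>df_gens. ev f = 0)"
proof -
  have "border_setting n ts bs" by unfold_locales
  then show ?thesis
    unfolding comm_gens_vanish_iff df_gens_vanish_iff df_border_point_def border_point_def
      border_point_axioms_def df_border_point_axioms_def by blast
qed

text \<open>The rows of the block with index \<open>j\<close> of the matrix \<open>W\<close> compute the coordinate with index
  \<open>\<mu> - \<Delta> + j\<close> of the products \<open>f t\<^sub>k\<close> modulo \<open>DF(I\<^sub>\<Gamma>)\<close>, where \<open>f\<close> is the combination of \<open>t\<^sub>1, \<dots>, t\<^sub>\<mu>\<close> with the
  given coefficients.\<close>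

lemma W_kernel_iff:
  assumes "df_border_point n ts bs \<Gamma>" and v: "v \<in> carrier_vec (length ts)"
  shows "map_mat ev (W_mat n ts bs) *\<^sub>v v = 0\<^sub>v (Delta ts * length ts) \<longleftrightarrow>
    (\<forall>k<length ts. \<forall>l<length ts. tdeg (ts ! l) = tdeg (last ts) \<longrightarrow>
      border_point.phi n ts bs (hom_point \<Gamma>) (comb (($) v) * trm_poly (ts ! k)) l = 0)"
proof -
  interpret ev: comm_ring_hom ev by (rule ev_hom)
  interpret g: graded_point n ts bs \<Gamma> using assms(1) by (rule graded_point.intro)
  have M: "map_mat ev (M_hom n ts bs t) = g.H.trm_mat t" for t
  proof -
    have "map_mat ev (M_hom n ts bs t) = eval_trm_mat n (length ts) (\<lambda>r. map_mat ev (hom_mult_mat ts bs r)) t"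
      unfolding M_hom_def by (rule ev.eval_trm_mat_hom) (rule hom_mult_mat_carrier)
    also have "\<dots> = g.H.trm_mat t"
      unfolding g.H.trm_mat_def by (rule eval_trm_mat_cong) (rule ev_hom_mult_mat)
    finally show ?thesis .
  qed
  have V: "map_mat ev (V_mat n ts bs j) *\<^sub>v v = 0\<^sub>v (length ts) \<longleftrightarrow>
      (\<forall>k<length ts. g.H.phi (comb (($) v) * trm_poly (ts ! k)) (length ts - Delta ts + j) = 0)"
    if j: "j < Delta ts" for j
  proof -
    let ?l = "length ts - Delta ts + j"
    have l: "?l < length ts" using j Delta_le by simp
    have "(map_mat ev (V_mat n ts bs j) *\<^sub>v v) $ k = g.H.phi (comb (($) v) * trm_poly (ts ! k)) ?l"
      if k: "k < length ts" for k
    proof -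
      have entry: "ev (M_hom n ts bs (ts ! i) $$ (?l, k)) = g.H.phi (trm_poly (ts ! i) * trm_poly (ts ! k)) ?l"
        if i: "i < length ts" for i
      proof -
        have "ev (M_hom n ts bs (ts ! i) $$ (?l, k)) = map_mat ev (M_hom n ts bs (ts ! i)) $$ (?l, k)"
          using k l by (simp add: carrier_matD[OF M_hom_carrier])
        then show ?thesis unfolding M using g.H.trm_mat_eq_phi[OF keys_ts[OF i] l k] by simp
      qed
      have "(map_mat ev (V_mat n ts bs j) *\<^sub>v v) $ k =
          (\<Sum>i<length ts. ev (M_hom n ts bs (ts ! i) $$ (?l, k)) * v $ i)"
        unfolding V_mat_eq[OF j] using k v by (auto simp: scalar_prod_def lessThan_atLeast0)
      also have "\<dots> = (\<Sum>i<length ts. v $ i * g.H.phi (trm_poly (ts ! i) * trm_poly (ts ! k)) ?l)"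
        by (rule sum.cong) (auto simp: entry)
      also have "\<dots> = g.H.phi (comb (($) v) * trm_poly (ts ! k)) ?l"
        unfolding comb_def sum_distrib_right mult.assoc g.H.phi_sum g.H.phi_const_mult ..
      finally show ?thesis .
    qed
    moreover have "dim_vec (map_mat ev (V_mat n ts bs j) *\<^sub>v v) = length ts"
      using carrier_matD[OF V_mat_carrier[of j]] by simp
    ultimately show ?thesis by (auto simp: vec_eq_iff)
  qed
  let ?Vs = "map (map_mat ev) (map (V_mat n ts bs) [0..<Delta ts])"
  have "map_mat ev (W_mat n ts bs) = foldr append_rows ?Vs (0\<^sub>m 0 (length ts))"
    unfolding W_mat_def by (rule ev.foldr_append_rows_hom) (auto simp: V_mat_carrier)
  moreover have "foldr append_rows ?Vs (0\<^sub>m 0 (length ts)) *\<^sub>v v = 0\<^sub>v (length ?Vs * length ts) \<longleftrightarrow>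
      (\<forall>V\<in>set ?Vs. V *\<^sub>v v = 0\<^sub>v (length ts))"
    by (rule foldr_append_rows_kernel[OF _ v]) (auto simp: V_mat_carrier)
  moreover have set_Vs: "(\<forall>V\<in>set ?Vs. V *\<^sub>v v = 0\<^sub>v (length ts)) \<longleftrightarrow>
      (\<forall>j<Delta ts. map_mat ev (V_mat n ts bs j) *\<^sub>v v = 0\<^sub>v (length ts))"
    by auto
  ultimately have "map_mat ev (W_mat n ts bs) *\<^sub>v v = 0\<^sub>v (Delta ts * length ts) \<longleftrightarrow>
      (\<forall>j<Delta ts. map_mat ev (V_mat n ts bs j) *\<^sub>v v = 0\<^sub>v (length ts))"
    unfolding set_Vs by simp
  also have "\<dots> \<longleftrightarrow> (\<forall>j<Delta ts. \<forall>k<length ts.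
      g.H.phi (comb (($) v) * trm_poly (ts ! k)) (length ts - Delta ts + j) = 0)"
    using V by blast
  also have "\<dots> \<longleftrightarrow> (\<forall>k<length ts. \<forall>l\<in>{length ts - Delta ts..<length ts}.
      g.H.phi (comb (($) v) * trm_poly (ts ! k)) l = 0)" (is "?L \<longleftrightarrow> ?R")
  proof
    assume L: ?L
    show ?R
    proof (intro allI impI ballI)
      fix k l assume k: "k < length ts" and l: "l \<in> {length ts - Delta ts..<length ts}"
      then have "l - (length ts - Delta ts) < Delta ts" "length ts - Delta ts + (l - (length ts - Delta ts)) = l"
        using Delta_le by auto
      then show "g.H.phi (comb (($) v) * trm_poly (ts ! k)) l = 0" using L k by metis
    qed
  next
    assume R: ?R
    show ?L
    proof (intro allI impI)
      fix j k assume "j < Delta ts" "k < length ts"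
      moreover from this have "length ts - Delta ts + j \<in> {length ts - Delta ts..<length ts}"
        using Delta_le by auto
      ultimately show "g.H.phi (comb (($) v) * trm_poly (ts ! k)) (length ts - Delta ts + j) = 0"
        using R by blast
    qed
  qed
  finally show ?thesis unfolding top_indices_eq[symmetric] top_indices_def by blast
qed

lemma minors_vanish_iff:
  assumes pt: "df_border_point n ts bs \<Gamma>"
  shows "(\<forall>f\<in>maximal_minors (W_mat n ts bs). ev f = 0) \<longleftrightarrow> \<not> strict_cayley_bacharach n (I_pt n ts bs \<Gamma>)"
proof -
  interpret ev: comm_ring_hom ev by (rule ev_hom)
  interpret g: graded_point n ts bs \<Gamma> using pt by (rule graded_point.intro)
  let ?W = "map_mat ev (W_mat n ts bs)"
  have W: "?W \<in> carrier_mat (Delta ts * length ts) (length ts)"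
    by (simp add: W_mat_carrier)
  have len: "length ts \<le> Delta ts * length ts" using Delta_pos by simp
  let ?Q = "\<lambda>c. \<forall>k<length ts. \<forall>l<length ts. tdeg (ts ! l) = tdeg (last ts) \<longrightarrow>
      g.H.phi (comb c * trm_poly (ts ! k)) l = 0"
  have "(\<forall>f\<in>maximal_minors (W_mat n ts bs). ev f = 0) \<longleftrightarrow> (\<forall>B\<in>maximal_minors ?W. B = 0)"
    unfolding ev.maximal_minors_hom by blast
  also have "\<dots> \<longleftrightarrow> (\<exists>v\<in>carrier_vec (length ts). v \<noteq> 0\<^sub>v (length ts) \<and> ?W *\<^sub>v v = 0\<^sub>v (Delta ts * length ts))"
    by (rule maximal_minors_zero_iff[OF W len])
  also have "\<dots> \<longleftrightarrow> (\<exists>v\<in>carrier_vec (length ts). v \<noteq> 0\<^sub>v (length ts) \<and> ?Q (($) v))"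
    using W_kernel_iff[OF pt] by blast
  also have "\<dots> \<longleftrightarrow> (\<exists>c. (\<exists>i<length ts. c i \<noteq> 0) \<and> ?Q c)"
  proof
    assume "\<exists>v\<in>carrier_vec (length ts). v \<noteq> 0\<^sub>v (length ts) \<and> ?Q (($) v)"
    then obtain v where v: "v \<in> carrier_vec (length ts)" "v \<noteq> 0\<^sub>v (length ts)" "?Q (($) v)" by blast
    have "\<exists>i<length ts. v $ i \<noteq> 0"
    proof (rule ccontr)
      assume "\<not> (\<exists>i<length ts. v $ i \<noteq> 0)"
      then have "v = 0\<^sub>v (length ts)" using v(1) by (intro eq_vecI) auto
      then show False using v(2) by simp
    qed
    then show "\<exists>c. (\<exists>i<length ts. c i \<noteq> 0) \<and> ?Q c" using v(3) by (intro exI[of _ "($) v"] conjI)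
  next
    assume "\<exists>c. (\<exists>i<length ts. c i \<noteq> 0) \<and> ?Q c"
    then obtain c where c: "\<exists>i<length ts. c i \<noteq> 0" "?Q c" by blast
    have "comb (($) (vec (length ts) c)) = comb c" unfolding comb_def by (rule sum.cong) auto
    then have "?Q (($) (vec (length ts) c))" using c(2) by simp
    moreover have "vec (length ts) c \<noteq> 0\<^sub>v (length ts)"
    proof
      assume *: "vec (length ts) c = 0\<^sub>v (length ts)"
      obtain i where "i < length ts" "c i \<noteq> 0" using c(1) by blast
      then show False using arg_cong[OF *, of "\<lambda>v. v $ i"] by simp
    qed
    ultimately show "\<exists>v\<in>carrier_vec (length ts). v \<noteq> 0\<^sub>v (length ts) \<and> ?Q (($) v)"
      by (intro bexI[of _ "vec (length ts) c"] conjI) auto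
  qed
  also have "\<dots> \<longleftrightarrow> \<not> strict_cayley_bacharach n (I_pt n ts bs \<Gamma>)"
    unfolding g.not_strict_cayley_bacharach_iff g.top_deg_def ..
  finally show ?thesis .
qed

lemma NonSCB_point_iff:
  "\<Gamma> \<in> rational_points \<iota> ts bs (I_NonSCB n ts bs) \<longleftrightarrow>
    \<Gamma> \<in> carrier_mat (length ts) (length bs) \<and> df_border_point n ts bs \<Gamma> \<and>
    \<not> strict_cayley_bacharach n (I_pt n ts bs \<Gamma>)"
  unfolding rational_points_NonSCB_iff[OF \<iota>] ev_def[symmetric]
  using df_border_point_iff minors_vanish_iff by blast

end

lemma NonSCB_points:
  fixes \<iota> :: "'k::field \<Rightarrow> 'l::field"
  assumes \<iota>: "field_hom \<iota>"
  shows "I_pt n ts bs ` rational_points \<iota> ts bs (I_NonSCB n ts bs) =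
    {I. zero_dim_scheme n I \<and> df_border_basis n ts I \<and> \<not> strict_cayley_bacharach n I}"
proof (intro equalityI subsetI)
  fix I assume "I \<in> I_pt n ts bs ` rational_points \<iota> ts bs (I_NonSCB n ts bs)"
  then obtain \<Gamma> where \<Gamma>: "\<Gamma> \<in> rational_points \<iota> ts bs (I_NonSCB n ts bs)" "I = I_pt n ts bs \<Gamma>" by blast
  then have pt: "df_border_point n ts bs \<Gamma>" and cb: "\<not> strict_cayley_bacharach n I"
    using NonSCB_point_iff[OF \<iota>] by blast+
  show "I \<in> {I. zero_dim_scheme n I \<and> df_border_basis n ts I \<and> \<not> strict_cayley_bacharach n I}"
    using df_border_point.zero_dim_scheme_I_pt[OF pt] df_border_point.df_border_basis_I_pt[OF pt] cb \<Gamma>(2) by simp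
next
  fix I :: "(nat, 'l) mpoly set"
  assume "I \<in> {I. zero_dim_scheme n I \<and> df_border_basis n ts I \<and> \<not> strict_cayley_bacharach n I}"
  then have I: "ideal I (PR n)" "df_border_basis n ts I" "\<not> strict_cayley_bacharach n I"
    by (auto simp: zero_dim_scheme_def)
  obtain \<Gamma> where "\<Gamma> \<in> carrier_mat (length ts) (length bs)" "df_border_point n ts bs \<Gamma>" "I = I_pt n ts bs \<Gamma>"
    using df_border_basis_imp_point[OF I(1,2)] by metis
  then show "I \<in> I_pt n ts bs ` rational_points \<iota> ts bs (I_NonSCB n ts bs)"
    using I(3) NonSCB_point_iff[OF \<iota>] by blast
qed

end

theorem mainTheorem3:
  fixes n :: nat and ts bs :: "nat trm list" and \<iota> :: "'k::field \<Rightarrow> 'l::field"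
  assumes "order_ideal n (set ts)" and "distinct ts" and "sorted (map tdeg ts)"
    and "set bs = border n (set ts)" and "distinct bs"
    and "field_hom \<iota>"
  shows "ideal (I_NonSCB n ts bs :: 'k cpoly set) (KC ts bs) \<and>
    (I_border_df n ts bs :: 'k cpoly set) \<subseteq> I_NonSCB n ts bs \<and>
    I_pt n ts bs ` rational_points (id :: 'k \<Rightarrow> 'k) ts bs (I_NonSCB n ts bs) =
      {I. zero_dim_scheme n I \<and> df_border_basis n ts I \<and> \<not> strict_cayley_bacharach n I} \<and>
    I_pt n ts bs ` rational_points \<iota> ts bs (I_NonSCB n ts bs) =
      {I. zero_dim_scheme n I \<and> df_border_basis n ts I \<and> \<not> strict_cayley_bacharach n I}"
proof -
  interpret border_setting n ts bs using assms(1-5) by unfold_locales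
  have id: "field_hom (id :: 'k \<Rightarrow> 'k)" by unfold_locales auto
  show ?thesis
    using I_NonSCB_ideal ideal_sum_upper(1)[OF I_border_df_ideal J_minors_ideal]
      NonSCB_points[OF id] NonSCB_points[OF assms(6)]
    unfolding I_NonSCB_def[symmetric] by blast
qed

end
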